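(* Let $\mu$ be a locally finite Borel measure on $\mathbb{R}^n$, let $\mathscr{D}$ be a dyadic system on $\mathbb{R}^n$, and let $\mathscr{M}$ be the associated Rademacher maximal operator with respect to $\mu$. The following conditions are equivalent for any Banach space $X$: (i) $\mathscr{M}:L^p(\mu;X)\to L^p(\mu)$ for all $p\in(1,\infty)$; that is, for every $p\in(1,\infty)$ there is a constant $C$ with $\|\mathscr{M}f\|_{L^p(\mu)}\le C\|f\|_{L^p(\mu;X)}$ for all $f\in L^p(\mu;X)$; (ii) $\mathscr{M}:L^p(\mu;X)\to L^p(\mu)$ for some $p\in(1,\infty)$; that is, for some $p\in(1,\infty)$ there is a constant $C$ with $\|\mathscr{M}f\|_{L^p(\mu)}\le C\|f\|_{L^p(\mu;X)}$ for all $f\in L^p(\mu;X)$; (iii) $\mathscr{M}:L^1(\mu;X)\to L^{1,\infty}(\mu)$; that is, there is a constant $C$ with $\mu(\{x\in\mathbb{R}^n:\mathscr{M}f(x)>\lambda\})\le\frac{C}{\lambda}\|f\|_{L^1(\mu;X)}$ for all $f\in L^1(\mu;X)$ and $\lambda>0$.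
   Context: Dyadic system: $\mathscr{D}=\bigcup_{k\in\mathbb{Z}}\mathscr{D}_k$, where each $\mathscr{D}_k$ is a partition of $\mathbb{R}^n$ into (half-open, axis-parallel) cubes of sidelength $2^{-k}$ and every $Q\in\mathscr{D}_k$ is a union of $2^n$ cubes of $\mathscr{D}_{k+1}$. R-bound: let $(\varepsilon_k)$ be independent random variables taking values $+1$ and $-1$, each with probability $1/2$, and let $\mathbb{E}$ denote expectation. For $S\subset X$, the R-bound $\mathscr{R}(S)\in[0,\infty]$ is the smallest $C$ such that $\big(\mathbb{E}\|\sum_k\varepsilon_k\lambda_k\xi_k\|^2\big)^{1/2}\le C\big(\sum_k|\lambda_k|^2\big)^{1/2}$ for all finite families of vectors $\xi_k\in S$ and scalars $\lambda_k$ ($\mathscr{R}(S)=\infty$ if no such $C$ exists). For $f:\mathbb{R}^n\to X$ locally Bochner integrable with respect to $\mu$ and $Q\in\mathscr{D}$, $\langle f\rangle_Q=\frac{1}{\mu(Q)}\int_Q f\,d\mu$, with $\langle f\rangle_Q=0$ if $\mu(Q)=0$. The Rademacher maximal function is $\mathscr{M}f(x)=\mathscr{R}(\langle f\rangle_Q: Q\in\mathscr{D},\,Q\ni x)$, $x\in\mathbb{R}^n$. $L^p(\mu;X)$ is the Lebesgue–Bochner space of $X$-valued functions on $(\mathbb{R}^n,\mu)$. *)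

theory Defs
  imports "HOL-Probability.Probability"
begin

subsection \<open>Banach spaces over the real or the complex field\<close>

text \<open>A Banach space over the scalar field \<open>'k\<close> is a type of class \<open>banach\<close> with a scalar
  multiplication \<open>smul\<close> extending \<open>(*\<^sub>R)\<close>. Up to isomorphism the only types of sort
  \<open>{real_normed_field, euclidean_space}\<close> are \<open>real\<close> and \<open>complex\<close>, both of which are instances.\<close>

definition banach_scaling ::
    "('k::{real_normed_field, euclidean_space} \<Rightarrow> 'a::banach \<Rightarrow> 'a) \<Rightarrow> bool" where
  "banach_scaling smul \<longleftrightarrow>
     vector_space smul \<and>
     (\<forall>c x. norm (smul c x) = norm c * norm x) \<and>
     (\<forall>r x. smul (of_real r) x = r *\<^sub>R x)"


subsection \<open>Bochner integral and Lebesgue--Bochner spaces\<close>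

text \<open>The library's \<open>has_bochner_integral\<close> and \<open>lebesgue_integral\<close> require a second countable
  target. For an arbitrary Banach space, Borel measurability has to be replaced by strong
  measurability; otherwise the definition of the integral is the same.\<close>

definition strongly_measurable :: "'s measure \<Rightarrow> ('s \<Rightarrow> 'a::real_normed_vector) \<Rightarrow> bool" where
  "strongly_measurable M f \<longleftrightarrow>
     (\<exists>s. (\<forall>i. simple_function M (s i)) \<and> (AE x in M. (\<lambda>i. s i x) \<longlonglongrightarrow> f x))"

definition has_strong_integral ::
    "'s measure \<Rightarrow> ('s \<Rightarrow> 'a::real_normed_vector) \<Rightarrow> 'a \<Rightarrow> bool" where
  "has_strong_integral M f v \<longleftrightarrow>
     strongly_measurable M f \<and>
     (\<exists>s. (\<forall>i. Bochner_Integration.simple_bochner_integrable M (s i)) \<and>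
          (\<lambda>i. \<integral>\<^sup>+ x. ennreal (norm (f x - s i x)) \<partial>M) \<longlonglongrightarrow> 0 \<and>
          (\<lambda>i. Bochner_Integration.simple_bochner_integral M (s i)) \<longlonglongrightarrow> v)"

definition strong_integral :: "'s measure \<Rightarrow> ('s \<Rightarrow> 'a::real_normed_vector) \<Rightarrow> 'a" where
  "strong_integral M f =
     (if \<exists>v. has_strong_integral M f v then THE v. has_strong_integral M f v else 0)"

text \<open>Used for exponents \<open>p > 0\<close> only.\<close>

definition ennreal_powr :: "ennreal \<Rightarrow> real \<Rightarrow> ennreal" where
  "ennreal_powr t p = (if t = \<infinity> then \<infinity> else ennreal (enn2real t powr p))"

definition Lp_norm :: "'s measure \<Rightarrow> real \<Rightarrow> ('s \<Rightarrow> ennreal) \<Rightarrow> ennreal" where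
  "Lp_norm M p g = ennreal_powr (\<integral>\<^sup>+ x. ennreal_powr (g x) p \<partial>M) (1 / p)"

definition Lp_norm_vec :: "'s measure \<Rightarrow> real \<Rightarrow> ('s \<Rightarrow> 'a::real_normed_vector) \<Rightarrow> ennreal" where
  "Lp_norm_vec M p f = Lp_norm M p (\<lambda>x. ennreal (norm (f x)))"

definition Lp_vec :: "'s measure \<Rightarrow> real \<Rightarrow> ('s \<Rightarrow> 'a::real_normed_vector) set" where
  "Lp_vec M p = {f. strongly_measurable M f \<and> Lp_norm_vec M p f < \<infinity>}"


subsection \<open>R-boundedness\<close>

definition rademacher_signs :: "nat \<Rightarrow> (nat \<Rightarrow> real) pmf" where
  "rademacher_signs N = Pi_pmf {..<N} 0 (\<lambda>_. pmf_of_set {-1, 1})"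

text \<open>The constant \<open>\<infinity>\<close> is always admissible (\<open>\<infinity> * 0 = 0\<close> in \<open>ennreal\<close>), so the infimum is \<open>\<infinity>\<close>
  precisely if there is no finite admissible constant. The vectors \<open>\<xi> k\<close> need not be distinct.\<close>

definition R_bound ::
    "('k::{real_normed_field, euclidean_space} \<Rightarrow> 'a::banach \<Rightarrow> 'a) \<Rightarrow> 'a set \<Rightarrow> ennreal" where
  "R_bound smul S =
     Inf {C. \<forall>N (\<xi>::nat \<Rightarrow> 'a) (c::nat \<Rightarrow> 'k). (\<forall>k<N. \<xi> k \<in> S) \<longrightarrow>
       ennreal (sqrt (measure_pmf.expectation (rademacher_signs N)
                  (\<lambda>\<epsilon>. (norm (\<Sum>k<N. \<epsilon> k *\<^sub>R smul (c k) (\<xi> k)))\<^sup>2)))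
       \<le> C * ennreal (sqrt (\<Sum>k<N. (norm (c k))\<^sup>2))}"


subsection \<open>Dyadic systems, locally finite measures and the maximal function\<close>

definition half_open_cube :: "real \<Rightarrow> (real ^ 'n) set \<Rightarrow> bool" where
  "half_open_cube l Q \<longleftrightarrow> (\<exists>a. Q = {x. \<forall>i. a $ i \<le> x $ i \<and> x $ i < a $ i + l})"

definition dyadic_system :: "(int \<Rightarrow> (real ^ 'n) set set) \<Rightarrow> bool" where
  "dyadic_system D \<longleftrightarrow>
     (\<forall>k. partition_on UNIV (D k) \<and>
          (\<forall>Q\<in>D k. half_open_cube (2 powi (- k)) Q \<and>
                   (\<exists>F\<subseteq>D (k + 1). card F = 2 ^ CARD('n) \<and> Q = \<Union>F)))"

definition locally_finite_borel :: "('s::topological_space) measure \<Rightarrow> bool" where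
  "locally_finite_borel M \<longleftrightarrow>
     sets M = sets borel \<and> (\<forall>x. \<exists>U. open U \<and> x \<in> U \<and> emeasure M U < \<infinity>)"

definition average :: "'s measure \<Rightarrow> ('s \<Rightarrow> 'a::banach) \<Rightarrow> 's set \<Rightarrow> 'a" where
  "average M f Q =
     (if emeasure M Q = 0 then 0
      else (1 / measure M Q) *\<^sub>R strong_integral M (\<lambda>x. indicator Q x *\<^sub>R f x))"

text \<open>For a dyadic system and a locally finite Borel measure this function of \<open>x\<close> is always Borel
  measurable: it is the supremum over \<open>m\<close> of the R-bounds of the averages over the cubes of
  generations \<open>-m, \<dots>, m\<close>, and those are constant on each of the countably many cubes of
  generation \<open>m\<close>.\<close>

definition rademacher_maximal ::
    "('k::{real_normed_field, euclidean_space} \<Rightarrow> 'a::banach \<Rightarrow> 'a) \<Rightarrow> (real ^ 'n) measure \<Rightarrow>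
     (int \<Rightarrow> (real ^ 'n) set set) \<Rightarrow> (real ^ 'n \<Rightarrow> 'a) \<Rightarrow> real ^ 'n \<Rightarrow> ennreal" where
  "rademacher_maximal smul M D f x = R_bound smul {average M f Q |Q. Q \<in> (\<Union>k. D k) \<and> x \<in> Q}"

definition maximal_strong_type ::
    "('k::{real_normed_field, euclidean_space} \<Rightarrow> 'a::banach \<Rightarrow> 'a) \<Rightarrow> (real ^ 'n) measure \<Rightarrow>
     (int \<Rightarrow> (real ^ 'n) set set) \<Rightarrow> real \<Rightarrow> bool" where
  "maximal_strong_type smul M D p \<longleftrightarrow>
     (\<exists>C::real. \<forall>f\<in>Lp_vec M p.
        Lp_norm M p (rademacher_maximal smul M D f) \<le> ennreal C * Lp_norm_vec M p f)"

definition maximal_weak_type ::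
    "('k::{real_normed_field, euclidean_space} \<Rightarrow> 'a::banach \<Rightarrow> 'a) \<Rightarrow> (real ^ 'n) measure \<Rightarrow>
     (int \<Rightarrow> (real ^ 'n) set set) \<Rightarrow> bool" where
  "maximal_weak_type smul M D \<longleftrightarrow>
     (\<exists>C::real. \<forall>f\<in>Lp_vec M 1. \<forall>t::real. t > 0 \<longrightarrow>
        emeasure M {x. rademacher_maximal smul M D f x > ennreal t}
          \<le> ennreal (C / t) * Lp_norm_vec M 1 f)"

end

theory Submission
  imports Defs
begin

text \<open>
  \<^emph>\<open>Weak type implies strong type.\<close> If the maximal function restricted to the generations
  \<open>\<ge> b\<close> first exceeds \<open>t\<close> on a cube of generation \<open>k\<close>, then the R-bound of the averages over its
  proper ancestors is at most \<open>t\<close>, and the remaining averages do not see \<open>f\<close> outside the cube. Hence, by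
  subadditivity of the R-bound, the weak type inequality localizes to
  \<open>\<mu>{M f > 2t} \<le> C/t \<integral>{M f > t} |f| d\<mu>\<close>, and the strong type follows as in Doob's inequality.

  \<^emph>\<open>Strong type implies weak type.\<close> As \<open>\<mu>\<close> need not be doubling, the average of \<open>f\<close> over a
  stopping cube is not controlled by \<open>t\<close>, and the Calderon--Zygmund decomposition is replaced by one in the style of
  Gundy. The martingale \<open>f\<^sub>k\<close> of averages is stopped as soon as the average of \<open>|f|\<close> or the
  compensator \<open>A\<^sub>k\<close> of the sizes of the first big averages exceeds \<open>t\<close>; this happens on a set of measure at most
  \<open>2 \<parallel>f\<parallel>\<^sub>1 / t\<close>. If the overshooting values \<open>v\<^sub>j\<^sub>+\<^sub>1\<close> are replaced by their conditional expectations
  \<open>e\<^sub>j\<close> one generation earlier, one obtains a martingale \<open>S\<close> that is bounded by \<open>2t\<close> with \<open>L\<^sup>1\<close>-norm at most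
  \<open>4 \<parallel>f\<parallel>\<^sub>1\<close>, to which the strong type applies. Where nothing has been stopped, \<open>f\<^sub>k = S\<^sub>k - \<Sum>j<k. e\<^sub>j\<close>,
  and the R-bound of the partial sums is at most \<open>\<Sum>j. |e\<^sub>j| \<le> A\<^sub>n \<le> t\<close>.
\<close>

section \<open>The strong integral\<close>

text \<open>Generations run over all integers, and averages need not tend to 0 as the cubes grow,
  for instance if the measure is finite. There is thus no initial value for a stopping argument:
  both directions are proved for generations \<open>b\<close>, ..., \<open>b + n\<close> with
  constants free of \<open>b\<close> and \<open>n\<close>, and the full operator is the increasing
  limit of such windows.

  The R-bound of a set is not controlled by the sizes of its vectors. The argument uses that it
  grows with the set, is subadditive, is at most the norm for a single vector, and is determined by
  finite subfamilies. The bound for a single vector is where orthogonality of the signs enters.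

  What makes the compensator useful is predictability: on generation \<open>k\<close> it already
  contains the expected jump of generation \<open>k + 1\<close>, so one can stop before it does
  harm. The bound \<open>2 * t\<close> for S is \<open>t\<close> for the stopped average plus
  \<open>t\<close> for the accumulated drift.

  The target space may be nonseparable. Apart from \<open>f\<close> itself, the stopping
  construction involves only functions that are constant on the cubes of some generation; they take
  countably many values, so their measurability is elementary.\<close>

lemma strongly_measurable_simple:
  "simple_function M f \<Longrightarrow> strongly_measurable M f"
  unfolding strongly_measurable_def by (rule exI[of _ "\<lambda>_. f"]) auto

lemma strongly_measurable_add:
  assumes "strongly_measurable M f" "strongly_measurable M g"
  shows "strongly_measurable M (\<lambda>x. f x + g x)"
proof -
  obtain s t where s: "\<And>i. simple_function M (s i)" "AE x in M. (\<lambda>i. s i x) \<longlonglongrightarrow> f x"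
    and t: "\<And>i. simple_function M (t i)" "AE x in M. (\<lambda>i. t i x) \<longlonglongrightarrow> g x"
    using assms unfolding strongly_measurable_def by auto
  have "AE x in M. (\<lambda>i. s i x + t i x) \<longlonglongrightarrow> f x + g x"
    using s(2) t(2) by eventually_elim (rule tendsto_add)
  then show ?thesis unfolding strongly_measurable_def
    by (intro exI[of _ "\<lambda>i x. s i x + t i x"]) (auto intro: simple_function_compose2 s t)
qed

lemma strongly_measurable_scaleR:
  fixes r :: "'s \<Rightarrow> real"
  assumes "strongly_measurable M f" and r: "simple_function M r"
  shows "strongly_measurable M (\<lambda>x. r x *\<^sub>R f x)"
proof -
  obtain s where s: "\<And>i. simple_function M (s i)" "AE x in M. (\<lambda>i. s i x) \<longlonglongrightarrow> f x"
    using assms unfolding strongly_measurable_def by auto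
  have "AE x in M. (\<lambda>i. r x *\<^sub>R s i x) \<longlonglongrightarrow> r x *\<^sub>R f x"
    using s(2) by eventually_elim (intro tendsto_intros)
  then show ?thesis unfolding strongly_measurable_def
    by (intro exI[of _ "\<lambda>i x. r x *\<^sub>R s i x"]) (auto intro: simple_function_compose2 s r)
qed

lemma strongly_measurable_diff_simple:
  assumes "strongly_measurable M f" "simple_function M s"
  shows "strongly_measurable M (\<lambda>x. f x - s x)"
  using strongly_measurable_add[OF assms(1) strongly_measurable_simple[OF
        simple_function_compose1[OF assms(2), of uminus]]] by simp

lemma strongly_measurable_cong_AE:
  assumes "AE x in M. f x = g x"
  shows "strongly_measurable M f \<longleftrightarrow> strongly_measurable M g"
proof -
  have "(AE x in M. (\<lambda>i. s i x) \<longlonglongrightarrow> f x) \<longleftrightarrow> (AE x in M. (\<lambda>i. s i x) \<longlonglongrightarrow> g x)" for s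
  proof
    assume "AE x in M. (\<lambda>i. s i x) \<longlonglongrightarrow> f x"
    with assms show "AE x in M. (\<lambda>i. s i x) \<longlonglongrightarrow> g x" by eventually_elim simp
  next
    assume "AE x in M. (\<lambda>i. s i x) \<longlonglongrightarrow> g x"
    with assms show "AE x in M. (\<lambda>i. s i x) \<longlonglongrightarrow> f x" by eventually_elim simp
  qed
  then show ?thesis unfolding strongly_measurable_def by simp
qed

text \<open>As the measure need not be complete, a function that is merely an almost everywhere
  limit of simple functions can have a non-measurable norm. Setting everything to 0 on a null set
  gives a version that is a limit at every point.\<close>

lemma strongly_measurable_obtain_limit:
  assumes "strongly_measurable M f"
  obtains s g where "\<forall>i. simple_function M (s i)" "\<forall>x\<in>space M. (\<lambda>i. s i x) \<longlonglongrightarrow> g x"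
    "AE x in M. f x = g x"
proof -
  obtain s where s: "\<And>i. simple_function M (s i)" "AE x in M. (\<lambda>i. s i x) \<longlonglongrightarrow> f x"
    using assms unfolding strongly_measurable_def by auto
  obtain N where N: "N \<in> null_sets M" "{x\<in>space M. \<not> (\<lambda>i. s i x) \<longlonglongrightarrow> f x} \<subseteq> N"
    using s(2) by (auto simp: eventually_ae_filter)
  let ?I = "\<lambda>x. indicator (space M - N) x :: real"
  show thesis
  proof
    show "\<forall>i. simple_function M (\<lambda>x. ?I x *\<^sub>R s i x)"
      using N by (intro allI simple_function_compose2[OF simple_function_indicator s(1)]) auto
    show "\<forall>x\<in>space M. (\<lambda>i. ?I x *\<^sub>R s i x) \<longlonglongrightarrow> ?I x *\<^sub>R f x"
    proof
      fix x assume x: "x \<in> space M"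
      show "(\<lambda>i. ?I x *\<^sub>R s i x) \<longlonglongrightarrow> ?I x *\<^sub>R f x"
      proof (cases "x \<in> N")
        case False
        then have "(\<lambda>i. s i x) \<longlonglongrightarrow> f x" using x N(2) by blast
        then show ?thesis by (intro tendsto_intros)
      qed simp
    qed
    show "AE x in M. f x = ?I x *\<^sub>R f x"
      using AE_not_in[OF N(1)] AE_space by eventually_elim (simp add: indicator_def)
  qed
qed

lemma limit_simple_norm_measurable:
  assumes "\<And>i. simple_function M (s i)" "\<And>x. x \<in> space M \<Longrightarrow> (\<lambda>i. s i x) \<longlonglongrightarrow> g x"
  shows "(\<lambda>x. norm (g x)) \<in> borel_measurable M"
proof (rule borel_measurable_LIMSEQ_real)
  show "(\<lambda>i. norm (s i x)) \<longlonglongrightarrow> norm (g x)" if "x \<in> space M" for x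
    using assms(2)[OF that] by (intro tendsto_intros)
  show "(\<lambda>x. norm (s i x)) \<in> borel_measurable M" for i
    using assms(1)[of i] by (rule borel_measurable_simple_function[OF simple_function_compose1])
qed

text \<open>The measurable stand-in \<open>u\<close> is what additivity of the nonnegative integral
  is applied to.\<close>

lemma strongly_measurable_norm:
  assumes "strongly_measurable M f"
  obtains u where "u \<in> borel_measurable M" "\<And>x. (0::real) \<le> u x" "AE x in M. norm (f x) = u x"
proof -
  obtain s g where *: "\<forall>i. simple_function M (s i)" "\<forall>x\<in>space M. (\<lambda>i. s i x) \<longlonglongrightarrow> g x"
    "AE x in M. f x = g x" by (rule strongly_measurable_obtain_limit[OF assms])
  show thesis
    by (rule that[of "\<lambda>x. norm (g x)"]) (use limit_simple_norm_measurable[of M s g] * in auto)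
qed

lemma nn_integral_norm_le_add:
  assumes f: "strongly_measurable M f" and g: "strongly_measurable M g"
    and le: "\<And>x. x \<in> space M \<Longrightarrow> norm (h x) \<le> norm (f x) + norm (g x)"
  shows "(\<integral>\<^sup>+x. norm (h x) \<partial>M) \<le> (\<integral>\<^sup>+x. norm (f x) \<partial>M) + (\<integral>\<^sup>+x. norm (g x) \<partial>M)"
proof -
  obtain u where u: "u \<in> borel_measurable M" "\<And>x. (0::real) \<le> u x" "AE x in M. norm (f x) = u x"
    using strongly_measurable_norm[OF f] by blast
  obtain v where v: "v \<in> borel_measurable M" "\<And>x. (0::real) \<le> v x" "AE x in M. norm (g x) = v x"
    using strongly_measurable_norm[OF g] by blast
  have "(\<integral>\<^sup>+x. norm (h x) \<partial>M) \<le> (\<integral>\<^sup>+x. ennreal (u x) + ennreal (v x) \<partial>M)"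
  proof (rule nn_integral_mono_AE)
    show "AE x in M. ennreal (norm (h x)) \<le> ennreal (u x) + ennreal (v x)"
      using u(3) v(3) AE_space
    proof eventually_elim
      case (elim x)
      have "ennreal (norm (h x)) \<le> ennreal (u x + v x)"
        using le[OF elim(3)] elim(1,2) by (intro ennreal_leI) simp
      then show ?case using u(2) v(2) by simp
    qed
  qed
  also have "\<dots> = (\<integral>\<^sup>+x. u x \<partial>M) + (\<integral>\<^sup>+x. v x \<partial>M)"
    using u(1) v(1) by (intro nn_integral_add) auto
  also have "(\<integral>\<^sup>+x. u x \<partial>M) = (\<integral>\<^sup>+x. norm (f x) \<partial>M)"
    by (intro nn_integral_cong_AE) (use u(3) in \<open>eventually_elim, simp\<close>)
  also have "(\<integral>\<^sup>+x. v x \<partial>M) = (\<integral>\<^sup>+x. norm (g x) \<partial>M)"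
    by (intro nn_integral_cong_AE) (use v(3) in \<open>eventually_elim, simp\<close>)
  finally show ?thesis .
qed

section \<open>Approximation by simple functions in the mean\<close>

abbreviation "simple_integrable \<equiv> Bochner_Integration.simple_bochner_integrable"
abbreviation "simple_integral_vec \<equiv> Bochner_Integration.simple_bochner_integral"

lemma simple_integral_norm_le:
  assumes "simple_integrable M s"
  shows "ennreal (norm (simple_integral_vec M s)) \<le> (\<integral>\<^sup>+x. norm (s x) \<partial>M)"
proof -
  have "simple_integrable M (\<lambda>x. norm (s x))"
    using Bochner_Integration.simple_bochner_integrable_compose2[of "\<lambda>x y. norm x" M s s] assms by simp
  then have "ennreal (simple_integral_vec M (\<lambda>x. norm (s x))) = (\<integral>\<^sup>+x. norm (s x) \<partial>M)"
    by (intro simple_bochner_integral_eq_nn_integral) auto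
  then show ?thesis
    using simple_bochner_integral_norm_bound[OF assms] by (metis ennreal_leI)
qed

lemma simple_integrable_add:
  "simple_integrable M s \<Longrightarrow> simple_integrable M t \<Longrightarrow> simple_integrable M (\<lambda>x. s x + t x)"
  by (rule Bochner_Integration.simple_bochner_integrable_compose2) auto

lemma simple_integrable_diff:
  "simple_integrable M s \<Longrightarrow> simple_integrable M t \<Longrightarrow> simple_integrable M (\<lambda>x. s x - t x)"
  by (rule Bochner_Integration.simple_bochner_integrable_compose2) auto

lemma simple_integrable_simple: "simple_integrable M s \<Longrightarrow> simple_function M s"
  by (auto elim: Bochner_Integration.simple_bochner_integrable.cases)

text \<open>The triangle inequality through \<open>f\<close>. It shows that two approximating
  sequences have the same limit, that an approximating sequence has Cauchy integrals and, with
  \<open>t\<close> equal to 0, that the integral is bounded by the integral of the norm.\<close>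

lemma simple_integral_dist_le:
  assumes f: "strongly_measurable M f" and s: "simple_integrable M s" and t: "simple_integrable M t"
  shows "ennreal (norm (simple_integral_vec M s - simple_integral_vec M t)) \<le>
    (\<integral>\<^sup>+x. norm (f x - s x) \<partial>M) + (\<integral>\<^sup>+x. norm (f x - t x) \<partial>M)"
proof -
  have "ennreal (norm (simple_integral_vec M s - simple_integral_vec M t))
      \<le> (\<integral>\<^sup>+x. norm (s x - t x) \<partial>M)"
    using simple_integral_norm_le[OF simple_integrable_diff[OF s t]]
    by (simp add: simple_bochner_integral_diff[OF s t])
  also have "\<dots> \<le> (\<integral>\<^sup>+x. norm (f x - s x) \<partial>M) + (\<integral>\<^sup>+x. norm (f x - t x) \<partial>M)"
    using f s t norm_triangle_ineq4[of "f x - t x" "f x - s x" for x]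
    by (intro nn_integral_norm_le_add strongly_measurable_diff_simple simple_integrable_simple)
       (auto simp: algebra_simps)
  finally show ?thesis .
qed

lemma has_strong_integral_unique:
  assumes "has_strong_integral M f v" "has_strong_integral M f w"
  shows "v = w"
proof -
  obtain s where s: "\<And>i. simple_integrable M (s i)"
      "(\<lambda>i. \<integral>\<^sup>+x. ennreal (norm (f x - s i x)) \<partial>M) \<longlonglongrightarrow> 0"
      "(\<lambda>i. simple_integral_vec M (s i)) \<longlonglongrightarrow> v" and f: "strongly_measurable M f"
    using assms(1) unfolding has_strong_integral_def by auto
  obtain t where t: "\<And>i. simple_integrable M (t i)"
      "(\<lambda>i. \<integral>\<^sup>+x. ennreal (norm (f x - t i x)) \<partial>M) \<longlonglongrightarrow> 0"
      "(\<lambda>i. simple_integral_vec M (t i)) \<longlonglongrightarrow> w"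
    using assms(2) unfolding has_strong_integral_def by auto
  have "(\<lambda>i. ennreal (norm (simple_integral_vec M (s i) - simple_integral_vec M (t i))))
      \<longlonglongrightarrow> ennreal (norm (v - w))"
    by (intro tendsto_ennrealI tendsto_intros s t)
  moreover have "(\<lambda>i. (\<integral>\<^sup>+x. norm (f x - s i x) \<partial>M) + (\<integral>\<^sup>+x. norm (f x - t i x) \<partial>M)) \<longlonglongrightarrow> 0 + 0"
    by (intro tendsto_add s t)
  ultimately have "ennreal (norm (v - w)) \<le> 0 + 0"
    by (rule LIMSEQ_le) (use simple_integral_dist_le[OF f s(1) t(1)] in auto)
  then show ?thesis by simp
qed

lemma strong_integral_eq: "has_strong_integral M f v \<Longrightarrow> strong_integral M f = v"
  unfolding strong_integral_def by (auto intro!: the_equality intro: has_strong_integral_unique)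

lemma has_strong_integral_cong_AE:
  assumes "AE x in M. f x = g x"
  shows "has_strong_integral M f v \<longleftrightarrow> has_strong_integral M g v"
proof -
  have "(\<integral>\<^sup>+x. ennreal (norm (f x - t x)) \<partial>M) = (\<integral>\<^sup>+x. ennreal (norm (g x - t x)) \<partial>M)" for t
    by (intro nn_integral_cong_AE) (use assms in \<open>eventually_elim, simp\<close>)
  then show ?thesis
    unfolding has_strong_integral_def strongly_measurable_cong_AE[OF assms] by simp
qed

lemma strong_integral_cong_AE:
  "AE x in M. f x = g x \<Longrightarrow> strong_integral M f = strong_integral M g"
  unfolding strong_integral_def using has_strong_integral_cong_AE[of f g M] by presburger

lemma has_strong_integral_add:
  assumes "has_strong_integral M f v" "has_strong_integral M g w"
  shows "has_strong_integral M (\<lambda>x. f x + g x) (v + w)"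
proof -
  obtain s where s: "\<And>i. simple_integrable M (s i)"
      "(\<lambda>i. \<integral>\<^sup>+x. ennreal (norm (f x - s i x)) \<partial>M) \<longlonglongrightarrow> 0"
      "(\<lambda>i. simple_integral_vec M (s i)) \<longlonglongrightarrow> v" and f: "strongly_measurable M f"
    using assms(1) unfolding has_strong_integral_def by auto
  obtain t where t: "\<And>i. simple_integrable M (t i)"
      "(\<lambda>i. \<integral>\<^sup>+x. ennreal (norm (g x - t i x)) \<partial>M) \<longlonglongrightarrow> 0"
      "(\<lambda>i. simple_integral_vec M (t i)) \<longlonglongrightarrow> w" and g: "strongly_measurable M g"
    using assms(2) unfolding has_strong_integral_def by auto
  have le: "(\<integral>\<^sup>+x. norm (f x + g x - (s i x + t i x)) \<partial>M)
      \<le> (\<integral>\<^sup>+x. norm (f x - s i x) \<partial>M) + (\<integral>\<^sup>+x. norm (g x - t i x) \<partial>M)" for i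
    using f g s(1) t(1) norm_triangle_ineq[of "f x - s i x" "g x - t i x" for x]
    by (intro nn_integral_norm_le_add strongly_measurable_diff_simple simple_integrable_simple)
       (auto simp: algebra_simps)
  have "(\<lambda>i. (\<integral>\<^sup>+x. norm (f x - s i x) \<partial>M) + (\<integral>\<^sup>+x. norm (g x - t i x) \<partial>M)) \<longlonglongrightarrow> 0 + 0"
    by (intro tendsto_add s t)
  then have lim: "(\<lambda>i. (\<integral>\<^sup>+x. norm (f x + g x - (s i x + t i x)) \<partial>M)) \<longlonglongrightarrow> 0"
    using le tendsto_sandwich[of "\<lambda>_. 0" "\<lambda>i. (\<integral>\<^sup>+x. norm (f x + g x - (s i x + t i x)) \<partial>M)"
        sequentially "\<lambda>i. (\<integral>\<^sup>+x. norm (f x - s i x) \<partial>M) + (\<integral>\<^sup>+x. norm (g x - t i x) \<partial>M)" 0] by simp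
  have "(\<lambda>i. simple_integral_vec M (\<lambda>x. s i x + t i x)) \<longlonglongrightarrow> v + w"
    using tendsto_add[OF s(3) t(3)] by (simp add: simple_bochner_integral_add[OF s(1) t(1)])
  then show ?thesis unfolding has_strong_integral_def
    using lim simple_integrable_add[OF s(1) t(1)] strongly_measurable_add[OF f g]
    by (intro conjI exI[of _ "\<lambda>i x. s i x + t i x"]) simp_all
qed

lemma has_strong_integral_simple:
  assumes "simple_integrable M s"
  shows "has_strong_integral M s (simple_integral_vec M s)"
  unfolding has_strong_integral_def
  using assms
  by (intro conjI strongly_measurable_simple simple_integrable_simple exI[of _ "\<lambda>_. s"]) simp_all

lemma has_strong_integral_indicator:
  assumes "A \<in> sets M" "emeasure M A < \<infinity>"
  shows "has_strong_integral M (\<lambda>x. indicator A x *\<^sub>R c) (measure M A *\<^sub>R c)"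
proof -
  have i: "simple_integrable M (indicator A :: _ \<Rightarrow> real)"
  proof
    have "{y \<in> space M. (indicator A y::real) \<noteq> 0} = A"
      using sets.sets_into_space[OF assms(1)] by (auto split: split_indicator)
    then show "emeasure M {y \<in> space M. (indicator A y::real) \<noteq> 0} \<noteq> \<infinity>" using assms(2) by auto
  qed (rule simple_function_indicator assms)+
  \<comment> \<open>The integral of the real indicator is its measure; the linear map
    \<open>\<lambda>r. r *\<^sub>R c\<close> carries this over to the vector
    \<open>c\<close>.\<close>
  have "linear (\<lambda>r. r *\<^sub>R c)" by (simp add: linear_iff algebra_simps)
  then have 1: "simple_integral_vec M (\<lambda>x. indicator A x *\<^sub>R c) = simple_integral_vec M (indicator A) *\<^sub>R c"
    using i by (rule simple_bochner_integral_linear)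
  have 2: "simple_integral_vec M (indicator A) = measure M A"
    using has_bochner_integral_real_indicator[OF assms]
      has_bochner_integral_simple_bochner_integrable[OF i] by (rule has_bochner_integral_eq[symmetric])
  have "simple_integrable M (\<lambda>x. indicator A x *\<^sub>R c)"
    using Bochner_Integration.simple_bochner_integrable_compose2[of "\<lambda>x y. x *\<^sub>R c" M "indicator A" "indicator A :: _ \<Rightarrow> real"] i
    by simp
  from has_strong_integral_simple[OF this] show ?thesis by (simp add: 1 2)
qed

lemma has_strong_integral_zero: "has_strong_integral M (\<lambda>x. 0) 0"
  using has_strong_integral_indicator[of "{}" M 0] by simp

lemma has_strong_integral_sum:
  assumes "\<And>i. i \<in> I \<Longrightarrow> has_strong_integral M (f i) (v i)"
  shows "has_strong_integral M (\<lambda>x. \<Sum>i\<in>I. f i x) (\<Sum>i\<in>I. v i)"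
  using assms
proof (induction I rule: infinite_finite_induct)
  case (insert i I)
  then show ?case using has_strong_integral_add[of M "f i" "v i"] by simp
qed (simp_all add: has_strong_integral_zero)

lemma has_strong_integral_norm_le:
  assumes "has_strong_integral M f v"
  shows "ennreal (norm v) \<le> (\<integral>\<^sup>+x. norm (f x) \<partial>M)"
proof -
  obtain s where s: "\<And>i. simple_integrable M (s i)"
      "(\<lambda>i. \<integral>\<^sup>+x. ennreal (norm (f x - s i x)) \<partial>M) \<longlonglongrightarrow> 0"
      "(\<lambda>i. simple_integral_vec M (s i)) \<longlonglongrightarrow> v" and f: "strongly_measurable M f"
    using assms(1) unfolding has_strong_integral_def by auto
  have le: "ennreal (norm (simple_integral_vec M (s i)))
     \<le> (\<integral>\<^sup>+x. norm (f x - s i x) \<partial>M) + (\<integral>\<^sup>+x. norm (f x) \<partial>M)" for i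
  proof -
    have "simple_integrable M (\<lambda>_. 0 :: 'b)" by (simp add: Bochner_Integration.simple_bochner_integrable.simps)
    moreover have "simple_integral_vec M (\<lambda>_. 0 :: 'b) = 0"
      unfolding simple_bochner_integral_def by (intro sum.neutral) auto
    ultimately show ?thesis
      using simple_integral_dist_le[OF f s(1)[of i], of "\<lambda>_. 0"] by simp
  qed
  have "(\<lambda>i. ennreal (norm (simple_integral_vec M (s i)))) \<longlonglongrightarrow> ennreal (norm v)"
    by (intro tendsto_ennrealI tendsto_intros s)
  moreover have "(\<lambda>i. (\<integral>\<^sup>+x. norm (f x - s i x) \<partial>M) + (\<integral>\<^sup>+x. norm (f x) \<partial>M)) \<longlonglongrightarrow> 0 + (\<integral>\<^sup>+x. norm (f x) \<partial>M)"
    by (intro tendsto_add s tendsto_const)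
  ultimately have "ennreal (norm v) \<le> 0 + (\<integral>\<^sup>+x. norm (f x) \<partial>M)"
    by (rule LIMSEQ_le) (use le in auto)
  then show ?thesis by simp
qed

text \<open>Completeness enters here: dominated convergence makes the integrals of suitable simple
  functions a Cauchy sequence.\<close>

lemma has_strong_integral_exists:
  fixes f :: "'s \<Rightarrow> 'a::banach"
  assumes f: "strongly_measurable M f" and fin: "(\<integral>\<^sup>+x. norm (f x) \<partial>M) < \<infinity>"
  shows "\<exists>v. has_strong_integral M f v"
proof -
  obtain s g where sg: "\<forall>i. simple_function M (s i)" "\<forall>x\<in>space M. (\<lambda>i. s i x) \<longlonglongrightarrow> g x"
    and fg: "AE x in M. f x = g x" by (rule strongly_measurable_obtain_limit[OF f])
  have s: "simple_function M (s i)" "x \<in> space M \<Longrightarrow> (\<lambda>i. s i x) \<longlonglongrightarrow> g x" for i x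
    using sg by blast+
  have g: "strongly_measurable M g" using f strongly_measurable_cong_AE[OF fg] by simp
  have gm[measurable]: "(\<lambda>x. norm (g x)) \<in> borel_measurable M"
    by (rule limit_simple_norm_measurable[OF s])
  have gfin: "(\<integral>\<^sup>+x. norm (g x) \<partial>M) < \<infinity>"
  proof -
    have "(\<integral>\<^sup>+x. norm (f x) \<partial>M) = (\<integral>\<^sup>+x. norm (g x) \<partial>M)"
      by (intro nn_integral_cong_AE) (use fg in \<open>eventually_elim, simp\<close>)
    then show ?thesis using fin by simp
  qed
  \<comment> \<open>Cutting off at twice the norm of the limit dominates the approximations by an
    integrable function. The cut-off is eventually inactive where \<open>g x\<close> is nonzero and
    forces the value 0 where \<open>g x\<close> vanishes, so convergence survives.\<close>
  define B where "B i = {x\<in>space M. norm (s i x) \<le> 2 * norm (g x)}" for i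
  have [measurable]: "(\<lambda>x. norm (s i x)) \<in> borel_measurable M" for i
    using s(1)[of i] by (rule borel_measurable_simple_function[OF simple_function_compose1])
  have B[measurable]: "B i \<in> sets M" for i unfolding B_def by measurable
  define t where "t i x = indicator (B i) x *\<^sub>R s i x" for i x
  have t_simple: "simple_function M (t i)" for i
    unfolding t_def by (rule simple_function_compose2[OF simple_function_indicator[OF B] s(1)])
  have t_le: "norm (t i x) \<le> 2 * norm (g x)" if "x \<in> space M" for i x
    using that by (auto simp: t_def B_def indicator_def)
  have t_lim: "(\<lambda>i. t i x) \<longlonglongrightarrow> g x" if x: "x \<in> space M" for x
  proof (cases "g x = 0")
    case True
    then have "t i x = 0" for i using t_le[OF x, of i] by simp
    with True show ?thesis by simp
  next
    case False
    have "(\<lambda>i. norm (s i x)) \<longlonglongrightarrow> norm (g x)" using s(2)[OF x] by (intro tendsto_intros)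
    then have "eventually (\<lambda>i. norm (s i x) < 2 * norm (g x)) sequentially"
      using False by (intro order_tendstoD) auto
    then have "eventually (\<lambda>i. s i x = t i x) sequentially"
      by eventually_elim (use x in \<open>auto simp: t_def B_def indicator_def\<close>)
    then show ?thesis using s(2)[OF x] by (rule Lim_transform_eventually[rotated])
  qed
  have fin2: "(\<integral>\<^sup>+x. ennreal (c * norm (g x)) \<partial>M) < \<infinity>" if "c \<ge> 0" for c
    using gfin that by (simp add: ennreal_mult nn_integral_cmult ennreal_mult_less_top)
  have t_int: "simple_integrable M (t i)" for i
  proof (rule Bochner_Integration.simple_bochner_integrableI_bounded[OF t_simple])
    have "(\<integral>\<^sup>+x. norm (t i x) \<partial>M) \<le> (\<integral>\<^sup>+x. ennreal (2 * norm (g x)) \<partial>M)"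
      using t_le by (intro nn_integral_mono ennreal_leI) auto
    then show "(\<integral>\<^sup>+x. norm (t i x) \<partial>M) < \<infinity>" using fin2[of 2] by (auto simp: le_less_trans)
  qed
  have lim0: "(\<lambda>i. \<integral>\<^sup>+x. ennreal (norm (g x - t i x)) \<partial>M) \<longlonglongrightarrow> (\<integral>\<^sup>+x. ennreal 0 \<partial>M)"
  proof (rule nn_integral_dominated_convergence[where w="\<lambda>x. ennreal (3 * norm (g x))"])
    show "(\<lambda>x. ennreal (norm (g x - t i x))) \<in> borel_measurable M" for i
    proof (intro measurable_compose[OF _ measurable_ennreal] limit_simple_norm_measurable)
      show "simple_function M (\<lambda>x. s j x - t i x)" for j
        by (rule simple_function_compose2[OF s(1) t_simple])
      show "(\<lambda>j. s j x - t i x) \<longlonglongrightarrow> g x - t i x" if "x \<in> space M" for x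
        using s(2)[OF that] by (intro tendsto_intros)
    qed
    show "AE x in M. ennreal (norm (g x - t i x)) \<le> ennreal (3 * norm (g x))" for i
      using AE_space
    proof eventually_elim
      case (elim x)
      then show ?case using t_le[OF elim, of i] norm_triangle_ineq4[of "g x" "t i x"]
        by (intro ennreal_leI) linarith
    qed
    show "AE x in M. (\<lambda>i. ennreal (norm (g x - t i x))) \<longlonglongrightarrow> ennreal 0"
      using AE_space
    proof eventually_elim
      case (elim x)
      have "(\<lambda>i. norm (g x - t i x)) \<longlonglongrightarrow> norm (g x - g x)"
        by (intro tendsto_intros t_lim elim)
      then show ?case by (intro tendsto_ennrealI) simp
    qed
  qed (use fin2 in auto)
  then have lim: "(\<lambda>i. \<integral>\<^sup>+x. ennreal (norm (g x - t i x)) \<partial>M) \<longlonglongrightarrow> 0" by simp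
  have "Cauchy (\<lambda>i. simple_integral_vec M (t i))"
  proof (rule metric_CauchyI)
    fix e :: real assume "e > 0"
    then have "eventually (\<lambda>i. (\<integral>\<^sup>+x. ennreal (norm (g x - t i x)) \<partial>M) < ennreal (e/2)) sequentially"
      using lim by (intro order_tendstoD) auto
    then obtain N where N: "\<And>i. i \<ge> N \<Longrightarrow> (\<integral>\<^sup>+x. ennreal (norm (g x - t i x)) \<partial>M) < ennreal (e/2)"
      by (auto simp: eventually_sequentially)
    have "dist (simple_integral_vec M (t i)) (simple_integral_vec M (t j)) < e" if "i \<ge> N" "j \<ge> N" for i j
    proof -
      have "ennreal (norm (simple_integral_vec M (t i) - simple_integral_vec M (t j))) < ennreal (e/2) + ennreal (e/2)"
        using simple_integral_dist_le[OF g t_int t_int, of i j] add_strict_mono[OF N[OF that(1)] N[OF that(2)]]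
        by (rule le_less_trans)
      also have "\<dots> = ennreal e" using \<open>e > 0\<close> by (simp flip: ennreal_plus)
      finally show ?thesis using \<open>e > 0\<close> by (simp add: dist_norm ennreal_less_iff)
    qed
    then show "\<exists>N. \<forall>m\<ge>N. \<forall>n\<ge>N. dist (simple_integral_vec M (t m)) (simple_integral_vec M (t n)) < e" by blast
  qed
  then obtain v where "(\<lambda>i. simple_integral_vec M (t i)) \<longlonglongrightarrow> v"
    using Cauchy_convergent_iff convergent_def by blast
  then have "has_strong_integral M g v"
    unfolding has_strong_integral_def using g t_int lim by blast
  then show ?thesis using has_strong_integral_cong_AE[OF fg] by blast
qed

section \<open>R-bounds\<close>

definition rademacher_norm ::
    "('k::{real_normed_field, euclidean_space} \<Rightarrow> 'a::banach \<Rightarrow> 'a) \<Rightarrow> nat \<Rightarrow> (nat \<Rightarrow> 'k) \<Rightarrow> (nat \<Rightarrow> 'a) \<Rightarrow> real" where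
  "rademacher_norm smul N c \<xi> = sqrt (measure_pmf.expectation (rademacher_signs N)
     (\<lambda>\<epsilon>. (norm (\<Sum>k<N. \<epsilon> k *\<^sub>R smul (c k) (\<xi> k)))\<^sup>2))"

lemma finite_set_rademacher_signs: "finite (set_pmf (rademacher_signs N))"
proof -
  have "set_pmf (rademacher_signs N) \<subseteq> PiE_dflt {..<N} 0 (\<lambda>_. {-1, 1})"
    unfolding rademacher_signs_def by (subst set_Pi_pmf) (auto simp: set_pmf_of_set)
  then show ?thesis by (rule finite_subset) (intro finite_PiE_dflt, auto)
qed

text \<open>Minkowski's inequality on a finite probability space: with the weights
  \<open>sqrt (pmf p e)\<close> absorbed into the entries, the expectations become finite Euclidean
  norms.\<close>

lemma sqrt_expectation_norm_add_le:
  fixes a b :: "'e \<Rightarrow> 'a::real_normed_vector"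
  assumes fin: "finite (set_pmf p)"
  shows "sqrt (measure_pmf.expectation p (\<lambda>e. (norm (a e + b e))\<^sup>2)) \<le>
    sqrt (measure_pmf.expectation p (\<lambda>e. (norm (a e))\<^sup>2)) + sqrt (measure_pmf.expectation p (\<lambda>e. (norm (b e))\<^sup>2))"
proof -
  have eq: "sqrt (measure_pmf.expectation p (\<lambda>e. (norm (f e))\<^sup>2)) = L2_set (\<lambda>e. sqrt (pmf p e) * norm (f e)) (set_pmf p)"
    for f :: "'e \<Rightarrow> 'a"
    using integral_measure_pmf[OF fin, of p "\<lambda>e. (norm (f e))\<^sup>2"]
    by (simp add: L2_set_def power_mult_distrib)
  have "L2_set (\<lambda>e. sqrt (pmf p e) * norm (a e + b e)) (set_pmf p)
      \<le> L2_set (\<lambda>e. sqrt (pmf p e) * norm (a e) + sqrt (pmf p e) * norm (b e)) (set_pmf p)"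
    by (intro L2_set_mono) (auto simp: norm_triangle_ineq mult_left_mono simp flip: distrib_left)
  also have "\<dots> \<le> L2_set (\<lambda>e. sqrt (pmf p e) * norm (a e)) (set_pmf p) + L2_set (\<lambda>e. sqrt (pmf p e) * norm (b e)) (set_pmf p)"
    by (rule L2_set_triangle_ineq)
  finally show ?thesis unfolding eq .
qed

lemma rademacher_signs_Suc:
  "rademacher_signs (Suc N) =
     pmf_of_set {-1, 1} \<bind> (\<lambda>y. map_pmf (\<lambda>f. f(N := y)) (rademacher_signs N))"
  unfolding rademacher_signs_def lessThan_Suc
  by (subst Pi_pmf_insert') (auto simp: map_pmf_def)

text \<open>Condition on the last sign and apply the parallelogram law to the sum of the earlier
  terms and \<open>c N\<close>. This uses the inner product of the scalar field; a general Banach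
  space has no such identity.\<close>

lemma expectation_rademacher_orthogonal:
  fixes c :: "nat \<Rightarrow> 'k::euclidean_space"
  shows "measure_pmf.expectation (rademacher_signs N) (\<lambda>\<epsilon>. (norm (\<Sum>k<N. \<epsilon> k *\<^sub>R c k))\<^sup>2) = (\<Sum>k<N. (norm (c k))\<^sup>2)"
proof (induction N)
  case (Suc N)
  let ?E = "measure_pmf.expectation (rademacher_signs N)"
  let ?S = "\<lambda>\<epsilon>. \<Sum>k<N. \<epsilon> k *\<^sub>R c k"
  note int = integrable_measure_pmf_finite[OF finite_set_rademacher_signs[of N]]
  have "measure_pmf.expectation (rademacher_signs (Suc N)) (\<lambda>\<epsilon>. (norm (\<Sum>k<Suc N. \<epsilon> k *\<^sub>R c k))\<^sup>2)
    = (\<Sum>y\<in>{-1,1}. ?E (\<lambda>\<epsilon>. (norm (?S \<epsilon> + y *\<^sub>R c N))\<^sup>2)) / 2"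
    unfolding rademacher_signs_Suc
    by (subst pmf_expectation_bind_pmf_of_set) (auto simp: finite_set_rademacher_signs)
  also have "\<dots> = (?E (\<lambda>\<epsilon>. (norm (?S \<epsilon> - c N))\<^sup>2) + ?E (\<lambda>\<epsilon>. (norm (?S \<epsilon> + c N))\<^sup>2)) / 2"
    by simp
  also have "\<dots> = ?E (\<lambda>\<epsilon>. (norm (?S \<epsilon> - c N))\<^sup>2 + (norm (?S \<epsilon> + c N))\<^sup>2) / 2"
    by (subst Bochner_Integration.integral_add) (auto intro: int)
  also have "(\<lambda>\<epsilon>. (norm (?S \<epsilon> - c N))\<^sup>2 + (norm (?S \<epsilon> + c N))\<^sup>2) = (\<lambda>\<epsilon>. 2 * (norm (?S \<epsilon>))\<^sup>2 + 2 * (norm (c N))\<^sup>2)"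
    by (simp add: power2_norm_eq_inner inner_diff_left inner_diff_right inner_add_left inner_add_right inner_commute)
  also have "?E \<dots> = 2 * ?E (\<lambda>\<epsilon>. (norm (?S \<epsilon>))\<^sup>2) + 2 * (norm (c N))\<^sup>2"
    by (subst Bochner_Integration.integral_add) (auto intro: int)
  finally show ?case using Suc by simp
qed (simp add: rademacher_signs_def)

locale banach_scaled =
  fixes smul :: "'k::{real_normed_field, euclidean_space} \<Rightarrow> 'a::banach \<Rightarrow> 'a"
  assumes banach_scaling: "banach_scaling smul"
begin

sublocale vector_space smul using banach_scaling unfolding banach_scaling_def by blast

lemma norm_smul: "norm (smul c x) = norm c * norm x"
  using banach_scaling unfolding banach_scaling_def by blast

lemma scaleR_smul: "r *\<^sub>R smul c x = smul (r *\<^sub>R c) x"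
  using banach_scaling unfolding banach_scaling_def
  by (metis scale_scale scaleR_conv_of_real)

abbreviation "R \<equiv> R_bound smul"

lemma R_bound_leI:
  assumes "\<And>N \<xi> c. (\<And>k. k < N \<Longrightarrow> \<xi> k \<in> S) \<Longrightarrow>
    ennreal (rademacher_norm smul N c \<xi>) \<le> C * ennreal (sqrt (\<Sum>k<N. (norm (c k))\<^sup>2))"
  shows "R S \<le> C"
  unfolding R_bound_def using assms unfolding rademacher_norm_def by (intro Inf_lower) blast

text \<open>The infimum defining the R-bound is itself admissible: an inequality for every constant
  \<open>C\<close> passes to the infimum after division by the Euclidean norm of the scalars. If all
  scalars vanish, division is impossible but the left side is 0.\<close>

lemma rademacher_norm_le:
  assumes "\<And>k. k < N \<Longrightarrow> \<xi> k \<in> S"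
  shows "ennreal (rademacher_norm smul N c \<xi>) \<le> R S * ennreal (sqrt (\<Sum>k<N. (norm (c k))\<^sup>2))"
proof (cases "(\<Sum>k<N. (norm (c k))\<^sup>2) = 0")
  case True
  then have "\<forall>k<N. c k = 0" by (simp add: sum_nonneg_eq_0_iff)
  then have "rademacher_norm smul N c \<xi> = 0" by (simp add: rademacher_norm_def)
  then show ?thesis by simp
next
  case False
  let ?X = "ennreal (rademacher_norm smul N c \<xi>)" and ?y = "ennreal (sqrt (\<Sum>k<N. (norm (c k))\<^sup>2))"
  have "(\<Sum>k<N. (norm (c k))\<^sup>2) > 0" using False sum_nonneg[of "{..<N}" "\<lambda>k. (norm (c k))\<^sup>2"] by simp
  then have y: "?y \<noteq> 0" "?y \<noteq> top" by simp_all
  have "?X / ?y \<le> R S"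
    unfolding R_bound_def
  proof (rule Inf_greatest, safe)
    fix C assume "\<forall>N \<xi> (c::nat \<Rightarrow> 'k). (\<forall>k<N. \<xi> k \<in> S) \<longrightarrow>
       ennreal (sqrt (measure_pmf.expectation (rademacher_signs N)
                  (\<lambda>\<epsilon>. (norm (\<Sum>k<N. \<epsilon> k *\<^sub>R smul (c k) (\<xi> k)))\<^sup>2)))
       \<le> C * ennreal (sqrt (\<Sum>k<N. (norm (c k))\<^sup>2))"
    then have "?X \<le> C * ?y" using assms unfolding rademacher_norm_def by blast
    then show "?X / ?y \<le> C" using y by (simp add: divide_le_posI_ennreal mult.commute less_le zero_less_iff_neq_zero)
  qed
  then have "?X / ?y * ?y \<le> R S * ?y" by (rule mult_right_mono) simp
  then show ?thesis using y by (simp add: ennreal_divide_times mult_divide_eq_ennreal)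
qed

lemma R_bound_mono: "S \<subseteq> T \<Longrightarrow> R S \<le> R T"
  by (rule R_bound_leI, rule rademacher_norm_le) blast

text \<open>A term with vector 0 is unchanged if the vector is replaced by a member of
  \<open>S\<close> and its scalar by 0, and this can only decrease the right side.\<close>

lemma R_bound_insert_zero: "R (insert 0 S) \<le> R S"
proof (rule R_bound_leI)
  fix N :: nat and \<xi> :: "nat \<Rightarrow> 'a" and c :: "nat \<Rightarrow> 'k"
  assume \<xi>: "\<And>k. k < N \<Longrightarrow> \<xi> k \<in> insert 0 S"
  show "ennreal (rademacher_norm smul N c \<xi>) \<le> R S * ennreal (sqrt (\<Sum>k<N. (norm (c k))\<^sup>2))"
  proof (cases "S = {}")
    case True
    then have "rademacher_norm smul N c \<xi> = 0" using \<xi> by (simp add: rademacher_norm_def)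
    then show ?thesis by simp
  next
    case False
    then obtain s where s: "s \<in> S" by blast
    define c' where "c' k = (if \<xi> k = 0 then 0 else c k)" for k
    define \<xi>' where "\<xi>' k = (if \<xi> k = 0 then s else \<xi> k)" for k
    have "smul (c k) (\<xi> k) = smul (c' k) (\<xi>' k)" for k by (simp add: c'_def \<xi>'_def)
    then have "rademacher_norm smul N c \<xi> = rademacher_norm smul N c' \<xi>'" by (simp add: rademacher_norm_def)
    moreover have "ennreal (rademacher_norm smul N c' \<xi>') \<le> R S * ennreal (sqrt (\<Sum>k<N. (norm (c' k))\<^sup>2))"
      by (rule rademacher_norm_le) (use \<xi> s in \<open>auto simp: \<xi>'_def\<close>)
    moreover have "\<dots> \<le> R S * ennreal (sqrt (\<Sum>k<N. (norm (c k))\<^sup>2))"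
      by (intro mult_left_mono ennreal_leI real_sqrt_le_mono sum_mono) (auto simp: c'_def)
    ultimately show ?thesis by simp
  qed
qed

lemma rademacher_norm_add:
  "rademacher_norm smul N c (\<lambda>k. \<xi> k + \<eta> k) \<le> rademacher_norm smul N c \<xi> + rademacher_norm smul N c \<eta>"
  using sqrt_expectation_norm_add_le[OF finite_set_rademacher_signs[of N],
      of "\<lambda>\<epsilon>. \<Sum>k<N. \<epsilon> k *\<^sub>R smul (c k) (\<xi> k)" "\<lambda>\<epsilon>. \<Sum>k<N. \<epsilon> k *\<^sub>R smul (c k) (\<eta> k)"]
  by (simp add: rademacher_norm_def scale_right_distrib scaleR_add_right sum.distrib)

lemma rademacher_norm_nonneg: "rademacher_norm smul N c \<xi> \<ge> 0"
  by (simp add: rademacher_norm_def integral_nonneg_AE)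

text \<open>Minkowski's inequality. Allowing 0 as a summand on either side makes this serve for
  unions as well as for sets of sums.\<close>

lemma R_bound_sum_le:
  assumes "\<And>z. z \<in> S \<Longrightarrow> \<exists>a\<in>insert 0 A. \<exists>b\<in>insert 0 B. z = a + b"
  shows "R S \<le> R A + R B"
proof (rule R_bound_leI)
  fix N :: nat and \<xi> :: "nat \<Rightarrow> 'a" and c :: "nat \<Rightarrow> 'k"
  assume "\<And>k. k < N \<Longrightarrow> \<xi> k \<in> S"
  then have "\<forall>k<N. \<exists>a b. a \<in> insert 0 A \<and> b \<in> insert 0 B \<and> \<xi> k = a + b" using assms by blast
  then obtain a b where ab: "\<forall>k<N. a k \<in> insert 0 A \<and> b k \<in> insert 0 B \<and> \<xi> k = a k + b k" by metis
  let ?y = "ennreal (sqrt (\<Sum>k<N. (norm (c k))\<^sup>2))"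
  have "rademacher_norm smul N c \<xi> = rademacher_norm smul N c (\<lambda>k. a k + b k)"
    using ab by (simp add: rademacher_norm_def)
  then have "ennreal (rademacher_norm smul N c \<xi>) \<le> ennreal (rademacher_norm smul N c a + rademacher_norm smul N c b)"
    using rademacher_norm_add by (intro ennreal_leI) simp
  also have "\<dots> = ennreal (rademacher_norm smul N c a) + ennreal (rademacher_norm smul N c b)"
    by (simp add: rademacher_norm_nonneg)
  also have "\<dots> \<le> R (insert 0 A) * ?y + R (insert 0 B) * ?y"
    using ab by (intro add_mono rademacher_norm_le) auto
  also have "\<dots> \<le> R A * ?y + R B * ?y"
    by (intro add_mono mult_right_mono R_bound_insert_zero) auto
  finally show "ennreal (rademacher_norm smul N c \<xi>) \<le> (R A + R B) * ?y"
    by (simp add: distrib_right)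
qed

lemma R_bound_Un_le: "R (A \<union> B) \<le> R A + R B"
  by (rule R_bound_sum_le) force

text \<open>For multiples of one vector the randomized sum is a scalar sum times that vector, so
  orthogonality of the signs applies.\<close>

lemma R_bound_singleton: "R {v} \<le> ennreal (norm v)"
proof (rule R_bound_leI)
  fix N :: nat and \<xi> :: "nat \<Rightarrow> 'a" and c :: "nat \<Rightarrow> 'k"
  assume "\<And>k. k < N \<Longrightarrow> \<xi> k \<in> {v}"
  then have "(\<Sum>k<N. \<epsilon> k *\<^sub>R smul (c k) (\<xi> k)) = smul (\<Sum>k<N. \<epsilon> k *\<^sub>R c k) v" for \<epsilon> :: "nat \<Rightarrow> real"
    by (simp add: scaleR_smul scale_sum_left)
  then have "rademacher_norm smul N c \<xi> = sqrt (\<Sum>k<N. (norm (c k))\<^sup>2) * norm v"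
    by (simp add: rademacher_norm_def norm_smul power_mult_distrib expectation_rademacher_orthogonal real_sqrt_mult)
  then show "ennreal (rademacher_norm smul N c \<xi>) \<le> ennreal (norm v) * ennreal (sqrt (\<Sum>k<N. (norm (c k))\<^sup>2))"
    by (simp add: ennreal_mult[symmetric] mult.commute sum_nonneg)
qed

lemma R_bound_empty: "R {} = 0"
  using R_bound_mono[of "{}" "{0}"] R_bound_singleton[of 0] by simp

lemma R_bound_finite: "finite S \<Longrightarrow> R S < \<infinity>"
proof (induction S rule: finite_induct)
  case (insert x S)
  have "R (insert x S) \<le> R {x} + R S" using R_bound_Un_le[of "{x}" S] by simp
  also have "\<dots> \<le> ennreal (norm x) + R S" by (intro add_right_mono R_bound_singleton)
  also have "\<dots> < \<infinity>" using insert by (simp add: ennreal_add_less_top)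
  finally show ?case .
qed (simp add: R_bound_empty)

text \<open>One more term adds a single new vector, the longest sum, and this is the previous
  longest sum plus \<open>e n\<close>. It therefore costs only the R-bound of
  \<open>{e n}\<close>.\<close>

lemma R_bound_partial_sums:
  fixes n :: nat
  shows "R {\<Sum>j<k. e j |k. k \<le> n} \<le> (\<Sum>j<n. ennreal (norm (e j)))"
proof (induction n)
  case 0
  show ?case using R_bound_singleton[of 0] by simp
next
  case (Suc n)
  have "R {\<Sum>j<k. e j |k. k \<le> Suc n} \<le> R {\<Sum>j<k. e j |k. k \<le> n} + R {e n}"
  proof (rule R_bound_sum_le)
    fix z assume "z \<in> {\<Sum>j<k. e j |k. k \<le> Suc n}"
    then obtain k where k: "z = (\<Sum>j<k. e j)" "k \<le> Suc n" by blast
    have n: "(\<Sum>j<n. e j) \<in> {\<Sum>j<k. e j |k. k \<le> n}" by blast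
    show "\<exists>a\<in>insert 0 {\<Sum>j<k. e j |k. k \<le> n}. \<exists>b\<in>insert 0 {e n}. z = a + b"
    proof (cases "k \<le> n")
      case True then show ?thesis using k by (intro bexI[of _ z] bexI[of _ 0]) auto
    next
      case False
      then have "z = (\<Sum>j<n. e j) + e n" using k by (simp add: le_Suc_eq)
      then show ?thesis using n by blast
    qed
  qed
  also have "\<dots> \<le> (\<Sum>j<n. ennreal (norm (e j))) + ennreal (norm (e n))"
    by (intro add_mono Suc R_bound_singleton)
  finally show ?case by simp
qed

text \<open>Each instance of the defining inequality involves finitely many vectors, and these
  already lie in one of the sets.\<close>

lemma R_bound_incseq_Union:
  fixes S :: "nat \<Rightarrow> 'a set"
  assumes "incseq S"
  shows "R (\<Union>i. S i) = (SUP i. R (S i))"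
proof (rule antisym)
  show "R (\<Union>i. S i) \<le> (SUP i. R (S i))"
  proof (rule R_bound_leI)
    fix N :: nat and \<xi> :: "nat \<Rightarrow> 'a" and c :: "nat \<Rightarrow> 'k"
    assume "\<And>k. k < N \<Longrightarrow> \<xi> k \<in> (\<Union>i. S i)"
    then have "\<forall>k\<in>{..<N}. \<exists>i. \<xi> k \<in> S i" by blast
    then obtain i where i: "\<forall>k\<in>{..<N}. \<xi> k \<in> S (i k)" by metis
    define m where "m = Max (insert 0 (i ` {..<N}))"
    have "\<xi> k \<in> S m" if "k < N" for k
    proof -
      have "i k \<le> m" unfolding m_def using that by (intro Max_ge) auto
      then show ?thesis using i that incseqD[OF assms] by blast
    qed
    then have "ennreal (rademacher_norm smul N c \<xi>) \<le> R (S m) * ennreal (sqrt (\<Sum>k<N. (norm (c k))\<^sup>2))"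
      by (rule rademacher_norm_le)
    also have "\<dots> \<le> (SUP i. R (S i)) * ennreal (sqrt (\<Sum>k<N. (norm (c k))\<^sup>2))"
      by (intro mult_right_mono SUP_upper) auto
    finally show "ennreal (rademacher_norm smul N c \<xi>) \<le> \<dots>" .
  qed
  show "(SUP i. R (S i)) \<le> R (\<Union>i. S i)"
    by (intro SUP_least R_bound_mono) blast
qed

end

section \<open>A Doob type inequality\<close>

text \<open>Layer cake formula with layers up to height \<open>N\<close> only. Open and closed ends
  differ in the points 0 and \<open>a\<close>; for \<open>q < 1\<close> the density is unbounded
  near 0 but integrable.\<close>

lemma nn_integral_powr_layer:
  assumes a: "a \<ge> 0" and N: "N \<ge> 0" and q: "q > 0"
  shows "(\<integral>\<^sup>+t. ennreal (q * t powr (q - 1)) * indicator {0<..N} t * indicator {..<a} t \<partial>lborel) = ennreal (min a N powr q)"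
proof -
  have "((\<lambda>t. q * t powr (q - 1)) has_integral q * (min a N powr (q - 1 + 1) / (q - 1 + 1))) {0..min a N}"
    using a N q by (intro has_integral_mult_right has_integral_powr_from_0) auto
  then have I: "((\<lambda>t. q * t powr (q - 1)) has_integral min a N powr q) {0..min a N}"
    using q by simp
  have "(\<integral>\<^sup>+t. ennreal (q * t powr (q - 1)) * indicator {0<..N} t * indicator {..<a} t \<partial>lborel)
      = (\<integral>\<^sup>+t. ennreal (q * t powr (q - 1)) * indicator {0..min a N} t \<partial>lborel)"
  proof (rule nn_integral_cong_AE)
    show "AE t in lborel. ennreal (q * t powr (q - 1)) * indicator {0<..N} t * indicator {..<a} t
       = ennreal (q * t powr (q - 1)) * indicator {0..min a N} t"
      using AE_lborel_singleton[of 0] AE_lborel_singleton[of a]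
      by eventually_elim (auto simp: indicator_def)
  qed
  also have "\<dots> = ennreal (min a N powr q)"
    using q by (intro nn_integral_has_integral_lebesgue'[OF _ I]) simp
  finally show ?thesis .
qed

text \<open>Comparing \<open>u\<close> with \<open>e * w\<close>, each of the two regimes is covered
  by one term on the right. The free weight \<open>e\<close> is there to make the \<open>w\<close>
  term small enough to be absorbed.\<close>

lemma mult_powr_le_Young:
  fixes u w e p :: real
  assumes "u \<ge> 0" "w \<ge> 0" "e > 0" "p > 1"
  shows "u * w powr (p - 1) \<le> e * w powr p + e powr (1 - p) * u powr p"
proof (cases "u \<le> e * w")
  case True
  have "u * w powr (p - 1) \<le> (e * w) * w powr (p - 1)" using True by (rule mult_right_mono) simp
  also have "\<dots> = e * w powr p" using assms by (cases "w = 0") (simp_all add: powr_diff)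
  finally show ?thesis using assms by (simp add: add_increasing2)
next
  case False
  then have "w \<le> u / e" using assms by (simp add: field_simps)
  then have "u * w powr (p - 1) \<le> u * (u / e) powr (p - 1)"
    using assms by (intro mult_left_mono powr_mono2) auto
  also have "\<dots> = e powr (1 - p) * u powr p"
    using assms by (cases "u = 0") (simp_all add: powr_divide powr_diff field_simps)
  finally show ?thesis using assms by (simp add: add_increasing)
qed

text \<open>Finiteness of \<open>x\<close> is what permits subtracting half of it.\<close>

lemma ennreal_absorb_half:
  fixes x b :: ennreal
  assumes "x \<le> ennreal (1/2) * x + b" "x < top"
  shows "x \<le> 2 * b"
proof (cases b)
  case (real r)
  obtain y where y: "x = ennreal y" "y \<ge> 0" using assms(2) by (cases x) auto
  have "ennreal (1/2 * y + r) = ennreal (1/2) * x + b"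
    using y real ennreal_plus[of "1/2 * y" r] ennreal_mult[of "1/2" y] by (simp only: y(1) real(2))
  then have "ennreal y \<le> ennreal (1/2 * y + r)" using assms(1) y by simp
  then have "y \<le> 1/2 * y + r" using y real by (subst (asm) ennreal_le_iff) simp_all
  then have "y \<le> 2 * r" by simp
  then have "ennreal y \<le> ennreal (2 * r)" by (rule ennreal_leI)
  then show ?thesis using y real by (simp add: ennreal_mult)
next
  case top
  then show ?thesis by simp
qed

text \<open>\<open>K\<close> is the constant of the truncated estimate. The weight
  \<open>1 / (2 * K)\<close> in Young's inequality turns the term to be absorbed into one half, and
  absorption gives the outer factor 2.\<close>

definition doob_const :: "real \<Rightarrow> real \<Rightarrow> real" where
  "doob_const p C = (let K = 2 powr p * (C * p / (p - 1)) in 2 * (K * (1 / (2 * K)) powr (1 - p)))"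

text \<open>Integrate the weak estimate against \<open>p * t powr (p - 1)\<close> and exchange the
  integrals. The factor 2 in the hypothesis rescales the truncation:
  \<open>min (g x) (2 * N)\<close> is twice \<open>min (g x / 2) N\<close>, whereas the right side
  is truncated at \<open>N\<close>.\<close>

lemma (in sigma_finite_measure) Doob_type_truncated:
  fixes g u :: "'a \<Rightarrow> real"
  assumes [measurable]: "g \<in> borel_measurable M" "u \<in> borel_measurable M"
    and g0: "\<And>x. g x \<ge> 0" and u0: "\<And>x. u x \<ge> 0" and p: "p > 1" and C: "C > 0"
    and weak: "\<And>t. t > 0 \<Longrightarrow> emeasure M {x\<in>space M. 2 * t < g x} \<le>
      ennreal (C / t) * (\<integral>\<^sup>+x. ennreal (u x) * indicator {..<g x} t \<partial>M)"
    and N: "N \<ge> 0"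
  shows "(\<integral>\<^sup>+x. ennreal (min (g x) (2 * N) powr p) \<partial>M) \<le>
    ennreal (2 powr p * (C * p / (p - 1))) * (\<integral>\<^sup>+x. ennreal (u x * min (g x) N powr (p - 1)) \<partial>M)"
proof -
  interpret L: sigma_finite_measure "lborel :: real measure" by (rule sigma_finite_lborel)
  interpret pair_sigma_finite M "lborel :: real measure" ..
  define k where "k t = ennreal (p * t powr (p - 1)) * indicator {0<..N} t" for t
  define l where "l t = ennreal ((p - 1) * t powr (p - 1 - 1)) * indicator {0<..N} t" for t
  have [measurable]: "k \<in> borel_measurable borel" "l \<in> borel_measurable borel"
    unfolding k_def l_def by measurable
  have ind: "indicator {..<g x / 2} t = (indicator {x\<in>space M. 2 * t < g x} x :: ennreal)" if "x \<in> space M" for x t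
    using that by (auto simp: indicator_def)
  have m1[measurable]: "(\<lambda>(x, t). indicator {..<g x / 2} t :: ennreal) \<in> borel_measurable (M \<Otimes>\<^sub>M lborel)"
  proof -
    have "(\<lambda>(x, t). indicator {..<g x / 2} t :: ennreal) = indicator {(x, t). t < g x / 2}"
      by (auto simp: fun_eq_iff indicator_def)
    moreover have "{z \<in> space (M \<Otimes>\<^sub>M lborel). snd z < g (fst z) / 2} \<in> sets (M \<Otimes>\<^sub>M lborel)" by measurable
    ultimately show ?thesis
      by (subst measurable_cong[where g="indicator {z \<in> space (M \<Otimes>\<^sub>M lborel). snd z < g (fst z) / 2}"])
         (auto simp: indicator_def)
  qed
  have m2[measurable]: "(\<lambda>(x, t). indicator {..<g x} t :: ennreal) \<in> borel_measurable (M \<Otimes>\<^sub>M lborel)"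
  proof -
    have "{z \<in> space (M \<Otimes>\<^sub>M lborel). snd z < g (fst z)} \<in> sets (M \<Otimes>\<^sub>M lborel)" by measurable
    then show ?thesis
      by (subst measurable_cong[where g="indicator {z \<in> space (M \<Otimes>\<^sub>M lborel). snd z < g (fst z)}"])
         (auto simp: indicator_def)
  qed
  have "(\<integral>\<^sup>+x. ennreal (min (g x) (2 * N) powr p) \<partial>M)
      = (\<integral>\<^sup>+x. ennreal (2 powr p) * (\<integral>\<^sup>+t. k t * indicator {..<g x / 2} t \<partial>lborel) \<partial>M)"
  proof (rule nn_integral_cong)
    fix x
    have "min (g x) (2 * N) powr p = (2 * min (g x / 2) N) powr p" by (simp add: min_def)
    also have "\<dots> = 2 powr p * min (g x / 2) N powr p" using g0 N by (simp add: powr_mult)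
    finally show "ennreal (min (g x) (2 * N) powr p) = ennreal (2 powr p) * (\<integral>\<^sup>+t. k t * indicator {..<g x / 2} t \<partial>lborel)"
      using nn_integral_powr_layer[of "g x / 2" N p] g0[of x] N p by (simp add: k_def ennreal_mult)
  qed
  also have "\<dots> = ennreal (2 powr p) * (\<integral>\<^sup>+x. (\<integral>\<^sup>+t. k t * indicator {..<g x / 2} t \<partial>lborel) \<partial>M)"
    by (rule nn_integral_cmult) measurable
  also have "(\<integral>\<^sup>+x. (\<integral>\<^sup>+t. k t * indicator {..<g x / 2} t \<partial>lborel) \<partial>M)
      = (\<integral>\<^sup>+t. (\<integral>\<^sup>+x. k t * indicator {..<g x / 2} t \<partial>M) \<partial>lborel)"
    by (rule Fubini'[symmetric]) measurable
  also have "\<dots> \<le> (\<integral>\<^sup>+t. (\<integral>\<^sup>+x. ennreal (C * p / (p - 1)) * (ennreal (u x) * (l t * indicator {..<g x} t)) \<partial>M) \<partial>lborel)"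
  proof (rule nn_integral_mono)
    fix t :: real
    show "(\<integral>\<^sup>+x. k t * indicator {..<g x / 2} t \<partial>M)
       \<le> (\<integral>\<^sup>+x. ennreal (C * p / (p - 1)) * (ennreal (u x) * (l t * indicator {..<g x} t)) \<partial>M)"
    proof (cases "0 < t \<and> t \<le> N")
      case True
      have "(\<integral>\<^sup>+x. k t * indicator {..<g x / 2} t \<partial>M) = (\<integral>\<^sup>+x. k t * indicator {x\<in>space M. 2 * t < g x} x \<partial>M)"
        by (intro nn_integral_cong) (simp add: ind)
      also have "\<dots> = k t * emeasure M {x\<in>space M. 2 * t < g x}"
        by (intro nn_integral_cmult_indicator) measurable
      also have "\<dots> \<le> k t * (ennreal (C / t) * (\<integral>\<^sup>+x. ennreal (u x) * indicator {..<g x} t \<partial>M))"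
        using weak True by (intro mult_left_mono) auto
      also have "\<dots> = (ennreal (C * p / (p - 1)) * l t) * (\<integral>\<^sup>+x. ennreal (u x) * indicator {..<g x} t \<partial>M)"
      proof -
        \<comment> \<open>The factor \<open>1 / t\<close> of the weak estimate lowers the exponent:
          up to a constant, the weight becomes the layer density for the power
          \<open>p - 1\<close>.\<close>
        have "p * t powr (p - 1) * (C / t) = C * p / (p - 1) * ((p - 1) * t powr (p - 1 - 1))"
          using True p by (simp add: powr_diff field_simps power2_eq_square)
        then have "k t * ennreal (C / t) = ennreal (C * p / (p - 1)) * l t"
          using True p C by (simp add: k_def l_def flip: ennreal_mult)
        then show ?thesis by (simp add: mult.assoc[symmetric])
      qed
      also have "\<dots> = (\<integral>\<^sup>+x. (ennreal (C * p / (p - 1)) * l t) * (ennreal (u x) * indicator {..<g x} t) \<partial>M)"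
      proof (rule nn_integral_cmult[symmetric])
        have "(\<lambda>x. ennreal (u x) * indicator {x\<in>space M. t < g x} x) \<in> borel_measurable M" by measurable
        then show "(\<lambda>x. ennreal (u x) * indicator {..<g x} t) \<in> borel_measurable M"
          by (rule measurable_cong[THEN iffD1, rotated]) (auto simp: indicator_def)
      qed
      finally show ?thesis by (simp add: ac_simps)
    qed (auto simp: k_def indicator_def)
  qed
  also have "\<dots> = (\<integral>\<^sup>+x. (\<integral>\<^sup>+t. ennreal (C * p / (p - 1)) * (ennreal (u x) * (l t * indicator {..<g x} t)) \<partial>lborel) \<partial>M)"
    by (rule Fubini') measurable
  also have "\<dots> = (\<integral>\<^sup>+x. ennreal (C * p / (p - 1)) * ennreal (u x * min (g x) N powr (p - 1)) \<partial>M)"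
  proof (rule nn_integral_cong)
    fix x
    have "(\<integral>\<^sup>+t. ennreal (C * p / (p - 1)) * (ennreal (u x) * (l t * indicator {..<g x} t)) \<partial>lborel)
      = ennreal (C * p / (p - 1)) * (ennreal (u x) * (\<integral>\<^sup>+t. l t * indicator {..<g x} t \<partial>lborel))"
      by (simp add: nn_integral_cmult)
    also have "(\<integral>\<^sup>+t. l t * indicator {..<g x} t \<partial>lborel) = ennreal (min (g x) N powr (p - 1))"
      using nn_integral_powr_layer[of "g x" N "p - 1"] g0[of x] N p by (simp add: l_def)
    finally show "(\<integral>\<^sup>+t. ennreal (C * p / (p - 1)) * (ennreal (u x) * (l t * indicator {..<g x} t)) \<partial>lborel)
      = ennreal (C * p / (p - 1)) * ennreal (u x * min (g x) N powr (p - 1))"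
      using u0[of x] by (simp add: ennreal_mult)
  qed
  also have "\<dots> = ennreal (C * p / (p - 1)) * (\<integral>\<^sup>+x. ennreal (u x * min (g x) N powr (p - 1)) \<partial>M)"
    by (rule nn_integral_cmult) measurable
  finally have *: "(\<integral>\<^sup>+x. ennreal (min (g x) (2 * N) powr p) \<partial>M) \<le> ennreal (2 powr p) *
      (ennreal (C * p / (p - 1)) * (\<integral>\<^sup>+x. ennreal (u x * min (g x) N powr (p - 1)) \<partial>M))"
    by (simp add: mult_left_mono)
  have "ennreal (2 powr p * (C * p / (p - 1))) = ennreal (2 powr p) * ennreal (C * p / (p - 1))"
    using C p by (intro ennreal_mult) auto
  then show ?thesis using * by (simp only: mult.assoc)
qed

text \<open>Young's inequality leaves a multiple of the left side on the right, and absorbing it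
  requires the truncated integral to be finite. This is where integrability of \<open>u\<close>
  enters: the truncated integral is at most a multiple of \<open>N powr (p - 1)\<close> times the
  integral of \<open>u\<close>.\<close>

lemma (in sigma_finite_measure) Doob_type_inequality:
  fixes g u :: "'a \<Rightarrow> real"
  assumes [measurable]: "g \<in> borel_measurable M" "u \<in> borel_measurable M"
    and g0: "\<And>x. g x \<ge> 0" and u0: "\<And>x. u x \<ge> 0" and p: "p > 1" and C: "C > 0"
    and weak: "\<And>t. t > 0 \<Longrightarrow> emeasure M {x\<in>space M. 2 * t < g x} \<le>
      ennreal (C / t) * (\<integral>\<^sup>+x. ennreal (u x) * indicator {..<g x} t \<partial>M)"
    and ufin: "(\<integral>\<^sup>+x. u x \<partial>M) < \<infinity>"
  shows "(\<integral>\<^sup>+x. ennreal (g x powr p) \<partial>M) \<le> ennreal (doob_const p C) * (\<integral>\<^sup>+x. ennreal (u x powr p) \<partial>M)"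
proof -
  define K where "K = 2 powr p * (C * p / (p - 1))"
  define e where "e = 1 / (2 * K)"
  have K: "K > 0" using C p by (simp add: K_def)
  have e: "e > 0" using K by (simp add: e_def)
  define \<Phi> where "\<Phi> N = (\<integral>\<^sup>+x. ennreal (min (g x) N powr p) \<partial>M)" for N
  define U where "U = (\<integral>\<^sup>+x. ennreal (u x powr p) \<partial>M)"
  have step: "\<Phi> (2 * N) \<le> ennreal K * (\<integral>\<^sup>+x. ennreal (u x * min (g x) N powr (p - 1)) \<partial>M)" if "N \<ge> 0" for N
    unfolding \<Phi>_def K_def by (rule Doob_type_truncated[OF assms(1-7) that])
  \<comment> \<open>Brings both sides to the same truncation level, as the truncated estimate bounds
    level \<open>2 * N\<close> by level \<open>N\<close>.\<close>
  have mono: "\<Phi> N \<le> \<Phi> (2 * N)" if "N \<ge> 0" for N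
    unfolding \<Phi>_def using that g0 p by (intro nn_integral_mono ennreal_leI powr_mono2) auto
  have bound: "\<Phi> N \<le> ennreal (doob_const p C) * U" if N: "N \<ge> 0" for N
  proof -
    have "(\<integral>\<^sup>+x. ennreal (u x * min (g x) N powr (p - 1)) \<partial>M) \<le> (\<integral>\<^sup>+x. ennreal (N powr (p - 1)) * ennreal (u x) \<partial>M)"
    proof (rule nn_integral_mono)
      fix x
      have "u x * min (g x) N powr (p - 1) \<le> N powr (p - 1) * u x"
        using u0[of x] g0[of x] N p by (subst mult.commute, intro mult_right_mono powr_mono2) auto
      then show "ennreal (u x * min (g x) N powr (p - 1)) \<le> ennreal (N powr (p - 1)) * ennreal (u x)"
        using u0[of x] by (simp add: ennreal_leI flip: ennreal_mult)
    qed
    also have "\<dots> < top" using ufin by (simp add: nn_integral_cmult ennreal_mult_less_top)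
    finally have "ennreal K * (\<integral>\<^sup>+x. ennreal (u x * min (g x) N powr (p - 1)) \<partial>M) < top"
      by (simp add: ennreal_mult_less_top)
    with mono[OF N] step[OF N] have fin: "\<Phi> N < top" by (meson le_less_trans order_trans)
    have "\<Phi> N \<le> ennreal K * (\<integral>\<^sup>+x. ennreal (u x * min (g x) N powr (p - 1)) \<partial>M)"
      using mono[OF N] step[OF N] by (rule order_trans)
    also have "\<dots> \<le> ennreal K * (\<integral>\<^sup>+x. ennreal e * ennreal (min (g x) N powr p) + ennreal (e powr (1 - p)) * ennreal (u x powr p) \<partial>M)"
    proof (intro mult_left_mono nn_integral_mono)
      fix x
      have "u x * min (g x) N powr (p - 1) \<le> e * min (g x) N powr p + e powr (1 - p) * u x powr p"
        using u0[of x] g0[of x] N e p by (intro mult_powr_le_Young) auto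
      then have "ennreal (u x * min (g x) N powr (p - 1)) \<le> ennreal (e * min (g x) N powr p + e powr (1 - p) * u x powr p)"
        by (rule ennreal_leI)
      then show "ennreal (u x * min (g x) N powr (p - 1)) \<le>
          ennreal e * ennreal (min (g x) N powr p) + ennreal (e powr (1 - p)) * ennreal (u x powr p)"
        using e by (simp add: ennreal_mult)
    qed simp
    also have "\<dots> = ennreal K * (ennreal e * \<Phi> N + ennreal (e powr (1 - p)) * U)"
      unfolding \<Phi>_def U_def by (subst nn_integral_add) (simp_all add: nn_integral_cmult)
    also have "\<dots> = ennreal (K * e) * \<Phi> N + ennreal (K * e powr (1 - p)) * U"
      using K e by (simp add: distrib_left ennreal_mult mult.assoc)
    also have "K * e = 1/2" using K by (simp add: e_def)
    finally have "\<Phi> N \<le> 2 * (ennreal (K * e powr (1 - p)) * U)"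
      using fin by (rule ennreal_absorb_half)
    also have "\<dots> = ennreal (doob_const p C) * U"
    proof -
      have "doob_const p C = 2 * (K * e powr (1 - p))" by (simp add: doob_const_def K_def e_def Let_def)
      then show ?thesis using K by (simp add: ennreal_mult mult.assoc)
    qed
    finally show ?thesis .
  qed
  have "(\<integral>\<^sup>+x. ennreal (g x powr p) \<partial>M) \<le> (\<integral>\<^sup>+x. (SUP n. ennreal (min (g x) (real n) powr p)) \<partial>M)"
  proof (rule nn_integral_mono)
    fix x
    obtain n where "g x \<le> real n" using real_arch_simple by blast
    then have "ennreal (g x powr p) = ennreal (min (g x) (real n) powr p)" by (simp add: min_def)
    also have "\<dots> \<le> (SUP n. ennreal (min (g x) (real n) powr p))" by (rule SUP_upper) simp
    finally show "ennreal (g x powr p) \<le> (SUP n. ennreal (min (g x) (real n) powr p))" .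
  qed
  also have "\<dots> = (SUP n. \<Phi> (real n))"
    unfolding \<Phi>_def using g0 p
    by (intro nn_integral_monotone_convergence_SUP)
       (auto simp: incseq_def le_fun_def intro!: ennreal_leI powr_mono2)
  also have "\<dots> \<le> ennreal (doob_const p C) * U"
    by (intro SUP_least bound) simp
  finally show ?thesis unfolding U_def .
qed

section \<open>Dyadic averages\<close>

locale dyadic_measure =
  fixes \<mu> :: "(real ^ 'n) measure" and D :: "int \<Rightarrow> (real ^ 'n) set set"
  assumes locally_finite: "locally_finite_borel \<mu>" and dyadic: "dyadic_system D"
begin

definition cube :: "int \<Rightarrow> real ^ 'n \<Rightarrow> (real ^ 'n) set" where
  "cube k x = (THE Q. Q \<in> D k \<and> x \<in> Q)"

lemma sets_\<mu> [measurable_cong, simp]: "sets \<mu> = sets borel"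
  using locally_finite unfolding locally_finite_borel_def by blast

lemma space_\<mu> [simp]: "space \<mu> = UNIV"
  using sets_eq_imp_space_eq[OF sets_\<mu>] by simp

lemma cube_unique:
  assumes "Q \<in> D k" "Q' \<in> D k" "x \<in> Q" "x \<in> Q'" shows "Q = Q'"
  using dyadic assms unfolding dyadic_system_def partition_on_def disjoint_def by blast

lemma cube_eqI: "Q \<in> D k \<Longrightarrow> x \<in> Q \<Longrightarrow> cube k x = Q"
  unfolding cube_def using cube_unique by (intro the_equality) auto

lemma cube_in [simp]: "cube k x \<in> D k" and in_cube [simp]: "x \<in> cube k x"
proof -
  have "\<Union>(D k) = UNIV" using dyadic unfolding dyadic_system_def partition_on_def by blast
  then obtain Q where "Q \<in> D k" "x \<in> Q" by blast
  then show "cube k x \<in> D k" "x \<in> cube k x" using cube_eqI by auto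
qed

lemma mem_cube_iff: "y \<in> cube k x \<longleftrightarrow> cube k y = cube k x"
  using cube_eqI[OF cube_in] in_cube by blast

lemma half_open: "half_open_cube (2 powi (- k)) (cube k x)"
  using dyadic cube_in unfolding dyadic_system_def by blast

lemma cube_children:
  obtains F where "F \<subseteq> D (k + 1)" "finite F" "cube k x = \<Union>F"
proof -
  obtain F where F: "F \<subseteq> D (k + 1)" "card F = 2 ^ CARD('n)" "cube k x = \<Union>F"
    using dyadic cube_in[of k x] unfolding dyadic_system_def by blast
  then have "finite F" by (intro card_ge_0_finite) simp
  with F that show ?thesis by blast
qed

lemma cube_Suc_subset: "cube (k + 1) x \<subseteq> cube k x"
proof -
  obtain F where F: "F \<subseteq> D (k + 1)" "finite F" "cube k x = \<Union>F" by (rule cube_children)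
  then obtain Q where "Q \<in> F" "x \<in> Q" using in_cube[of x k] by blast
  then have "cube (k + 1) x = Q" using F cube_eqI by blast
  then show ?thesis using F \<open>Q \<in> F\<close> by blast
qed

lemma cube_antimono: "j \<le> k \<Longrightarrow> cube k x \<subseteq> cube j x"
proof (induction k rule: int_ge_induct)
  case (step i)
  then show ?case using cube_Suc_subset[of i x] by blast
qed simp

lemma cube_eq_antimono: "j \<le> k \<Longrightarrow> cube k y = cube k x \<Longrightarrow> cube j y = cube j x"
  using cube_antimono[of j k] by (metis in_cube mem_cube_iff subsetD)

lemma bounded_cube: "bounded (cube k x)"
  and sets_cube [measurable, simp]: "cube k x \<in> sets borel"
  and interior_cube: "interior (cube k x) \<noteq> {}"
proof -
  define l :: real where "l = 2 powi (- k)"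
  have l: "l > 0" by (simp add: l_def)
  obtain a where a: "cube k x = {x. \<forall>i. a $ i \<le> x $ i \<and> x $ i < a $ i + l}"
    using half_open unfolding half_open_cube_def l_def by blast
  have "cube k x \<subseteq> cbox a (\<chi> i. a $ i + l)" unfolding a by (auto simp: mem_box_cart less_imp_le)
  then show "bounded (cube k x)" using bounded_cbox bounded_subset by blast
  show "cube k x \<in> sets borel" unfolding a by measurable
  have sub: "box a (\<chi> i. a $ i + l) \<subseteq> cube k x" unfolding a by (auto simp: mem_box_cart less_imp_le)
  have "(\<chi> i. a $ i + l / 2) \<in> box a (\<chi> i. a $ i + l)" using l by (auto simp: mem_box_cart)
  then show "interior (cube k x) \<noteq> {}"
    using interior_maximal[OF sub open_box] by blast
qed

lemma D_eq_cubes: "D k = range (cube k)"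
proof -
  have "Q \<in> range (cube k)" if "Q \<in> D k" for Q
  proof -
    have "Q \<noteq> {}" using that dyadic unfolding dyadic_system_def partition_on_def by blast
    then obtain x where "x \<in> Q" by blast
    then show ?thesis using cube_eqI[OF that] by blast
  qed
  then show ?thesis by auto
qed

text \<open>Disjoint sets with nonempty interior contain different points of a countable dense set.
  Countability lets all null cubes be discarded at once and unions of cubes be measurable.\<close>

lemma countable_D: "countable (D k)"
proof (rule countable_disjoint_nonempty_interior_subsets)
  show "disjoint (D k)" using dyadic unfolding dyadic_system_def partition_on_def by blast
  show "S = {}" if "S \<in> D k" "interior S = {}" for S
    using that interior_cube by (auto simp: D_eq_cubes)
qed

lemma emeasure_bounded_finite:
  assumes "bounded S" shows "emeasure \<mu> S < \<infinity>"
proof -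
  obtain r where "\<forall>x\<in>S. norm x \<le> r" using assms unfolding bounded_iff by (elim exE)
  then have r: "S \<subseteq> cball 0 r" by auto
  have "\<forall>x. \<exists>U. open U \<and> x \<in> U \<and> emeasure \<mu> U < \<infinity>"
    using locally_finite unfolding locally_finite_borel_def by blast
  then obtain U where U: "\<And>x. open (U x) \<and> x \<in> U x \<and> emeasure \<mu> (U x) < \<infinity>" by metis
  obtain T where T: "finite T" "cball 0 r \<subseteq> (\<Union>x\<in>T. U x)"
    using compactE_image[OF compact_cball[of 0 r], of "cball 0 r" U] U by (metis UN_I subsetI)
  have "emeasure \<mu> S \<le> emeasure \<mu> (\<Union>x\<in>T. U x)"
    using r T U by (intro emeasure_mono) (auto intro!: borel_open open_UN)
  also have "\<dots> \<le> (\<Sum>x\<in>T. emeasure \<mu> (U x))"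
    using T U by (intro emeasure_subadditive_finite) auto
  also have "\<dots> < \<infinity>" using T U by (simp add: ennreal_sum_less_top)
  finally show ?thesis .
qed

lemma emeasure_cube_finite [simp]: "emeasure \<mu> (cube k x) < top" "emeasure \<mu> (cube k x) \<noteq> top"
  using emeasure_bounded_finite[OF bounded_cube, of k x] by auto

sublocale sigma_finite_measure \<mu>
proof
  show "\<exists>A. countable A \<and> A \<subseteq> sets \<mu> \<and> \<Union> A = space \<mu> \<and> (\<forall>a\<in>A. emeasure \<mu> a \<noteq> \<infinity>)"
    using countable_D[of 0] dyadic unfolding dyadic_system_def partition_on_def
    by (intro exI[of _ "D 0"]) (auto simp: D_eq_cubes)
qed

text \<open>Measurability with respect to the sigma-algebra generated by the cubes of generation \<open>k\<close>.\<close>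

definition level :: "int \<Rightarrow> (real ^ 'n \<Rightarrow> 'b) \<Rightarrow> bool" where
  "level k g \<longleftrightarrow> (\<forall>x y. cube k y = cube k x \<longrightarrow> g y = g x)"

lemma levelD: "level k g \<Longrightarrow> y \<in> cube k x \<Longrightarrow> g y = g x"
  unfolding level_def mem_cube_iff by blast

lemma level_mono: "level j g \<Longrightarrow> j \<le> k \<Longrightarrow> level k g"
  unfolding level_def using cube_eq_antimono by blast

lemma level_compose2:
  assumes "level k g" "level k h" shows "level k (\<lambda>x. c (g x) (h x))"
  unfolding level_def
proof (intro allI impI)
  fix x y assume "cube k y = cube k x"
  then have "y \<in> cube k x" by (simp add: mem_cube_iff)
  then show "c (g y) (h y) = c (g x) (h x)" using levelD[OF assms(1)] levelD[OF assms(2)] by metis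
qed

lemma level_compose: "level k g \<Longrightarrow> level k (\<lambda>x. c (g x))"
  using level_compose2[of k g g "\<lambda>a b. c a"] by simp

lemma level_all:
  assumes "\<And>i. level k (g i)" shows "level k (\<lambda>x. c (\<lambda>i. g i x))"
  unfolding level_def
proof (intro allI impI)
  fix x y assume "cube k y = cube k x"
  then have "y \<in> cube k x" by (simp add: mem_cube_iff)
  then have "(\<lambda>i. g i y) = (\<lambda>i. g i x)" using levelD[OF assms] by (intro ext) blast
  then show "c (\<lambda>i. g i y) = c (\<lambda>i. g i x)" by (rule arg_cong)
qed

text \<open>Preimages of arbitrary sets are countable unions of cubes. This covers predicates and
  functions with values in a nonseparable space alike.\<close>

lemma level_measurable_count_space:
  assumes "level k g" shows "g \<in> measurable \<mu> (count_space UNIV)"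
proof (rule measurableI)
  fix A
  have "g -` A \<inter> space \<mu> = \<Union>{Q\<in>D k. Q \<subseteq> g -` A}"
  proof
    show "g -` A \<inter> space \<mu> \<subseteq> \<Union>{Q\<in>D k. Q \<subseteq> g -` A}"
    proof
      fix x assume "x \<in> g -` A \<inter> space \<mu>"
      then have "g y \<in> A" if "y \<in> cube k x" for y using levelD[OF assms that] by simp
      then have "cube k x \<subseteq> g -` A" by blast
      then show "x \<in> \<Union>{Q\<in>D k. Q \<subseteq> g -` A}" using cube_in in_cube by blast
    qed
  qed auto
  also have "\<dots> \<in> sets \<mu>"
    by (intro sets.countable_Union) (auto intro: countable_subset[OF _ countable_D[of k]] simp: D_eq_cubes)
  finally show "g -` A \<inter> space \<mu> \<in> sets \<mu>" .
qed simp

lemma level_measurable: "level k g \<Longrightarrow> g \<in> borel_measurable \<mu>"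
  by (rule measurable_compose[OF level_measurable_count_space]) auto

lemma level_sets: "level k P \<Longrightarrow> {x. P x} \<in> sets \<mu>"
  using measurable_sets[OF level_measurable_count_space, of k P "{True}"] by (simp add: vimage_def)

text \<open>Keeping the function on the first \<open>i\<close> cubes of an enumeration gives simple
  functions that are eventually constant in \<open>i\<close> at each point.\<close>

lemma level_strongly_measurable:
  fixes g :: "real ^ 'n \<Rightarrow> 'b::real_normed_vector"
  assumes "level N g" shows "strongly_measurable \<mu> g"
proof -
  define s where "s i x = (if cube N x \<in> from_nat_into (D N) ` {..i} then g x else 0)" for i :: nat and x
  have ne: "D N \<noteq> {}" using cube_in[of N] by blast
  have "simple_function \<mu> (s i)" for i
    unfolding simple_function_def
  proof (intro conjI ballI)
    have "s i ` space \<mu> \<subseteq> insert 0 ((\<lambda>Q. g (SOME z. z \<in> Q)) ` from_nat_into (D N) ` {..i})"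
    proof
      fix v assume "v \<in> s i ` space \<mu>"
      then obtain x where x: "v = s i x" by blast
      have "(SOME z. z \<in> cube N x) \<in> cube N x" by (rule someI[of _ x]) simp
      then have "g x = g (SOME z. z \<in> cube N x)" by (rule levelD[OF assms, symmetric])
      then show "v \<in> insert 0 ((\<lambda>Q. g (SOME z. z \<in> Q)) ` from_nat_into (D N) ` {..i})"
        unfolding x s_def by auto
    qed
    then show "finite (s i ` space \<mu>)" by (rule finite_subset) simp
    have "level N (s i)" unfolding level_def s_def
    proof (intro allI impI)
      fix x y assume eq: "cube N y = cube N x"
      then have "y \<in> cube N x" by (simp add: mem_cube_iff)
      then have "g y = g x" by (rule levelD[OF assms])
      with eq show "(if cube N y \<in> from_nat_into (D N) ` {..i} then g y else 0)
        = (if cube N x \<in> from_nat_into (D N) ` {..i} then g x else 0)" by simp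
    qed
    then show "s i -` {v} \<inter> space \<mu> \<in> sets \<mu>" for v
      by (intro measurable_sets[OF level_measurable_count_space]) auto
  qed
  moreover have "(\<lambda>i. s i x) \<longlonglongrightarrow> g x" for x
  proof -
    obtain m where "from_nat_into (D N) m = cube N x"
      using from_nat_into_surj[OF countable_D cube_in] by blast
    then have "s i x = g x" if "m \<le> i" for i using that unfolding s_def by (auto intro: image_eqI[of _ _ m])
    then show ?thesis by (intro tendsto_eventually) (auto simp: eventually_sequentially)
  qed
  ultimately show ?thesis unfolding strongly_measurable_def by (intro exI[of _ s]) simp
qed

lemma nn_integral_cubes:
  assumes [measurable]: "h \<in> borel_measurable \<mu>"
  shows "(\<integral>\<^sup>+x. h x \<partial>\<mu>) = (\<integral>\<^sup>+Q. (\<integral>\<^sup>+x. h x * indicator Q x \<partial>\<mu>) \<partial>count_space (D k))"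
proof -
  have "(\<integral>\<^sup>+x. h x \<partial>\<mu>) = (\<integral>\<^sup>+x. (\<integral>\<^sup>+Q. h x * indicator Q x \<partial>count_space (D k)) \<partial>\<mu>)"
  proof (rule nn_integral_cong)
    fix x
    have "(\<integral>\<^sup>+Q. h x * indicator Q x \<partial>count_space (D k)) = (\<Sum>Q\<in>{cube k x}. h x * indicator Q x)"
      by (rule nn_integral_count_space') (auto simp: indicator_def dest: cube_eqI)
    then show "h x = (\<integral>\<^sup>+Q. h x * indicator Q x \<partial>count_space (D k))" by simp
  qed
  also have "\<dots> = (\<integral>\<^sup>+Q. (\<integral>\<^sup>+x. h x * indicator Q x \<partial>\<mu>) \<partial>count_space (D k))"
    by (intro nn_integral_count_space_nn_integral countable_D) (auto simp: D_eq_cubes)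
  finally show ?thesis .
qed

text \<open>As a function of the point, this is the conditional expectation of \<open>f\<close> on
  generation \<open>k\<close>.\<close>

definition avg :: "int \<Rightarrow> (real ^ 'n \<Rightarrow> 'a::banach) \<Rightarrow> real ^ 'n \<Rightarrow> 'a" where
  "avg k f x = average \<mu> f (cube k x)"

text \<open>On null cubes this is \<open>0 / 0 = 0\<close> as well.\<close>

definition nn_avg :: "int \<Rightarrow> (real ^ 'n \<Rightarrow> ennreal) \<Rightarrow> real ^ 'n \<Rightarrow> ennreal" where
  "nn_avg k u x = (\<integral>\<^sup>+y. u y * indicator (cube k x) y \<partial>\<mu>) / emeasure \<mu> (cube k x)"

text \<open>A relation rather than a value: \<open>strong_integral\<close> returns 0 if there is no
  integral, so existence has to be carried along.\<close>

definition cube_integral :: "int \<Rightarrow> real ^ 'n \<Rightarrow> (real ^ 'n \<Rightarrow> 'a::banach) \<Rightarrow> 'a \<Rightarrow> bool" where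
  "cube_integral k x f v \<longleftrightarrow> has_strong_integral \<mu> (\<lambda>y. indicator (cube k x) y *\<^sub>R f y) v"

definition loc_integrable :: "(real ^ 'n \<Rightarrow> 'a::banach) \<Rightarrow> bool" where
  "loc_integrable f \<longleftrightarrow> (\<forall>k x. \<exists>v. cube_integral k x f v)"

lemma level_avg: "level k (avg k f)" "level k (nn_avg k u)"
  unfolding level_def avg_def nn_avg_def by auto

lemma indicator_null_AE:
  assumes "emeasure \<mu> (cube k x) = 0"
  shows "AE y in \<mu>. y \<notin> cube k x"
  using assms by (intro AE_not_in) (auto simp: null_sets_def)

lemma nn_integral_null_cube:
  assumes "emeasure \<mu> (cube k x) = 0"
  shows "(\<integral>\<^sup>+y. u y * indicator (cube k x) y \<partial>\<mu>) = 0"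
proof -
  have "(\<integral>\<^sup>+y. u y * indicator (cube k x) y \<partial>\<mu>) = (\<integral>\<^sup>+y. 0 \<partial>\<mu>)"
    by (intro nn_integral_cong_AE) (use indicator_null_AE[OF assms] in \<open>eventually_elim, simp\<close>)
  then show ?thesis by simp
qed

text \<open>Valid on null cubes too, where both the integral and the measure vanish, so that sums
  over subcubes need no case distinction.\<close>

lemma cube_integral_avg:
  assumes "cube_integral k x f v" shows "v = measure \<mu> (cube k x) *\<^sub>R avg k f x"
proof (cases "emeasure \<mu> (cube k x) = 0")
  case True
  have "ennreal (norm v) \<le> (\<integral>\<^sup>+y. norm (indicator (cube k x) y *\<^sub>R f y) \<partial>\<mu>)"
    using assms unfolding cube_integral_def by (rule has_strong_integral_norm_le)
  also have "\<dots> = (\<integral>\<^sup>+y. ennreal (norm (f y)) * indicator (cube k x) y \<partial>\<mu>)"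
    by (intro nn_integral_cong) (auto simp: indicator_def)
  also have "\<dots> = 0" by (rule nn_integral_null_cube[OF True])
  finally show ?thesis using True by (simp add: measure_def)
next
  case False
  then have "measure \<mu> (cube k x) \<noteq> 0" by (simp add: measure_def enn2real_eq_0_iff)
  then show ?thesis using False strong_integral_eq[OF assms[unfolded cube_integral_def]]
    by (simp add: avg_def average_def)
qed

lemma loc_integrable_avg:
  "loc_integrable f \<Longrightarrow> cube_integral k x f (measure \<mu> (cube k x) *\<^sub>R avg k f x)"
  using cube_integral_avg unfolding loc_integrable_def by metis

lemma avg_eqI:
  assumes "cube_integral k x f (measure \<mu> (cube k x) *\<^sub>R w)" "measure \<mu> (cube k x) \<noteq> 0"
  shows "avg k f x = w"
  using cube_integral_avg[OF assms(1)] assms(2) by simp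

lemma avg_null: "measure \<mu> (cube k x) = 0 \<Longrightarrow> avg k f x = 0"
  unfolding avg_def average_def
  using emeasure_eq_ennreal_measure[of \<mu> "cube k x"] by simp

lemma cube_integral_add:
  "cube_integral k x f v \<Longrightarrow> cube_integral k x g w \<Longrightarrow> cube_integral k x (\<lambda>y. f y + g y) (v + w)"
  unfolding cube_integral_def by (drule (1) has_strong_integral_add) (simp add: scaleR_add_right)

lemma avg_add:
  assumes "loc_integrable f" "loc_integrable g"
  shows "avg k (\<lambda>y. f y + g y) x = avg k f x + avg k g x"
proof (cases "measure \<mu> (cube k x) = 0")
  case False
  show ?thesis
    using cube_integral_add[OF loc_integrable_avg[OF assms(1)] loc_integrable_avg[OF assms(2)]] False
    by (intro avg_eqI) (simp_all add: scaleR_add_right)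
qed (simp add: avg_null)

lemma cube_integral_cong:
  assumes "\<And>y. y \<in> cube k x \<Longrightarrow> f y = g y"
  shows "cube_integral k x f v \<longleftrightarrow> cube_integral k x g v"
  unfolding cube_integral_def by (intro has_strong_integral_cong_AE AE_I2) (auto simp: indicator_def assms)

lemma avg_cong:
  assumes "\<And>y. y \<in> cube k x \<Longrightarrow> f y = g y"
  shows "avg k f x = avg k g x"
proof -
  have "(\<lambda>y. indicator (cube k x) y *\<^sub>R f y) = (\<lambda>y. indicator (cube k x) y *\<^sub>R g y)"
    using assms by (auto simp: indicator_def fun_eq_iff)
  then show ?thesis unfolding avg_def average_def by simp
qed

lemma avg_cong_AE:
  assumes "AE y in \<mu>. f y = g y"
  shows "avg k f x = avg k g x"
proof -
  have "AE y in \<mu>. indicator (cube k x) y *\<^sub>R f y = indicator (cube k x) y *\<^sub>R g y"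
    using assms by eventually_elim simp
  then show ?thesis unfolding avg_def average_def by (simp add: strong_integral_cong_AE)
qed

lemma cube_integral_const:
  assumes "\<And>y. y \<in> cube k x \<Longrightarrow> f y = c"
  shows "cube_integral k x f (measure \<mu> (cube k x) *\<^sub>R c)"
proof -
  have "cube_integral k x (\<lambda>_. c) (measure \<mu> (cube k x) *\<^sub>R c)"
    unfolding cube_integral_def by (rule has_strong_integral_indicator) auto
  then show ?thesis using cube_integral_cong[of k x f "\<lambda>_. c"] assms by blast
qed

lemma avg_const:
  assumes "\<And>y. y \<in> cube k x \<Longrightarrow> f y = c" "measure \<mu> (cube k x) \<noteq> 0"
  shows "avg k f x = c"
  using cube_integral_const[OF assms(1)] assms(2) by (rule avg_eqI)

text \<open>Existence of the integral over the parent is part of the conclusion; it rests on the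
  finite number of children.\<close>

lemma cube_integral_children:
  assumes F: "F \<subseteq> D (k + 1)" "finite F" "cube k x = \<Union>F"
    and v: "\<And>y. y \<in> cube k x \<Longrightarrow> cube_integral (k + 1) y f (v (cube (k + 1) y))"
  shows "cube_integral k x f (\<Sum>Q\<in>F. v Q)"
proof -
  have Q: "has_strong_integral \<mu> (\<lambda>y. indicator Q y *\<^sub>R f y) (v Q)" if "Q \<in> F" for Q
  proof -
    obtain y where y: "Q = cube (k + 1) y" using subsetD[OF F(1) \<open>Q \<in> F\<close>] by (auto simp: D_eq_cubes)
    then have "y \<in> cube k x" using F that by auto
    from v[OF this] y show ?thesis by (simp add: cube_integral_def)
  qed
  have "indicator (cube k x) y *\<^sub>R f y = (\<Sum>Q\<in>F. indicator Q y *\<^sub>R f y)" for y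
  proof (cases "y \<in> cube k x")
    case True
    then obtain Q where Q: "Q \<in> F" "y \<in> Q" using F by blast
    have "(\<Sum>Q\<in>F. indicator Q y *\<^sub>R f y) = (\<Sum>Q\<in>{Q}. indicator Q y *\<^sub>R f y)"
      using Q F cube_unique[of _ "k + 1" Q y] by (intro sum.mono_neutral_right) (auto simp: indicator_def)
    then show ?thesis using True Q by simp
  next
    case False
    then have "(\<Sum>Q\<in>F. indicator Q y *\<^sub>R f y) = 0" using F by (intro sum.neutral) (auto simp: indicator_def)
    then show ?thesis using False by simp
  qed
  then show ?thesis
    using has_strong_integral_sum[of F \<mu> "\<lambda>Q y. indicator Q y *\<^sub>R f y" v] Q by (simp add: cube_integral_def)
qed

text \<open>An average is the mean of the averages over the subcubes weighted by their masses. Null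
  subcubes have weight 0, so agreement is asked for on the others only. In this form it yields both
  the tower property and \<open>avg_tamed\<close>.\<close>

lemma avg_cong_next:
  fixes f g :: "real ^ 'n \<Rightarrow> 'a::banach"
  assumes f: "loc_integrable f" and g: "loc_integrable g"
    and eq: "\<And>y. y \<in> cube k x \<Longrightarrow> measure \<mu> (cube (k + 1) y) \<noteq> 0 \<Longrightarrow> avg (k + 1) f y = avg (k + 1) g y"
  shows "avg k f x = avg k g x"
proof (cases "measure \<mu> (cube k x) = 0")
  case False
  obtain F where F: "F \<subseteq> D (k + 1)" "finite F" "cube k x = \<Union>F" by (rule cube_children)
  \<comment> \<open>The contribution of a cube as a function of the cube alone; averages are
    constant on it, so any of its points gives the same value.\<close>
  define v where "v h Q = measure \<mu> Q *\<^sub>R avg (k + 1) h (SOME y. y \<in> Q)"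
    for h :: "real ^ 'n \<Rightarrow> 'a" and Q
  have v: "v h (cube (k + 1) y) = measure \<mu> (cube (k + 1) y) *\<^sub>R avg (k + 1) h y"
    for h :: "real ^ 'n \<Rightarrow> 'a" and y
  proof -
    have "(SOME z. z \<in> cube (k + 1) y) \<in> cube (k + 1) y" by (rule someI[of _ y]) simp
    then show ?thesis unfolding v_def using levelD[OF level_avg(1)] by metis
  qed
  have 1: "cube_integral k x h (\<Sum>Q\<in>F. v h Q)" if "loc_integrable h"
    for h :: "real ^ 'n \<Rightarrow> 'a"
    using loc_integrable_avg[OF that, of "k + 1"] by (intro cube_integral_children[OF F]) (simp add: v)
  have "v f Q = v g Q" if "Q \<in> F" for Q
  proof -
    obtain y where y: "Q = cube (k + 1) y" using subsetD[OF F(1) \<open>Q \<in> F\<close>] by (auto simp: D_eq_cubes)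
    then have "y \<in> cube k x" using F that by auto
    then show ?thesis using eq[of y] unfolding y v by auto
  qed
  then have "(\<Sum>Q\<in>F. v f Q) = (\<Sum>Q\<in>F. v g Q)" by (rule sum.cong[OF refl])
  then have "measure \<mu> (cube k x) *\<^sub>R avg k f x = measure \<mu> (cube k x) *\<^sub>R avg k g x"
    using cube_integral_avg[OF 1[OF f]] cube_integral_avg[OF 1[OF g]] by simp
  then show ?thesis using False by simp
qed (simp add: avg_null)

text \<open>On cubes of generation \<open>N\<close> or finer the function is constant. Downward
  induction reaches the coarser cubes, each a finite union of cubes one generation finer.\<close>

lemma level_loc_integrable:
  assumes "level N f" shows "loc_integrable f"
  unfolding loc_integrable_def
proof (intro allI)
  have const: "\<exists>v. cube_integral k x f v" if "N \<le> k" for k x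
    using cube_integral_const[of k x f "f x"] levelD[OF level_mono[OF assms that]] by blast
  have low: "\<exists>v. cube_integral (N - int j) x f v" for j x
  proof (induction j arbitrary: x)
    case 0
    then show ?case using const by simp
  next
    case (Suc j)
    define k where "k = N - int (Suc j)"
    obtain F where F: "F \<subseteq> D (k + 1)" "finite F" "cube k x = \<Union>F" by (rule cube_children)
    have k: "k + 1 = N - int j" by (simp add: k_def)
    have "\<exists>v. cube_integral (k + 1) y f v" for y using Suc unfolding k .
    then obtain v where "\<And>y. cube_integral (k + 1) y f (v y)" by metis
    \<comment> \<open>Values chosen point by point become values per cube by evaluation at a
      representative.\<close>
    then have "cube_integral (k + 1) y f (v (SOME z. z \<in> cube (k + 1) y))" for y
    proof -
      have "(SOME z. z \<in> cube (k + 1) y) \<in> cube (k + 1) y" by (rule someI[of _ y]) simp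
      then have "cube (k + 1) (SOME z. z \<in> cube (k + 1) y) = cube (k + 1) y" by (simp add: mem_cube_iff)
      then show ?thesis using \<open>\<And>y. cube_integral (k + 1) y f (v y)\<close> unfolding cube_integral_def by metis
    qed
    then have "cube_integral k x f (\<Sum>Q\<in>F. v (SOME z. z \<in> Q))"
      by (intro cube_integral_children[OF F])
    then show ?case unfolding k_def by blast
  qed
  fix k x
  show "\<exists>v. cube_integral k x f v"
  proof (cases "N \<le> k")
    case False
    then show ?thesis using low[of "nat (N - k)" x] by simp
  qed (rule const)
qed

lemma avg_tower:
  assumes "loc_integrable f" shows "avg k (avg (k + 1) f) x = avg k f x"
  using level_loc_integrable[OF level_avg(1)] assms
proof (rule avg_cong_next)
  fix y assume "measure \<mu> (cube (k + 1) y) \<noteq> 0"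
  then show "avg (k + 1) (avg (k + 1) f) y = avg (k + 1) f y"
    by (intro avg_const[OF levelD[OF level_avg(1)]])
qed

lemma loc_integrableI:
  assumes f: "strongly_measurable \<mu> f"
    and fin: "\<And>k x. (\<integral>\<^sup>+y. ennreal (norm (f y)) * indicator (cube k x) y \<partial>\<mu>) < \<infinity>"
  shows "loc_integrable f"
  unfolding loc_integrable_def cube_integral_def
proof (intro allI has_strong_integral_exists)
  fix k x
  show "strongly_measurable \<mu> (\<lambda>y. indicator (cube k x) y *\<^sub>R f y)"
    by (intro strongly_measurable_scaleR f simple_function_indicator) simp
  have "(\<integral>\<^sup>+y. norm (indicator (cube k x) y *\<^sub>R f y) \<partial>\<mu>) = (\<integral>\<^sup>+y. ennreal (norm (f y)) * indicator (cube k x) y \<partial>\<mu>)"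
    by (intro nn_integral_cong) (auto simp: indicator_def)
  then show "(\<integral>\<^sup>+y. norm (indicator (cube k x) y *\<^sub>R f y) \<partial>\<mu>) < \<infinity>" using fin by simp
qed

lemma norm_avg_le:
  assumes "loc_integrable f"
  shows "ennreal (norm (avg k f x)) \<le> nn_avg k (\<lambda>y. ennreal (norm (f y))) x"
proof (cases "measure \<mu> (cube k x) = 0")
  case True
  then show ?thesis by (simp add: avg_null)
next
  case False
  then have m: "measure \<mu> (cube k x) > 0" by (simp add: less_le)
  have em: "emeasure \<mu> (cube k x) = ennreal (measure \<mu> (cube k x))" by (intro emeasure_eq_ennreal_measure) simp
  have "ennreal (measure \<mu> (cube k x) * norm (avg k f x)) \<le> (\<integral>\<^sup>+y. norm (indicator (cube k x) y *\<^sub>R f y) \<partial>\<mu>)"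
    using has_strong_integral_norm_le[OF loc_integrable_avg[OF assms, unfolded cube_integral_def], of k x] by simp
  also have "\<dots> = (\<integral>\<^sup>+y. ennreal (norm (f y)) * indicator (cube k x) y \<partial>\<mu>)"
    by (intro nn_integral_cong) (auto simp: indicator_def)
  finally have "ennreal (measure \<mu> (cube k x) * norm (avg k f x)) / emeasure \<mu> (cube k x) \<le> nn_avg k (\<lambda>y. ennreal (norm (f y))) x"
    unfolding nn_avg_def by (rule divide_right_mono_ennreal)
  then show ?thesis using m unfolding em by (simp add: divide_ennreal)
qed

text \<open>The characteristic property of conditional expectation, checked cube by cube: on a cube
  of generation \<open>k\<close> both the average and \<open>Z\<close> are constant. On a null cube
  the integral of \<open>u\<close> vanishes, in accordance with the quotient 0.\<close>

lemma nn_avg_integral: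
  assumes [measurable]: "u \<in> borel_measurable \<mu>" and Z: "level k Z"
  shows "(\<integral>\<^sup>+x. nn_avg k u x * indicator {x. Z x} x \<partial>\<mu>) = (\<integral>\<^sup>+x. u x * indicator {x. Z x} x \<partial>\<mu>)"
proof -
  have [measurable]: "{x. Z x} \<in> sets \<mu>" by (rule level_sets[OF Z])
  have [measurable]: "nn_avg k u \<in> borel_measurable \<mu>" by (rule level_measurable[OF level_avg(2)])
  have "(\<integral>\<^sup>+x. nn_avg k u x * indicator {x. Z x} x * indicator (cube k z) x \<partial>\<mu>) =
      (\<integral>\<^sup>+x. u x * indicator {x. Z x} x * indicator (cube k z) x \<partial>\<mu>)" for z
  proof -
    have 1: "(\<integral>\<^sup>+x. h x * indicator {x. Z x} x * indicator (cube k z) x \<partial>\<mu>) =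
       indicator {x. Z x} z * (\<integral>\<^sup>+x. h x * indicator (cube k z) x \<partial>\<mu>)" if [measurable]: "h \<in> borel_measurable \<mu>" for h
    proof -
      have "(\<integral>\<^sup>+x. h x * indicator {x. Z x} x * indicator (cube k z) x \<partial>\<mu>)
        = (\<integral>\<^sup>+x. indicator {x. Z x} z * (h x * indicator (cube k z) x) \<partial>\<mu>)"
      proof (rule nn_integral_cong)
        fix x
        show "h x * indicator {x. Z x} x * indicator (cube k z) x
          = indicator {x. Z x} z * (h x * indicator (cube k z) x)"
        proof (cases "x \<in> cube k z")
          case True
          then have "Z x = Z z" by (rule levelD[OF Z])
          then show ?thesis by (simp add: indicator_def mult.commute)
        qed simp
      qed
      then show ?thesis by (simp add: nn_integral_cmult)
    qed
    have "(\<integral>\<^sup>+x. nn_avg k u x * indicator (cube k z) x \<partial>\<mu>) = (\<integral>\<^sup>+x. nn_avg k u z * indicator (cube k z) x \<partial>\<mu>)"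
    proof (rule nn_integral_cong)
      fix x
      show "nn_avg k u x * indicator (cube k z) x = nn_avg k u z * indicator (cube k z) x"
        using levelD[OF level_avg(2)[of k u], of x z] by (cases "x \<in> cube k z") simp_all
    qed
    also have "\<dots> = nn_avg k u z * emeasure \<mu> (cube k z)"
      by (intro nn_integral_cmult_indicator) simp
    also have "\<dots> = (\<integral>\<^sup>+x. u x * indicator (cube k z) x \<partial>\<mu>)"
      using nn_integral_null_cube[of k z u] emeasure_cube_finite[of k z]
      by (cases "emeasure \<mu> (cube k z) = 0")
         (simp_all add: nn_avg_def ennreal_divide_times mult_divide_eq_ennreal)
    finally show ?thesis by (simp add: 1)
  qed
  then have "(\<integral>\<^sup>+x. nn_avg k u x * indicator {x. Z x} x * indicator Q x \<partial>\<mu>) =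
      (\<integral>\<^sup>+x. u x * indicator {x. Z x} x * indicator Q x \<partial>\<mu>)" if "Q \<in> D k" for Q
    using that by (auto simp: D_eq_cubes)
  then show ?thesis
    using nn_integral_cubes[of "\<lambda>x. nn_avg k u x * indicator {x. Z x} x" k]
      nn_integral_cubes[of "\<lambda>x. u x * indicator {x. Z x} x" k]
    by (simp cong: nn_integral_cong_simp)
qed

text \<open>Each of the countably many generations has countably many null cubes. Outside their
  union the convention that averages over null cubes are 0 is never met.\<close>

lemma AE_cube_pos: "AE x in \<mu>. \<forall>k. measure \<mu> (cube k x) \<noteq> 0"
proof -
  have "AE x in \<mu>. measure \<mu> (cube k x) \<noteq> 0" for k
  proof (rule AE_I')
    let ?N = "\<Union>{Q\<in>D k. emeasure \<mu> Q = 0}"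
    have "(\<Union>Q\<in>{Q\<in>D k. emeasure \<mu> Q = 0}. Q) \<in> null_sets \<mu>"
      by (intro null_sets_UN' countable_subset[OF _ countable_D[of k]]) (auto simp: null_sets_def D_eq_cubes)
    then show "?N \<in> null_sets \<mu>" by simp
    show "{x \<in> space \<mu>. \<not> measure \<mu> (cube k x) \<noteq> 0} \<subseteq> ?N"
    proof
      fix x assume "x \<in> {x \<in> space \<mu>. \<not> measure \<mu> (cube k x) \<noteq> 0}"
      then have "emeasure \<mu> (cube k x) = 0" using emeasure_eq_ennreal_measure[of \<mu> "cube k x"] by simp
      then show "x \<in> ?N" using cube_in in_cube by blast
    qed
  qed
  then show ?thesis by (simp add: AE_all_countable)
qed

end

section \<open>Powers of extended nonnegative reals\<close>

lemma ennreal_powr_ennreal: "a \<ge> 0 \<Longrightarrow> ennreal_powr (ennreal a) p = ennreal (a powr p)"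
  by (simp add: ennreal_powr_def)

lemma ennreal_powr_top: "ennreal_powr top p = top"
  by (simp add: ennreal_powr_def)

lemma ennreal_powr_mono: "p \<ge> 0 \<Longrightarrow> a \<le> b \<Longrightarrow> ennreal_powr a p \<le> ennreal_powr b p"
  by (cases a; cases b) (auto simp: ennreal_powr_ennreal ennreal_powr_top ennreal_le_iff top_unique intro!: ennreal_leI powr_mono2)

lemma ennreal_powr_inverse: "p > 0 \<Longrightarrow> ennreal_powr (ennreal_powr a p) (1 / p) = a"
  by (cases a) (auto simp: ennreal_powr_ennreal ennreal_powr_top powr_powr)

lemma ennreal_powr_inverse': "p > 0 \<Longrightarrow> ennreal_powr (ennreal_powr a (1 / p)) p = a"
  using ennreal_powr_inverse[of "1 / p" a] by simp

lemma ennreal_powr_one: "ennreal_powr a 1 = a"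
  by (cases a) (auto simp: ennreal_powr_ennreal ennreal_powr_top)

lemma ennreal_powr_mult:
  assumes "K > 0" shows "ennreal_powr (ennreal K * a) q = ennreal (K powr q) * ennreal_powr a q"
proof (cases a)
  case (real r)
  then show ?thesis using assms
    by (simp add: ennreal_powr_ennreal powr_mult flip: ennreal_mult)
next
  case top
  then show ?thesis using assms by (simp add: ennreal_powr_top ennreal_mult_top)
qed

text \<open>The inverse power is monotone, so an upper bound for the powers yields one for the
  bases.\<close>

lemma ennreal_powr_SUP_le:
  assumes "p > 0" shows "ennreal_powr (SUP i. a i) p \<le> (SUP i. ennreal_powr (a i) p)"
proof -
  have "a i \<le> ennreal_powr (SUP i. ennreal_powr (a i) p) (1 / p)" for i
  proof -
    have "a i = ennreal_powr (ennreal_powr (a i) p) (1 / p)" using assms by (simp add: ennreal_powr_inverse)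
    also have "\<dots> \<le> ennreal_powr (SUP i. ennreal_powr (a i) p) (1 / p)"
      using assms by (intro ennreal_powr_mono SUP_upper) auto
    finally show ?thesis .
  qed
  then have "ennreal_powr (SUP i. a i) p \<le> ennreal_powr (ennreal_powr (SUP i. ennreal_powr (a i) p) (1 / p)) p"
    using assms by (intro ennreal_powr_mono SUP_least) auto
  then show ?thesis using assms by (simp add: ennreal_powr_inverse')
qed

lemma ennreal_powr_measurable [measurable]: "(\<lambda>a. ennreal_powr a p) \<in> borel_measurable borel"
  unfolding ennreal_powr_def by measurable

lemma Lp_norm_vec_eq:
  "Lp_norm_vec M p f = ennreal_powr (\<integral>\<^sup>+x. ennreal (norm (f x) powr p) \<partial>M) (1 / p)"
  by (simp add: Lp_norm_vec_def Lp_norm_def ennreal_powr_ennreal)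

lemma Lp_norm_vec_1: "Lp_norm_vec M 1 f = (\<integral>\<^sup>+x. ennreal (norm (f x)) \<partial>M)"
  by (simp add: Lp_norm_vec_eq ennreal_powr_one)

lemma ennreal_powr_less_top: "a < top \<Longrightarrow> ennreal_powr a q < top"
  by (cases a) (auto simp: ennreal_powr_ennreal)

lemma Lp_vec_iff:
  assumes "p > 0"
  shows "f \<in> Lp_vec M p \<longleftrightarrow> strongly_measurable M f \<and> (\<integral>\<^sup>+x. ennreal (norm (f x) powr p) \<partial>M) < \<infinity>"
proof -
  let ?I = "\<integral>\<^sup>+x. ennreal (norm (f x) powr p) \<partial>M"
  have "ennreal_powr ?I (1 / p) < top \<longleftrightarrow> ?I < top"
    using ennreal_powr_less_top[of ?I "1 / p"] ennreal_powr_less_top[of "ennreal_powr ?I (1 / p)" p]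
      ennreal_powr_inverse'[OF assms, of ?I] by auto
  then show ?thesis by (simp add: Lp_vec_def Lp_norm_vec_eq)
qed

lemma Lp_norm_le_iff:
  assumes "p > 0" "C > 0"
  shows "Lp_norm M p g \<le> ennreal C * Lp_norm_vec M p f \<longleftrightarrow>
    (\<integral>\<^sup>+x. ennreal_powr (g x) p \<partial>M) \<le> ennreal (C powr p) * (\<integral>\<^sup>+x. ennreal (norm (f x) powr p) \<partial>M)"
    (is "?L \<longleftrightarrow> ?I \<le> ?J")
proof -
  have J: "ennreal C * Lp_norm_vec M p f = ennreal_powr ?J (1 / p)"
    using assms by (simp add: Lp_norm_vec_eq ennreal_powr_mult powr_powr)
  show ?thesis unfolding J Lp_norm_def
    using ennreal_powr_mono[of "1 / p" ?I ?J] ennreal_powr_mono[of p "ennreal_powr ?I (1 / p)" "ennreal_powr ?J (1 / p)"]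
      assms by (auto simp: ennreal_powr_inverse')
qed

section \<open>Truncated maximal functions\<close>

definition first_time :: "(nat \<Rightarrow> 'x \<Rightarrow> bool) \<Rightarrow> nat \<Rightarrow> 'x \<Rightarrow> bool" where
  "first_time P j x \<longleftrightarrow> P j x \<and> (\<forall>i<j. \<not> P i x)"

text \<open>The sets of first occurrence are disjoint and exhaust the union, so estimates over them
  add up without loss.\<close>

lemma sum_first_time:
  "(\<Sum>j\<le>n. indicator {x. first_time P j x} x) = (indicator {x. \<exists>j\<le>n. P j x} x :: ennreal)"
proof (induction n)
  case 0
  then show ?case by (simp add: first_time_def indicator_def)
next
  case (Suc n)
  have "first_time P (Suc n) x \<longleftrightarrow> P (Suc n) x \<and> \<not> (\<exists>j\<le>n. P j x)"
    by (auto simp: first_time_def less_Suc_eq_le)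
  then show ?case using Suc by (auto simp: indicator_def le_Suc_eq)
qed

locale rademacher_dyadic = banach_scaled smul + dyadic_measure \<mu> D
  for smul :: "'k::{real_normed_field, euclidean_space} \<Rightarrow> 'a::banach \<Rightarrow> 'a"
    and \<mu> :: "(real ^ 'n) measure" and D :: "int \<Rightarrow> (real ^ 'n) set set"
begin

abbreviation "maximal \<equiv> rademacher_maximal smul \<mu> D"

text \<open>The lower end \<open>b\<close> gives stopping arguments a first generation; the upper
  end makes the R-bound finite and the function constant on cubes of generation
  \<open>b + n\<close>.\<close>

definition truncated :: "int \<Rightarrow> nat \<Rightarrow> (real ^ 'n \<Rightarrow> 'a) \<Rightarrow> real ^ 'n \<Rightarrow> ennreal" where
  "truncated b n f x = R {avg (b + int j) f x |j. j \<le> n}"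

lemma maximal_eq: "maximal f x = R (range (\<lambda>k. avg k f x))"
proof -
  have "{average \<mu> f Q |Q. Q \<in> (\<Union>k. D k) \<and> x \<in> Q} = range (\<lambda>k. avg k f x)"
  proof (intro equalityI subsetI)
    fix z assume "z \<in> {average \<mu> f Q |Q. Q \<in> (\<Union>k. D k) \<and> x \<in> Q}"
    then obtain Q k where Q: "z = average \<mu> f Q" "Q \<in> D k" "x \<in> Q" by blast
    then have "z = avg k f x" using cube_eqI[of Q k x] by (simp add: avg_def)
    then show "z \<in> range (\<lambda>k. avg k f x)" by blast
  next
    fix z assume "z \<in> range (\<lambda>k. avg k f x)"
    then obtain k where "z = average \<mu> f (cube k x)" by (auto simp: avg_def)
    then show "z \<in> {average \<mu> f Q |Q. Q \<in> (\<Union>k. D k) \<and> x \<in> Q}" using cube_in in_cube by blast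
  qed
  then show ?thesis unfolding rademacher_maximal_def by simp
qed

lemma truncated_le_maximal: "truncated b n f x \<le> maximal f x"
  unfolding truncated_def maximal_eq by (intro R_bound_mono) auto

lemma truncated_image: "truncated b n f x = R ((\<lambda>j. avg (b + int j) f x) ` {..n})"
  unfolding truncated_def by (rule arg_cong[where f=R]) auto

lemma truncated_mono: "m \<le> n \<Longrightarrow> truncated b m f x \<le> truncated b n f x"
  unfolding truncated_def by (intro R_bound_mono) auto

lemma truncated_finite: "truncated b n f x < top"
  using R_bound_finite[of "(\<lambda>j. avg (b + int j) f x) ` {..n}"] by (simp add: truncated_image)

lemma incseq_truncated: "incseq (\<lambda>i. truncated (- int i) (2 * i) f x)"
proof (intro incseq_SucI)
  fix i
  have "{avg (- int i + int j) f x |j. j \<le> 2 * i} \<subseteq> {avg (- int (Suc i) + int j) f x |j. j \<le> 2 * Suc i}"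
  proof
    fix z assume "z \<in> {avg (- int i + int j) f x |j. j \<le> 2 * i}"
    then obtain j where "z = avg (- int i + int j) f x" "j \<le> 2 * i" by blast
    then have "z = avg (- int (Suc i) + int (Suc j)) f x" "Suc j \<le> 2 * Suc i" by simp_all
    then show "z \<in> {avg (- int (Suc i) + int j) f x |j. j \<le> 2 * Suc i}" by blast
  qed
  then show "truncated (- int i) (2 * i) f x \<le> truncated (- int (Suc i)) (2 * Suc i) f x"
    unfolding truncated_def by (rule R_bound_mono)
qed

text \<open>The window that starts at \<open>- int i\<close> with \<open>j\<close> up to
  \<open>2 * i\<close> consists of the generations from \<open>- int i\<close> to
  \<open>int i\<close>, and these exhaust the integers.\<close>

lemma maximal_SUP: "maximal f x = (SUP i. truncated (- int i) (2 * i) f x)"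
proof (rule antisym)
  define S where "S i = (\<lambda>k. avg k f x) ` {- int i..int i}" for i
  have "incseq S" unfolding S_def by (intro incseq_SucI image_mono) auto
  moreover have "(\<Union>i. S i) = range (\<lambda>k. avg k f x)"
  proof (intro equalityI subsetI)
    fix z assume "z \<in> range (\<lambda>k. avg k f x)"
    then obtain k where "z = avg k f x" by blast
    then have "z \<in> S (nat \<bar>k\<bar>)" unfolding S_def by (intro image_eqI[of _ _ k]) auto
    then show "z \<in> (\<Union>i. S i)" by blast
  qed (auto simp: S_def)
  ultimately have "maximal f x = (SUP i. R (S i))" using R_bound_incseq_Union[of S] by (simp add: maximal_eq)
  also have "\<dots> \<le> (SUP i. truncated (- int i) (2 * i) f x)"
  proof (intro SUP_mono)
    fix i
    have "S i \<subseteq> {avg (- int i + int j) f x |j. j \<le> 2 * i}"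
    proof
      fix z assume "z \<in> S i"
      then obtain k where "z = avg k f x" "- int i \<le> k" "k \<le> int i" by (auto simp: S_def)
      then have "z = avg (- int i + int (nat (k + int i))) f x" "nat (k + int i) \<le> 2 * i" by simp_all
      then show "z \<in> {avg (- int i + int j) f x |j. j \<le> 2 * i}" by blast
    qed
    then show "\<exists>m\<in>UNIV. R (S i) \<le> truncated (- int m) (2 * m) f x"
      unfolding truncated_def using R_bound_mono by blast
  qed
  finally show "maximal f x \<le> (SUP i. truncated (- int i) (2 * i) f x)" .
  show "(SUP i. truncated (- int i) (2 * i) f x) \<le> maximal f x"
    by (intro SUP_least truncated_le_maximal)
qed

lemma level_truncated: "level (b + int n) (truncated b n f)"
  unfolding level_def
proof (intro allI impI)
  fix x y assume eq: "cube (b + int n) y = cube (b + int n) x"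
  have "avg (b + int j) f y = avg (b + int j) f x" if "j \<le> n" for j
    by (rule levelD[OF level_mono[OF level_avg(1), of "b + int j" "b + int n"]])
       (use that eq in \<open>simp_all add: mem_cube_iff\<close>)
  then have "(\<lambda>j. avg (b + int j) f y) ` {..n} = (\<lambda>j. avg (b + int j) f x) ` {..n}"
    by (intro image_cong) simp_all
  then show "truncated b n f y = truncated b n f x" unfolding truncated_image by (rule arg_cong)
qed

lemma truncated_measurable [measurable]: "truncated b n f \<in> borel_measurable \<mu>"
  by (rule level_measurable[OF level_truncated])

lemma maximal_measurable [measurable]: "maximal f \<in> borel_measurable \<mu>"
proof -
  have "(\<lambda>x. SUP i. truncated (- int i) (2 * i) f x) \<in> borel_measurable \<mu>" by measurable
  then show ?thesis by (simp add: maximal_SUP[abs_def])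
qed

lemma maximal_cong_AE: "AE x in \<mu>. f x = g x \<Longrightarrow> maximal f = maximal g"
  by (auto simp: maximal_eq avg_cong_AE fun_eq_iff)

end

section \<open>From weak type to strong type\<close>

context rademacher_dyadic
begin

lemma level_first_time:
  assumes "\<And>i. level (b + int i) (P i)"
  shows "level (b + int j) (first_time P j)"
proof -
  \<comment> \<open>The conjunct \<open>i \<le> j\<close> discards the predicates of later
    generations, which may fail to be constant on cubes of generation \<open>b + j\<close>.\<close>
  have "level (b + int j) (\<lambda>x. i \<le> j \<and> P i x)" for i
  proof (cases "i \<le> j")
    case True
    then show ?thesis using level_mono[OF assms[of i], of "b + int j"] by simp
  qed (simp add: level_def)
  then have "level (b + int j) (\<lambda>x. (\<lambda>h. h j \<and> (\<forall>i<j. \<not> h i)) (\<lambda>i. i \<le> j \<and> P i x))"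
    by (rule level_all)
  moreover have "(\<lambda>x. (\<lambda>h. h j \<and> (\<forall>i<j. \<not> h i)) (\<lambda>i. i \<le> j \<and> P i x)) = first_time P j"
    by (auto simp: fun_eq_iff first_time_def)
  ultimately show ?thesis by simp
qed

text \<open>Each \<open>g j\<close> lives on the set where level \<open>t\<close> is first exceeded
  at \<open>j\<close>. These sets are disjoint, so \<open>n + 1\<close> uses of the weak type
  inequality cost a single integral of the norm over their union.\<close>

lemma weak_type_localized:
  assumes weak: "\<And>g s. g \<in> Lp_vec \<mu> 1 \<Longrightarrow> s > 0 \<Longrightarrow>
      emeasure \<mu> {x. maximal g x > ennreal s} \<le> ennreal (C / s) * Lp_norm_vec \<mu> 1 g"
    and f: "strongly_measurable \<mu> f" and fm[measurable]: "(\<lambda>x. norm (f x)) \<in> borel_measurable \<mu>"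
    and fin: "(\<integral>\<^sup>+x. norm (f x) \<partial>\<mu>) < \<infinity>" and t: "t > 0"
  shows "emeasure \<mu> {x. ennreal (2 * t) < truncated b n f x} \<le>
    ennreal (C / t) * (\<integral>\<^sup>+x. ennreal (norm (f x)) * indicator {x. ennreal t < truncated b n f x} x \<partial>\<mu>)"
proof -
  define P where "P j x \<longleftrightarrow> ennreal t < truncated b j f x" for j x
  define Z where "Z j = {x. first_time P j x}" for j
  define g where "g j x = indicator (Z j) x *\<^sub>R f x" for j x
  have levP: "level (b + int i) (P i)" for i
    unfolding P_def by (rule level_compose[OF level_truncated])
  have levZ: "level (b + int j) (first_time P j)" for j
    by (rule level_first_time[OF levP])
  have [measurable, simp]: "Z j \<in> sets borel" for j
    using level_sets[OF levZ] by (simp add: Z_def)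
  have norm_g: "ennreal (norm (g j x)) = ennreal (norm (f x)) * indicator (Z j) x" for j x
    by (simp add: g_def indicator_def)
  have g1: "g j \<in> Lp_vec \<mu> 1" for j
  proof -
    have "strongly_measurable \<mu> (g j)"
      unfolding g_def by (intro strongly_measurable_scaleR f simple_function_indicator) simp
    moreover have "(\<integral>\<^sup>+x. norm (g j x) \<partial>\<mu>) \<le> (\<integral>\<^sup>+x. norm (f x) \<partial>\<mu>)"
      by (intro nn_integral_mono) (simp add: norm_g indicator_def)
    ultimately show ?thesis using fin by (simp add: Lp_vec_iff le_less_trans)
  qed
  have sub: "{x. ennreal (2 * t) < truncated b n f x} \<subseteq> (\<Union>j\<le>n. {x. maximal (g j) x > ennreal t})"
  proof
    fix x assume "x \<in> {x. ennreal (2 * t) < truncated b n f x}"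
    then have big: "ennreal (2 * t) < truncated b n f x" by simp
    moreover have "ennreal t \<le> ennreal (2 * t)" using t by (intro ennreal_leI) simp
    ultimately have "P n x" unfolding P_def by (rule le_less_trans[rotated])
    then have "\<exists>j\<le>n. P j x" by blast
    then have "(\<Sum>j\<le>n. indicator {x. first_time P j x} x) \<noteq> (0::ennreal)" by (simp add: sum_first_time)
    then obtain j where j: "j \<le> n" "first_time P j x" by (auto simp: indicator_def split: if_splits)
    let ?A = "(\<lambda>i. avg (b + int i) f x) ` {..<j}" and ?B = "(\<lambda>i. avg (b + int i) f x) ` {j..n}"
    \<comment> \<open>For \<open>j = 0\<close> the window contains no proper ancestor; otherwise the
      ancestors end at \<open>j - 1\<close>, where \<open>t\<close> is not yet exceeded.\<close>
    have A: "R ?A \<le> ennreal t"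
    proof (cases j)
      case 0
      then show ?thesis by (simp add: R_bound_empty)
    next
      case (Suc i)
      then have "\<not> P i x" using j(2) by (simp add: first_time_def)
      moreover have "R ?A = truncated b i f x" by (simp add: truncated_image Suc lessThan_Suc_atMost)
      ultimately show ?thesis by (simp add: P_def not_less)
    qed
    \<comment> \<open>The time of first exceedance is the same on the whole cube of generation
      \<open>b + j\<close>, so \<open>f\<close> and \<open>g j\<close> agree there and on all
      smaller cubes around \<open>x\<close>.\<close>
    have "avg (b + int i) f x = avg (b + int i) (g j) x" if "i \<ge> j" for i
    proof (rule avg_cong)
      fix y assume "y \<in> cube (b + int i) x"
      then have "y \<in> cube (b + int j) x" using cube_antimono[of "b + int j" "b + int i"] that by auto
      then have "first_time P j y" using levelD[OF levZ] j(2) by blast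
      then show "f y = g j y" by (simp add: g_def Z_def)
    qed
    then have "?B \<subseteq> range (\<lambda>k. avg k (g j) x)" by auto
    then have B: "R ?B \<le> maximal (g j) x" unfolding maximal_eq by (rule R_bound_mono)
    have "truncated b n f x \<le> R (?A \<union> ?B)"
      unfolding truncated_image image_Un[symmetric] by (intro R_bound_mono image_mono) auto
    also have "\<dots> \<le> R ?A + R ?B" by (rule R_bound_Un_le)
    also have "\<dots> \<le> ennreal t + maximal (g j) x" using A B by (rule add_mono)
    finally have le: "truncated b n f x \<le> ennreal t + maximal (g j) x" .
    have "\<not> maximal (g j) x \<le> ennreal t"
    proof
      assume "maximal (g j) x \<le> ennreal t"
      then have "truncated b n f x \<le> ennreal t + ennreal t" using le by (meson add_left_mono order_trans)
      also have "\<dots> = ennreal (2 * t)" using t by (simp flip: ennreal_plus)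
      finally show False using big by simp
    qed
    then show "x \<in> (\<Union>j\<le>n. {x. maximal (g j) x > ennreal t})" using j(1) by (auto simp: not_le)
  qed
  have ms: "{x. maximal (g j) x > ennreal t} \<in> sets \<mu>" for j
  proof -
    have "{x\<in>space \<mu>. maximal (g j) x > ennreal t} \<in> sets \<mu>" by measurable
    then show ?thesis by simp
  qed
  have "emeasure \<mu> {x. ennreal (2 * t) < truncated b n f x} \<le> emeasure \<mu> (\<Union>j\<le>n. {x. maximal (g j) x > ennreal t})"
    using ms by (intro emeasure_mono sub sets.finite_UN) auto
  also have "\<dots> \<le> (\<Sum>j\<le>n. emeasure \<mu> {x. maximal (g j) x > ennreal t})"
    using ms by (intro emeasure_subadditive_finite) auto
  also have "\<dots> \<le> (\<Sum>j\<le>n. ennreal (C / t) * (\<integral>\<^sup>+x. ennreal (norm (f x)) * indicator (Z j) x \<partial>\<mu>))"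
    using weak[OF g1 t] by (intro sum_mono) (simp add: Lp_norm_vec_1 norm_g)
  also have "\<dots> = ennreal (C / t) * (\<integral>\<^sup>+x. (\<Sum>j\<le>n. ennreal (norm (f x)) * indicator (Z j) x) \<partial>\<mu>)"
    by (subst nn_integral_sum) (simp_all add: sum_distrib_left)
  also have "(\<lambda>x. \<Sum>j\<le>n. ennreal (norm (f x)) * indicator (Z j) x)
      = (\<lambda>x. ennreal (norm (f x)) * indicator {x. \<exists>j\<le>n. P j x} x)"
    by (simp only: Z_def sum_first_time sum_distrib_left[symmetric])
  also have "{x. \<exists>j\<le>n. P j x} = {x. ennreal t < truncated b n f x}"
    unfolding P_def using truncated_mono[of _ n b f] by (auto intro: less_le_trans)
  finally show ?thesis .
qed

text \<open>A finite window makes the truncated function real valued, as Doob's inequality demands;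
  the constant is the same for all windows.\<close>

lemma truncated_Lp_le:
  assumes weak: "\<And>g s. g \<in> Lp_vec \<mu> 1 \<Longrightarrow> s > 0 \<Longrightarrow>
      emeasure \<mu> {x. maximal g x > ennreal s} \<le> ennreal (C / s) * Lp_norm_vec \<mu> 1 g"
    and f: "strongly_measurable \<mu> f" and fm[measurable]: "(\<lambda>x. norm (f x)) \<in> borel_measurable \<mu>"
    and fin: "(\<integral>\<^sup>+x. norm (f x) \<partial>\<mu>) < \<infinity>" and C: "C > 0" and p: "p > 1"
  shows "(\<integral>\<^sup>+x. ennreal_powr (truncated b n f x) p \<partial>\<mu>) \<le>
    ennreal (doob_const p C) * (\<integral>\<^sup>+x. ennreal (norm (f x) powr p) \<partial>\<mu>)"
proof -
  define g where "g x = enn2real (truncated b n f x)" for x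
  have g: "truncated b n f x = ennreal (g x)" for x
    unfolding g_def using truncated_finite[of b n f x] by simp
  have [measurable]: "g \<in> borel_measurable \<mu>" unfolding g_def by measurable
  have "(\<integral>\<^sup>+x. ennreal (g x powr p) \<partial>\<mu>) \<le> ennreal (doob_const p C) * (\<integral>\<^sup>+x. ennreal (norm (f x) powr p) \<partial>\<mu>)"
  proof (rule Doob_type_inequality[OF _ fm _ _ p C _ fin])
    fix t :: real assume t: "t > 0"
    have "{x. ennreal s < truncated b n f x} = {x. s < g x}" if "s > 0" for s
      using that by (auto simp: g ennreal_less_iff)
    from weak_type_localized[OF weak f fm fin t, of b n] this[OF t] this[of "2 * t"] t
    show "emeasure \<mu> {x \<in> space \<mu>. 2 * t < g x} \<le> ennreal (C / t) * (\<integral>\<^sup>+x. ennreal (norm (f x)) * indicator {..<g x} t \<partial>\<mu>)"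
      by (simp add: indicator_def)
  qed (simp_all add: g_def)
  moreover have "g x \<ge> 0" for x by (simp add: g_def)
  ultimately show ?thesis by (simp add: g ennreal_powr_ennreal)
qed

text \<open>Pointwise \<open>a \<le> 1 + a powr p\<close>, and the constant 1 is integrable on
  \<open>B\<close>.\<close>

lemma powr_integrable_imp_integrable:
  assumes [measurable]: "(\<lambda>x. norm (f x :: 'a)) \<in> borel_measurable \<mu>" "B \<in> sets \<mu>"
    and p: "p \<ge> 1" and B: "emeasure \<mu> B < \<infinity>"
    and fin: "(\<integral>\<^sup>+x. ennreal (norm (f x) powr p) \<partial>\<mu>) < \<infinity>"
  shows "(\<integral>\<^sup>+x. ennreal (norm (f x)) * indicator B x \<partial>\<mu>) < \<infinity>"
proof -
  have "a \<le> 1 + a powr p" if "a \<ge> 0" for a :: real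
  proof (cases "a \<le> 1")
    case False
    then have "a powr 1 \<le> a powr p" using p by (intro powr_mono) auto
    then show ?thesis using False by simp
  qed (simp add: add_increasing2)
  then have "ennreal (norm (f x)) \<le> 1 + ennreal (norm (f x) powr p)" for x
    using ennreal_leI[of "norm (f x)" "1 + norm (f x) powr p"] by simp
  then have "(\<integral>\<^sup>+x. ennreal (norm (f x)) * indicator B x \<partial>\<mu>) \<le> (\<integral>\<^sup>+x. indicator B x + ennreal (norm (f x) powr p) \<partial>\<mu>)"
    by (intro nn_integral_mono) (simp add: indicator_def)
  also have "\<dots> = emeasure \<mu> B + (\<integral>\<^sup>+x. ennreal (norm (f x) powr p) \<partial>\<mu>)"
    using assms(2) by (simp add: nn_integral_add)
  also have "\<dots> < \<infinity>" using B fin by simp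
  finally show ?thesis .
qed

lemma strongly_measurable_nice:
  assumes "strongly_measurable \<mu> f"
  obtains g where "strongly_measurable \<mu> g" "(\<lambda>x. norm (g x)) \<in> borel_measurable \<mu>" "AE x in \<mu>. f x = g x"
proof -
  obtain s g where sg: "\<forall>i. simple_function \<mu> (s i)" "\<forall>x\<in>space \<mu>. (\<lambda>i. s i x) \<longlonglongrightarrow> g x"
    and fg: "AE x in \<mu>. f x = g x" by (rule strongly_measurable_obtain_limit[OF assms])
  have "(\<lambda>x. norm (g x)) \<in> borel_measurable \<mu>"
    by (rule limit_simple_norm_measurable[of _ s]) (use sg in blast)+
  moreover have "strongly_measurable \<mu> g" using assms strongly_measurable_cong_AE[OF fg] by simp
  ultimately show thesis using fg that by blast
qed

text \<open>A function that is integrable to the power \<open>p\<close> need not be integrable, as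
  the localized estimate demands, so it is first cut off to balls. At each point the averages of a
  window see a bounded cube only and are unaffected by large cut-offs; Fatou's lemma then removes
  the cut-off.\<close>

lemma weak_imp_strong:
  assumes "maximal_weak_type smul \<mu> D" and p: "p > 1"
  shows "maximal_strong_type smul \<mu> D p"
proof -
  obtain C' where C': "\<And>g s. g \<in> Lp_vec \<mu> 1 \<Longrightarrow> s > 0 \<Longrightarrow>
      emeasure \<mu> {x. maximal g x > ennreal s} \<le> ennreal (C' / s) * Lp_norm_vec \<mu> 1 g"
    using assms(1) unfolding maximal_weak_type_def by blast
  \<comment> \<open>The given constant may be nonpositive; enlarging it preserves the inequality and
    makes Doob's inequality applicable.\<close>
  define C where "C = max C' 1"
  have C: "C > 0" by (simp add: C_def)
  have weak: "emeasure \<mu> {x. maximal g x > ennreal s} \<le> ennreal (C / s) * Lp_norm_vec \<mu> 1 g"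
    if "g \<in> Lp_vec \<mu> 1" "s > 0" for g s
  proof -
    have "ennreal (C' / s) \<le> ennreal (C / s)" using that by (intro ennreal_leI divide_right_mono) (auto simp: C_def)
    then show ?thesis using C'[OF that] by (meson mult_right_mono order_trans zero_le)
  qed
  define K where "K = doob_const p C"
  have K: "K > 0" unfolding K_def doob_const_def Let_def using p C by simp
  have "(\<integral>\<^sup>+x. ennreal_powr (maximal f x) p \<partial>\<mu>) \<le> ennreal K * (\<integral>\<^sup>+x. ennreal (norm (f x) powr p) \<partial>\<mu>)"
    if f: "f \<in> Lp_vec \<mu> p" for f
  proof -
    have "strongly_measurable \<mu> f" using f p by (simp add: Lp_vec_iff)
    then obtain g where g: "strongly_measurable \<mu> g" and gm[measurable]: "(\<lambda>x. norm (g x)) \<in> borel_measurable \<mu>"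
      and fg: "AE x in \<mu>. f x = g x" by (rule strongly_measurable_nice)
    define G where "G = (\<integral>\<^sup>+x. ennreal (norm (g x) powr p) \<partial>\<mu>)"
    have fG: "(\<integral>\<^sup>+x. ennreal (norm (f x) powr p) \<partial>\<mu>) = G"
      unfolding G_def by (intro nn_integral_cong_AE) (use fg in \<open>eventually_elim, simp\<close>)
    then have fin: "G < \<infinity>" using f p by (simp add: Lp_vec_iff)
    define h where "h i x = indicator (ball 0 (real i)) x *\<^sub>R g x" for i :: nat and x
    have h: "strongly_measurable \<mu> (h i)" for i
      unfolding h_def by (intro strongly_measurable_scaleR g simple_function_indicator) simp
    have hm: "(\<lambda>x. norm (h i x)) \<in> borel_measurable \<mu>" for i
    proof -
      have "(\<lambda>x. norm (h i x)) = (\<lambda>x. indicator (ball 0 (real i)) x * norm (g x))"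
        by (auto simp: h_def indicator_def fun_eq_iff)
      moreover have "indicat_real (ball 0 (real i)) \<in> borel_measurable \<mu>"
        by (intro borel_measurable_indicator) simp
      ultimately show ?thesis using borel_measurable_times[OF _ gm] by metis
    qed
    have norm_h: "ennreal (norm (h i x)) = ennreal (norm (g x)) * indicator (ball 0 (real i)) x" for i x
      by (simp add: h_def indicator_def)
    have hfin: "(\<integral>\<^sup>+x. norm (h i x) \<partial>\<mu>) < \<infinity>" for i
      unfolding norm_h using p fin emeasure_bounded_finite[of "ball 0 (real i)"]
      by (intro powr_integrable_imp_integrable[of g "ball 0 (real i)" p]) (auto simp: G_def)
    have trunc: "(\<integral>\<^sup>+x. ennreal_powr (truncated b n g x) p \<partial>\<mu>) \<le> ennreal K * G" for b n
    proof -
      have 1: "(\<integral>\<^sup>+x. ennreal_powr (truncated b n (h i) x) p \<partial>\<mu>) \<le> ennreal K * G" for i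
      proof -
        have "(\<integral>\<^sup>+x. ennreal_powr (truncated b n (h i) x) p \<partial>\<mu>) \<le> ennreal K * (\<integral>\<^sup>+x. ennreal (norm (h i x) powr p) \<partial>\<mu>)"
          unfolding K_def by (rule truncated_Lp_le[OF weak h hm hfin C p])
        also have "(\<integral>\<^sup>+x. ennreal (norm (h i x) powr p) \<partial>\<mu>) \<le> G"
          unfolding G_def using p by (intro nn_integral_mono ennreal_leI powr_mono2) (auto simp: h_def indicator_def)
        finally show ?thesis by (simp add: mult_left_mono)
      qed
      have "ennreal_powr (truncated b n g x) p \<le> liminf (\<lambda>i. ennreal_powr (truncated b n (h i) x) p)" for x
      proof (rule Liminf_bounded)
        \<comment> \<open>All cubes of the window around \<open>x\<close> lie in the one of
          generation \<open>b\<close>, so one radius serves for all of them.\<close>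
        obtain r where r: "\<forall>y\<in>cube b x. norm y \<le> r" using bounded_cube[of b x] unfolding bounded_iff by (elim exE)
        obtain m where m: "r < real m" using reals_Archimedean2 by blast
        have "truncated b n g x = truncated b n (h i) x" if "i \<ge> m" for i
        proof -
          have "avg (b + int j) g x = avg (b + int j) (h i) x" for j
          proof (rule avg_cong)
            fix y assume "y \<in> cube (b + int j) x"
            then have "y \<in> cube b x" using cube_antimono[of b "b + int j" x] by auto
            then have "norm y < real i" using r m that by fastforce
            then show "g y = h i y" by (simp add: h_def)
          qed
          then show ?thesis by (simp add: truncated_def)
        qed
        then show "\<forall>\<^sub>F i in sequentially. ennreal_powr (truncated b n g x) p \<le> ennreal_powr (truncated b n (h i) x) p"
          unfolding eventually_sequentially by (intro exI[of _ m]) simp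
      qed
      then have "(\<integral>\<^sup>+x. ennreal_powr (truncated b n g x) p \<partial>\<mu>)
          \<le> (\<integral>\<^sup>+x. liminf (\<lambda>i. ennreal_powr (truncated b n (h i) x) p) \<partial>\<mu>)" by (intro nn_integral_mono)
      also have "\<dots> \<le> liminf (\<lambda>i. \<integral>\<^sup>+x. ennreal_powr (truncated b n (h i) x) p \<partial>\<mu>)"
        by (intro nn_integral_liminf) measurable
      also have "\<dots> \<le> liminf (\<lambda>i. ennreal K * G)" using 1 by (intro Liminf_mono always_eventually) simp
      finally show ?thesis by (simp add: Liminf_const)
    qed
    have "(\<integral>\<^sup>+x. ennreal_powr (maximal f x) p \<partial>\<mu>) = (\<integral>\<^sup>+x. ennreal_powr (maximal g x) p \<partial>\<mu>)"
      using maximal_cong_AE[OF fg] by simp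
    also have "\<dots> \<le> (\<integral>\<^sup>+x. (SUP i. ennreal_powr (truncated (- int i) (2 * i) g x) p) \<partial>\<mu>)"
      unfolding maximal_SUP using p by (intro nn_integral_mono ennreal_powr_SUP_le) simp
    also have "\<dots> = (SUP i. \<integral>\<^sup>+x. ennreal_powr (truncated (- int i) (2 * i) g x) p \<partial>\<mu>)"
      using p incseqD[OF incseq_truncated[of g]]
      by (intro nn_integral_monotone_convergence_SUP) (auto simp: incseq_def le_fun_def intro!: ennreal_powr_mono)
    also have "\<dots> \<le> ennreal K * G" by (intro SUP_least trunc)
    finally show ?thesis unfolding fG .
  qed
  moreover have "(K powr (1 / p)) powr p = K" using K p by (simp add: powr_powr)
  ultimately have "\<forall>f\<in>Lp_vec \<mu> p. Lp_norm \<mu> p (maximal f) \<le> ennreal (K powr (1 / p)) * Lp_norm_vec \<mu> p f"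
    using p K by (subst Lp_norm_le_iff) auto
  then show ?thesis unfolding maximal_strong_type_def by blast
qed

end

section \<open>From strong type to weak type\<close>

text \<open>One function, one starting generation and one height are fixed. The resulting estimates
  are uniform in \<open>b\<close>, which is sent to minus infinity only at the end.\<close>

locale dyadic_stopping = rademacher_dyadic smul \<mu> D
  for smul :: "'k::{real_normed_field, euclidean_space} \<Rightarrow> 'a::banach \<Rightarrow> 'a"
    and \<mu> :: "(real ^ 'n) measure" and D :: "int \<Rightarrow> (real ^ 'n) set set" +
  fixes f :: "real ^ 'n \<Rightarrow> 'a" and b :: int and t :: real
  assumes f_loc: "loc_integrable f" and f_borel [measurable]: "(\<lambda>x. norm (f x)) \<in> borel_measurable \<mu>"
    and t_pos: "t > 0"
begin

definition "mart j = avg (b + int j) f"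

definition "nmart j = nn_avg (b + int j) (\<lambda>y. ennreal (norm (f y)))"

definition "heavy j x \<longleftrightarrow> ennreal t < nmart j x"

text \<open>Taken at the first heavy time without reference to \<open>good\<close>: the compensator
  is built from the jumps and \<open>good\<close> from the compensator, so such a reference would be
  circular. By \<open>norm_overshoot_le\<close> the jumps dominate the actual overshoots.\<close>

definition jump :: "nat \<Rightarrow> real ^ 'n \<Rightarrow> ennreal" where
  "jump j x = (if first_time heavy j x then ennreal (norm (mart j x)) else 0)"

text \<open>The term for \<open>j\<close> averages the jump at \<open>j + 1\<close> over cubes of
  generation \<open>b + j\<close>. Hence \<open>compensator k\<close> is constant on cubes of
  generation \<open>b + k\<close> and announces a jump before it happens. The sum begins with
  \<open>jump 1\<close>, since a jump at time 0 has no earlier generation in the window to be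
  averaged over.\<close>

definition "compensator k x = (\<Sum>j\<le>k. nn_avg (b + int j) (jump (Suc j)) x)"

primrec good :: "nat \<Rightarrow> real ^ 'n \<Rightarrow> bool" where
  "good 0 x \<longleftrightarrow> \<not> heavy 0 x \<and> compensator 0 x \<le> ennreal t"
| "good (Suc k) x \<longleftrightarrow> good k x \<and> \<not> heavy (Suc k) x \<and> compensator (Suc k) x \<le> ennreal t"

definition "overshoot j x = (if good j x \<and> heavy (Suc j) x then mart (Suc j) x else 0)"

definition "drift j = avg (b + int j) (overshoot j)"

text \<open>At a heavy time the value becomes 0 and stays so. If only the compensator is too large,
  the current average is frozen; being light, it is bounded by \<open>t\<close>.\<close>

primrec stopped :: "nat \<Rightarrow> real ^ 'n \<Rightarrow> 'a" where
  "stopped 0 x = (if heavy 0 x then 0 else mart 0 x)"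
| "stopped (Suc k) x = (if good k x then (if heavy (Suc k) x then 0 else mart (Suc k) x) else stopped k x)"

text \<open>The martingale \<open>S\<close>: at a big average \<open>stopped\<close> jumps to \<open>0\<close>, and the drift makes up for the missing
  overshoot.\<close>

definition "tamed k x = stopped k x + (\<Sum>j<k. drift j x)"

section \<open>Constancy of the stopping construction on cubes\<close>

lemma level_mart: "level (b + int j) (mart j)"
  unfolding mart_def by (rule level_avg)

lemma level_nmart: "level (b + int j) (nmart j)"
  unfolding nmart_def by (rule level_avg)

lemma level_heavy: "level (b + int j) (heavy j)"
  unfolding heavy_def by (rule level_compose[OF level_nmart])

lemma level_first_heavy: "level (b + int j) (first_time heavy j)"
  by (rule level_first_time[OF level_heavy])

lemma level_jump: "level (b + int j) (jump j)"
  using level_compose2[OF level_first_heavy level_mart, of _ "\<lambda>P v. if P then ennreal (norm v) else 0"]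
  by (simp add: jump_def[abs_def])

lemma level_Suc: "level (b + int k) g \<Longrightarrow> level (b + int (Suc k)) g"
  by (rule level_mono) auto

lemma level_compensator: "level (b + int k) (compensator k)"
proof (induction k)
  case 0
  show ?case using level_avg(2)[of "b + int 0"] by (simp add: compensator_def[abs_def])
next
  case (Suc k)
  show ?case
    using level_compose2[OF level_Suc[OF Suc] level_avg(2), of "(+)"] by (simp add: compensator_def[abs_def])
qed

lemma level_good: "level (b + int k) (good k)"
proof (induction k)
  case 0
  show ?case
    using level_compose2[OF level_heavy level_compensator, of 0 "\<lambda>P c. \<not> P \<and> c \<le> ennreal t"]
    by simp
next
  case (Suc k)
  show ?case
    using level_compose2[OF level_Suc[OF Suc] level_compose2[OF level_heavy[of "Suc k"] level_compensator,
        of "\<lambda>P c. \<not> P \<and> c \<le> ennreal t"], of "(\<and>)"] by simp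
qed

lemma level_overshoot: "level (b + int (Suc j)) (overshoot j)"
  using level_compose2[OF level_Suc[OF level_good[of j]]
      level_compose2[OF level_heavy[of "Suc j"] level_mart, of "\<lambda>P v. if P then v else 0"],
      of "\<lambda>P v. if P then v else 0"]
  by (rule arg_cong[where f="level _", THEN iffD1, rotated]) (auto simp: overshoot_def fun_eq_iff)

lemma level_drift: "level (b + int j) (drift j)"
  unfolding drift_def by (rule level_avg)

lemma level_drift_sum: "level (b + int k) (\<lambda>x. \<Sum>j<k. drift j x)"
proof (induction k)
  case (Suc k)
  show ?case using level_Suc[OF level_compose2[OF Suc level_drift, of "(+)"]] by simp
qed (simp add: level_def)

lemma level_stopped: "level (b + int k) (stopped k)"
proof (induction k)
  case 0
  show ?case
    using level_compose2[OF level_heavy level_mart, of 0 "\<lambda>P v. if P then 0 else v"] by simp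
next
  case (Suc k)
  have "level (b + int (Suc k)) (\<lambda>x. (good k x, stopped k x))"
    by (rule level_compose2[OF level_Suc[OF level_good] level_Suc[OF Suc]])
  from level_compose2[OF this level_compose2[OF level_heavy[of "Suc k"] level_mart, of "\<lambda>P v. if P then 0 else v"],
      of "\<lambda>(G, s) v. if G then v else s"]
  show ?case by simp
qed

lemma level_tamed: "level (b + int k) (tamed k)"
  using level_compose2[OF level_stopped level_drift_sum, of _ "(+)"] by (simp add: tamed_def[abs_def])

section \<open>Pointwise bounds and the martingale property\<close>

lemma good_antimono: "j \<le> k \<Longrightarrow> good k x \<Longrightarrow> good j x"
  by (induction k rule: dec_induct) auto

lemma good_not_heavy: "good k x \<Longrightarrow> \<not> heavy k x"
  by (cases k) auto

lemma good_compensator: "good k x \<Longrightarrow> compensator k x \<le> ennreal t"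
  by (cases k) auto

lemma good_heavy_first: "good j x \<Longrightarrow> heavy (Suc j) x \<Longrightarrow> first_time heavy (Suc j) x"
  unfolding first_time_def using good_antimono[of _ j x] good_not_heavy by (auto simp: less_Suc_eq_le)

text \<open>The compensator increases with time, so an earlier excess over \<open>t\<close> persists
  until \<open>k\<close>.\<close>

lemma not_good_cases:
  assumes "\<not> good k x" shows "(\<exists>j\<le>k. heavy j x) \<or> ennreal t < compensator k x"
  using assms
proof (induction k)
  case (Suc k)
  have "compensator k x \<le> compensator (Suc k) x" by (simp add: compensator_def)
  with Suc show ?case by (auto simp: not_le intro: le_SucI less_le_trans)
qed auto

lemma norm_mart_le: "ennreal (norm (mart j x)) \<le> nmart j x"
  unfolding mart_def nmart_def by (rule norm_avg_le[OF f_loc])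

lemma norm_overshoot_le: "ennreal (norm (overshoot j x)) \<le> jump (Suc j) x"
  using good_heavy_first by (auto simp: overshoot_def jump_def)

lemma norm_drift_le: "ennreal (norm (drift j x)) \<le> nn_avg (b + int j) (jump (Suc j)) x"
proof -
  have "ennreal (norm (drift j x)) \<le> nn_avg (b + int j) (\<lambda>y. ennreal (norm (overshoot j y))) x"
    unfolding drift_def by (rule norm_avg_le[OF level_loc_integrable[OF level_overshoot]])
  also have "\<dots> \<le> nn_avg (b + int j) (jump (Suc j)) x"
    unfolding nn_avg_def
    by (intro divide_right_mono_ennreal nn_integral_mono mult_right_mono norm_overshoot_le) simp
  finally show ?thesis .
qed

text \<open>Goodness at \<open>j\<close> is constant on the cube that is averaged over, so all
  overshoots in it vanish together.\<close>

lemma drift_eq_0: "\<not> good j x \<Longrightarrow> drift j x = 0"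
proof -
  assume ng: "\<not> good j x"
  have "overshoot j y = 0" if "y \<in> cube (b + int j) x" for y
    using levelD[OF level_good that] ng by (simp add: overshoot_def)
  then show ?thesis
    unfolding drift_def
    by (cases "measure \<mu> (cube (b + int j) x) = 0") (simp_all add: avg_null avg_const)
qed

text \<open>Through the last good time the sum is below the compensator, which includes the term of
  that time and is at most \<open>t\<close>; all later drifts vanish. The bound thus holds at every
  point, good or not.\<close>

lemma sum_norm_drift_le: "(\<Sum>j<k. ennreal (norm (drift j x))) \<le> ennreal t"
proof (induction k)
  case (Suc k)
  show ?case
  proof (cases "good k x")
    case True
    have "(\<Sum>j<Suc k. ennreal (norm (drift j x))) \<le> (\<Sum>j<Suc k. nn_avg (b + int j) (jump (Suc j)) x)"
      by (intro sum_mono norm_drift_le)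
    also have "\<dots> = compensator k x" by (simp add: compensator_def lessThan_Suc_atMost)
    also have "\<dots> \<le> ennreal t" using True by (rule good_compensator)
    finally show ?thesis .
  next
    case False
    then show ?thesis using Suc by (simp add: drift_eq_0)
  qed
qed simp

lemma norm_sum_drift_le: "norm (\<Sum>j<k. drift j x) \<le> t"
proof -
  have "ennreal (norm (\<Sum>j<k. drift j x)) \<le> ennreal (\<Sum>j<k. norm (drift j x))"
    by (intro ennreal_leI norm_sum)
  also have "\<dots> \<le> ennreal t" using sum_norm_drift_le[where k=k and x=x] by simp
  finally show ?thesis using t_pos by (simp add: ennreal_le_iff)
qed

lemma norm_mart_le_light: "\<not> heavy j x \<Longrightarrow> norm (mart j x) \<le> t"
proof -
  assume "\<not> heavy j x"
  then have "ennreal (norm (mart j x)) \<le> ennreal t"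
    using norm_mart_le[of j x] unfolding heavy_def by (simp add: not_less)
  then show ?thesis using t_pos by (simp add: ennreal_le_iff)
qed

lemma norm_stopped_le: "norm (stopped k x) \<le> t"
  using t_pos by (induction k) (auto simp: norm_mart_le_light)

lemma stopped_good: "good k x \<Longrightarrow> stopped k x = mart k x"
  by (cases k) auto

lemma norm_tamed_le: "norm (tamed k x) \<le> 2 * t"
  unfolding tamed_def using norm_triangle_ineq[of "stopped k x" "\<Sum>j<k. drift j x"]
    norm_stopped_le[of k x] norm_sum_drift_le[where k=k and x=x] by linarith

text \<open>The martingale property. Null cubes are excluded: the average is 0 there, while
  \<open>tamed\<close> may retain the drift of coarser generations.\<close>

lemma avg_tamed_Suc:
  assumes nz: "measure \<mu> (cube (b + int k) x) \<noteq> 0"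
  shows "avg (b + int k) (tamed (Suc k)) x = tamed k x"
proof -
  let ?Q = "cube (b + int k) x" and ?c = "(\<Sum>j<k. drift j x) + drift k x"
  have drift: "(\<Sum>j<Suc k. drift j y) = ?c" if "y \<in> ?Q" for y
    using levelD[OF level_drift_sum that] levelD[OF level_drift that] by simp
  show ?thesis
  proof (cases "good k x")
    case False
    have "tamed (Suc k) y = tamed k x" if "y \<in> ?Q" for y
      using levelD[OF level_good that] levelD[OF level_stopped that] drift[OF that] False
      by (simp add: tamed_def drift_eq_0)
    then show ?thesis using nz by (rule avg_const)
  next
    case True
    \<comment> \<open>Adding the overshoot back restores the true average. When averaged it becomes
      \<open>drift k x\<close> and cancels the new term of the drift sum, which is the reason for
      the definition of \<open>drift\<close>.\<close>
    have "tamed (Suc k) y + overshoot k y = mart (Suc k) y + ?c" if "y \<in> ?Q" for y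
      using levelD[OF level_good that] drift[OF that] True
      by (auto simp: tamed_def overshoot_def)
    then have "avg (b + int k) (\<lambda>y. tamed (Suc k) y + overshoot k y) x = avg (b + int k) (\<lambda>y. mart (Suc k) y + ?c) x"
      by (rule avg_cong)
    moreover have "avg (b + int k) (\<lambda>y. tamed (Suc k) y + overshoot k y) x
        = avg (b + int k) (tamed (Suc k)) x + drift k x"
      unfolding drift_def
      by (intro avg_add level_loc_integrable[OF level_tamed] level_loc_integrable[OF level_overshoot])
    moreover have "avg (b + int k) (\<lambda>y. mart (Suc k) y + ?c) x = avg (b + int k) (mart (Suc k)) x + avg (b + int k) (\<lambda>_. ?c) x"
      by (intro avg_add level_loc_integrable[OF level_mart] level_loc_integrable[of 0]) (simp add: level_def)
    moreover have "avg (b + int k) (\<lambda>_. ?c) x = ?c" by (rule avg_const[OF refl nz])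
    moreover have "avg (b + int k) (mart (Suc k)) x = mart k x"
      using avg_tower[OF f_loc, of "b + int k" x] by (simp add: mart_def ac_simps)
    ultimately show ?thesis using stopped_good[OF True] by (simp add: tamed_def)
  qed
qed

text \<open>Closes the martingale: every \<open>tamed k\<close> is an average of the single function
  \<open>tamed n\<close>, to which the maximal operator can be applied.\<close>

lemma avg_tamed:
  assumes "k \<le> n"
  shows "measure \<mu> (cube (b + int k) x) \<noteq> 0 \<Longrightarrow> avg (b + int k) (tamed n) x = tamed k x"
  using assms
proof (induction k arbitrary: x rule: inc_induct)
  case base
  then show ?case by (intro avg_const levelD[OF level_tamed])
next
  case (step k)
  have "avg (b + int k) (tamed n) x = avg (b + int k) (tamed (Suc k)) x"
  proof (rule avg_cong_next)
    fix y assume nz: "measure \<mu> (cube (b + int k + 1) y) \<noteq> 0"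
    have eq: "b + int k + 1 = b + int (Suc k)" by simp
    have "avg (b + int (Suc k)) (tamed n) y = tamed (Suc k) y" using step.IH[of y] nz unfolding eq by simp
    moreover have "avg (b + int (Suc k)) (tamed (Suc k)) y = tamed (Suc k) y"
      using nz unfolding eq by (intro avg_const levelD[OF level_tamed])
    ultimately show "avg (b + int k + 1) (tamed n) y = avg (b + int k + 1) (tamed (Suc k)) y" unfolding eq by simp
  qed (intro level_loc_integrable[OF level_tamed])+
  then show ?case using avg_tamed_Suc step.prems by simp
qed

lemma truncated_le_tamed:
  assumes g: "good n x" and nz: "\<forall>k. measure \<mu> (cube k x) \<noteq> 0"
  shows "truncated b n f x \<le> maximal (tamed n) x + ennreal t"
proof -
  have "truncated b n f x \<le> truncated b n (tamed n) x + R {\<Sum>j<k. - drift j x |k. k \<le> n}"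
    unfolding truncated_def
  proof (rule R_bound_sum_le)
    fix z assume "z \<in> {avg (b + int j) f x |j. j \<le> n}"
    then obtain k where k: "z = mart k x" "k \<le> n" by (auto simp: mart_def)
    have "z = avg (b + int k) (tamed n) x + (\<Sum>j<k. - drift j x)"
      using avg_tamed[OF k(2)] nz stopped_good[OF good_antimono[OF k(2) g]] k(1)
      by (simp add: tamed_def sum_negf)
    then show "\<exists>a\<in>insert 0 {avg (b + int j) (tamed n) x |j. j \<le> n}.
        \<exists>d\<in>insert 0 {\<Sum>j<k. - drift j x |k. k \<le> n}. z = a + d"
      using k(2) by blast
  qed
  also have "\<dots> \<le> maximal (tamed n) x + (\<Sum>j<n. ennreal (norm (- drift j x)))"
    by (intro add_mono truncated_le_maximal R_bound_partial_sums)
  also have "\<dots> \<le> maximal (tamed n) x + ennreal t"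
    using sum_norm_drift_le[where k=n and x=x] by (intro add_left_mono) simp
  finally show ?thesis .
qed

section \<open>Integral estimates for the stopping construction\<close>

abbreviation "L1_norm \<equiv> (\<integral>\<^sup>+x. ennreal (norm (f x)) \<partial>\<mu>)"

lemma measurable_levels [measurable]:
  "nmart j \<in> borel_measurable \<mu>" "jump j \<in> borel_measurable \<mu>" "compensator j \<in> borel_measurable \<mu>"
  "nn_avg k u \<in> borel_measurable \<mu>"
  by (rule level_measurable[OF level_nmart] level_measurable[OF level_jump]
      level_measurable[OF level_compensator] level_measurable[OF level_avg(2)])+

lemma sets_levels [measurable]:
  "{x. good j x} \<in> sets \<mu>" "{x. heavy j x} \<in> sets \<mu>" "{x. first_time heavy j x} \<in> sets \<mu>"
  by (rule level_sets[OF level_good] level_sets[OF level_heavy] level_sets[OF level_first_heavy])+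

text \<open>A first heavy time depends on the past only, so the average may be replaced by the norm
  of \<open>f\<close> under the integral, and the sets are disjoint. Both the measure of the heavy
  points and the integral of the compensator reduce to this sum.\<close>

lemma sum_first_heavy_le:
  "(\<Sum>j\<le>n. \<integral>\<^sup>+x. nmart j x * indicator {x. first_time heavy j x} x \<partial>\<mu>) \<le> L1_norm"
proof -
  have "(\<Sum>j\<le>n. \<integral>\<^sup>+x. nmart j x * indicator {x. first_time heavy j x} x \<partial>\<mu>)
      = (\<Sum>j\<le>n. \<integral>\<^sup>+x. ennreal (norm (f x)) * indicator {x. first_time heavy j x} x \<partial>\<mu>)"
    unfolding nmart_def by (intro sum.cong refl nn_avg_integral level_first_heavy) measurable
  also have "\<dots> = (\<integral>\<^sup>+x. (\<Sum>j\<le>n. ennreal (norm (f x)) * indicator {x. first_time heavy j x} x) \<partial>\<mu>)"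
    by (rule nn_integral_sum[symmetric]) measurable
  also have "\<dots> = (\<integral>\<^sup>+x. ennreal (norm (f x)) * indicator {x. \<exists>j\<le>n. heavy j x} x \<partial>\<mu>)"
    by (simp only: sum_first_time sum_distrib_left[symmetric])
  also have "\<dots> \<le> L1_norm" by (intro nn_integral_mono) (simp add: indicator_def)
  finally show ?thesis .
qed

lemma sets_some_heavy: "{x. \<exists>j\<le>n. heavy j x} \<in> sets \<mu>"
proof -
  have "(\<Union>j\<in>{..n}. {x. heavy j x}) \<in> sets \<mu>" by (intro sets.finite_UN sets_levels) simp
  also have "(\<Union>j\<in>{..n}. {x. heavy j x}) = {x. \<exists>j\<le>n. heavy j x}" by auto
  finally show ?thesis .
qed

text \<open>Doob's weak type inequality for the averages of the norm, with constant 1.\<close>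

lemma emeasure_heavy_le: "ennreal t * emeasure \<mu> {x. \<exists>j\<le>n. heavy j x} \<le> L1_norm"
proof -
  have "ennreal t * emeasure \<mu> {x. \<exists>j\<le>n. heavy j x} = (\<integral>\<^sup>+x. ennreal t * indicator {x. \<exists>j\<le>n. heavy j x} x \<partial>\<mu>)"
    by (rule nn_integral_cmult_indicator[symmetric, OF sets_some_heavy])
  also have "\<dots> = (\<integral>\<^sup>+x. (\<Sum>j\<le>n. ennreal t * indicator {x. first_time heavy j x} x) \<partial>\<mu>)"
    by (simp only: sum_first_time sum_distrib_left[symmetric])
  also have "\<dots> \<le> (\<integral>\<^sup>+x. (\<Sum>j\<le>n. nmart j x * indicator {x. first_time heavy j x} x) \<partial>\<mu>)"
    by (intro nn_integral_mono sum_mono) (auto simp: first_time_def heavy_def indicator_def less_imp_le)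
  also have "\<dots> = (\<Sum>j\<le>n. \<integral>\<^sup>+x. nmart j x * indicator {x. first_time heavy j x} x \<partial>\<mu>)"
    by (rule nn_integral_sum) measurable
  also have "\<dots> \<le> L1_norm" by (rule sum_first_heavy_le)
  finally show ?thesis .
qed

text \<open>Averaging preserves integrals, and jumps of different times live on disjoint
  sets.\<close>

lemma integral_compensator_le: "(\<integral>\<^sup>+x. compensator n x \<partial>\<mu>) \<le> L1_norm"
proof -
  have "(\<integral>\<^sup>+x. compensator n x \<partial>\<mu>) = (\<Sum>j\<le>n. \<integral>\<^sup>+x. nn_avg (b + int j) (jump (Suc j)) x \<partial>\<mu>)"
    unfolding compensator_def by (rule nn_integral_sum) measurable
  also have "\<dots> = (\<Sum>j\<le>n. \<integral>\<^sup>+x. jump (Suc j) x \<partial>\<mu>)"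
    using nn_avg_integral[of "jump (Suc j)" "b + int j" "\<lambda>_. True" for j]
    by (intro sum.cong refl) (simp add: level_def)
  also have "\<dots> \<le> (\<Sum>j\<le>n. \<integral>\<^sup>+x. nmart (Suc j) x * indicator {x. first_time heavy (Suc j) x} x \<partial>\<mu>)"
    using norm_mart_le by (intro sum_mono nn_integral_mono) (simp add: jump_def)
  \<comment> \<open>Shifting the index adds the nonnegative term of time 0.\<close>
  also have "\<dots> \<le> (\<Sum>j\<le>Suc n. \<integral>\<^sup>+x. nmart j x * indicator {x. first_time heavy j x} x \<partial>\<mu>)"
    by (subst sum.atMost_Suc_shift) simp
  also have "\<dots> \<le> L1_norm" by (rule sum_first_heavy_le)
  finally show ?thesis .
qed

text \<open>One copy of the norm comes from the heavy points, the other from Chebyshev's inequality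
  for the compensator.\<close>

lemma emeasure_not_good_le: "ennreal t * emeasure \<mu> {x. \<not> good n x} \<le> 2 * L1_norm"
proof -
  note m1 = sets_some_heavy[of n]
  have "{x\<in>space \<mu>. ennreal t < compensator n x} \<in> sets \<mu>" by measurable
  then have m2: "{x. ennreal t < compensator n x} \<in> sets \<mu>" by simp
  have "ennreal t * emeasure \<mu> {x. ennreal t < compensator n x}
      = (\<integral>\<^sup>+x. ennreal t * indicator {x. ennreal t < compensator n x} x \<partial>\<mu>)"
    by (rule nn_integral_cmult_indicator[symmetric, OF m2])
  also have "\<dots> \<le> (\<integral>\<^sup>+x. compensator n x \<partial>\<mu>)"
    by (intro nn_integral_mono) (auto simp: indicator_def less_imp_le)
  also have "\<dots> \<le> L1_norm" by (rule integral_compensator_le)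
  finally have c: "ennreal t * emeasure \<mu> {x. ennreal t < compensator n x} \<le> L1_norm" .
  have "emeasure \<mu> {x. \<not> good n x} \<le> emeasure \<mu> ({x. \<exists>j\<le>n. heavy j x} \<union> {x. ennreal t < compensator n x})"
    by (intro emeasure_mono sets.Un m1 m2) (auto dest: not_good_cases)
  also have "\<dots> \<le> emeasure \<mu> {x. \<exists>j\<le>n. heavy j x} + emeasure \<mu> {x. ennreal t < compensator n x}"
    by (rule emeasure_subadditive[OF m1 m2])
  finally have "ennreal t * emeasure \<mu> {x. \<not> good n x} \<le>
      ennreal t * emeasure \<mu> {x. \<exists>j\<le>n. heavy j x} + ennreal t * emeasure \<mu> {x. ennreal t < compensator n x}"
    by (simp add: mult_left_mono flip: distrib_left)
  also have "\<dots> \<le> L1_norm + L1_norm" by (intro add_mono emeasure_heavy_le c)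
  finally show ?thesis by (simp add: mult_2)
qed

text \<open>The 4 is 1 + 2 + 1: the averages of the norm on the good set, the value \<open>t\<close>
  on the rest, and the compensator as a bound for the drifts.\<close>

lemma integral_tamed_le: "(\<integral>\<^sup>+x. ennreal (norm (tamed n x)) \<partial>\<mu>) \<le> 4 * L1_norm"
proof -
  have m: "{x. \<not> good n x} \<in> sets \<mu>"
    using sets.compl_sets[OF sets_levels(1)[of n]] by (simp add: Compl_eq_Diff_UNIV[symmetric] Collect_neg_eq)
  have "ennreal (norm (tamed n x)) \<le> (nmart n x + ennreal t * indicator {x. \<not> good n x} x) + compensator n x" for x
  proof -
    have "ennreal (norm (tamed n x)) \<le> ennreal (norm (stopped n x) + (\<Sum>j<n. norm (drift j x)))"
      unfolding tamed_def by (intro ennreal_leI order_trans[OF norm_triangle_ineq] add_left_mono norm_sum)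
    also have "\<dots> = ennreal (norm (stopped n x)) + (\<Sum>j<n. ennreal (norm (drift j x)))"
      by (simp add: sum_nonneg)
    also have "\<dots> \<le> (nmart n x + ennreal t * indicator {x. \<not> good n x} x) + compensator n x"
    proof (rule add_mono)
      show "ennreal (norm (stopped n x)) \<le> nmart n x + ennreal t * indicator {x. \<not> good n x} x"
      proof (cases "good n x")
        case True
        then show ?thesis using norm_mart_le by (simp add: stopped_good)
      next
        case False
        then show ?thesis using norm_stopped_le[of n x] by (simp add: add_increasing ennreal_leI)
      qed
      have "(\<Sum>j<n. ennreal (norm (drift j x))) \<le> (\<Sum>j<n. nn_avg (b + int j) (jump (Suc j)) x)"
        by (intro sum_mono norm_drift_le)
      also have "\<dots> \<le> compensator n x"
        unfolding compensator_def by (intro sum_mono2) auto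
      finally show "(\<Sum>j<n. ennreal (norm (drift j x))) \<le> compensator n x" .
    qed
    finally show ?thesis .
  qed
  then have "(\<integral>\<^sup>+x. ennreal (norm (tamed n x)) \<partial>\<mu>)
      \<le> (\<integral>\<^sup>+x. (nmart n x + ennreal t * indicator {x. \<not> good n x} x) + compensator n x \<partial>\<mu>)"
    by (intro nn_integral_mono)
  also have "\<dots> = (\<integral>\<^sup>+x. nmart n x \<partial>\<mu>) + ennreal t * emeasure \<mu> {x. \<not> good n x} + (\<integral>\<^sup>+x. compensator n x \<partial>\<mu>)"
    using m by (subst nn_integral_add, measurable, subst nn_integral_add)
      (auto intro!: borel_measurable_times_ennreal measurable_levels simp: nn_integral_cmult_indicator)
  also have "(\<integral>\<^sup>+x. nmart n x \<partial>\<mu>) = L1_norm"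
    using nn_avg_integral[of "\<lambda>y. ennreal (norm (f y))" "b + int n" "\<lambda>_. True"]
    by (simp add: nmart_def level_def)
  also have "L1_norm + ennreal t * emeasure \<mu> {x. \<not> good n x} + (\<integral>\<^sup>+x. compensator n x \<partial>\<mu>) \<le> L1_norm + 2 * L1_norm + L1_norm"
    by (intro add_mono emeasure_not_good_le integral_compensator_le order_refl)
  also have "\<dots> = (1 + 2 + 1) * L1_norm" by (simp only: distrib_right mult_1)
  finally show ?thesis by simp
qed

end

text \<open>The summand 2 of the constant accounts for the points that are not good. At the good
  ones the height \<open>2 * t\<close> splits into \<open>t\<close> for the drift and
  \<open>t\<close> for the maximal function of \<open>tamed n\<close>, which the strong type and
  Chebyshev's inequality control.\<close>

lemma (in dyadic_stopping) emeasure_truncated_le: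
  assumes strong: "\<And>g. g \<in> Lp_vec \<mu> p \<Longrightarrow>
      (\<integral>\<^sup>+x. ennreal_powr (maximal g x) p \<partial>\<mu>) \<le> ennreal K * (\<integral>\<^sup>+x. ennreal (norm (g x) powr p) \<partial>\<mu>)"
    and K: "K > 0" and p: "p > 1" and fin: "L1_norm < \<infinity>"
  shows "emeasure \<mu> {x. ennreal (2 * t) < truncated b n f x} \<le> ennreal ((2 + K * 2 powr (p - 1) * 4) / t) * L1_norm"
proof -
  let ?g = "tamed n" and ?c = "(2 * t) powr (p - 1)"
  have gm: "(\<lambda>x. norm (?g x)) \<in> borel_measurable \<mu>"
    by (rule level_measurable[OF level_compose[OF level_tamed]])
  \<comment> \<open>Boundedness by \<open>2 * t\<close> trades the surplus \<open>p - 1\<close> of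
    the exponent for a power of \<open>2 * t\<close>, leaving the integral of the norm. This is the
    origin of \<open>2 powr (p - 1) * 4\<close>.\<close>
  have le: "norm (?g x) powr p \<le> ?c * norm (?g x)" for x
  proof -
    have "norm (?g x) powr p = norm (?g x) powr (p - 1) * norm (?g x)"
      by (cases "?g x = 0") (simp_all add: powr_diff)
    also have "\<dots> \<le> ?c * norm (?g x)"
      using norm_tamed_le[of n x] p by (intro mult_right_mono powr_mono2) auto
    finally show ?thesis .
  qed
  have "(\<integral>\<^sup>+x. ennreal (norm (?g x) powr p) \<partial>\<mu>) \<le> (\<integral>\<^sup>+x. ennreal ?c * ennreal (norm (?g x)) \<partial>\<mu>)"
    using le by (intro nn_integral_mono) (simp add: ennreal_leI flip: ennreal_mult)
  also have "\<dots> = ennreal ?c * (\<integral>\<^sup>+x. ennreal (norm (?g x)) \<partial>\<mu>)"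
    using gm by (intro nn_integral_cmult) simp
  also have "\<dots> \<le> ennreal ?c * (4 * L1_norm)" by (intro mult_left_mono integral_tamed_le) simp
  finally have gp: "(\<integral>\<^sup>+x. ennreal (norm (?g x) powr p) \<partial>\<mu>) \<le> ennreal ?c * (4 * L1_norm)" .
  also have "\<dots> < \<infinity>" using fin by (simp add: ennreal_mult_less_top)
  finally have "?g \<in> Lp_vec \<mu> p"
    using p level_strongly_measurable[OF level_tamed] by (simp add: Lp_vec_iff)
  note Mg = order_trans[OF strong[OF this] mult_left_mono[OF gp]]
  let ?E = "{x. ennreal t < maximal ?g x}"
  have E: "?E \<in> sets \<mu>"
  proof -
    have "{x\<in>space \<mu>. ennreal t < maximal ?g x} \<in> sets \<mu>" by measurable
    then show ?thesis by simp
  qed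
  have "ennreal (t powr p) * emeasure \<mu> ?E = (\<integral>\<^sup>+x. ennreal (t powr p) * indicator ?E x \<partial>\<mu>)"
    by (rule nn_integral_cmult_indicator[symmetric, OF E])
  also have "\<dots> \<le> (\<integral>\<^sup>+x. ennreal_powr (maximal ?g x) p \<partial>\<mu>)"
  proof (rule nn_integral_mono)
    fix x
    show "ennreal (t powr p) * indicator ?E x \<le> ennreal_powr (maximal ?g x) p"
      using ennreal_powr_mono[of p "ennreal t" "maximal ?g x"] t_pos p
      by (auto simp: indicator_def ennreal_powr_ennreal less_imp_le)
  qed
  also have "\<dots> \<le> ennreal K * (ennreal ?c * (4 * L1_norm))" using Mg by simp
  finally have 1: "ennreal (t powr p) * emeasure \<mu> ?E \<le> ennreal K * (ennreal ?c * (4 * L1_norm))" .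
  let ?d = "t powr (p - 1)"
  \<comment> \<open>Both sides carry \<open>t powr (p - 1)\<close>; cancelling it leaves an estimate
    linear in \<open>t\<close>.\<close>
  have "t powr p = ?d * t" using t_pos by (simp add: powr_diff)
  then have l: "ennreal (t powr p) * emeasure \<mu> ?E = ennreal ?d * (ennreal t * emeasure \<mu> ?E)"
    using t_pos by (simp add: ennreal_mult mult.assoc)
  have "?c = ?d * 2 powr (p - 1)" using t_pos by (simp add: powr_mult mult.commute)
  then have "ennreal K * (ennreal ?c * (4 * L1_norm)) = ennreal ?d * (ennreal (K * 2 powr (p - 1) * 4) * L1_norm)"
    using K by (simp add: ennreal_mult ac_simps)
  with 1 l have "ennreal ?d * (ennreal t * emeasure \<mu> ?E) \<le> ennreal ?d * (ennreal (K * 2 powr (p - 1) * 4) * L1_norm)"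
    by simp
  then have Ele: "ennreal t * emeasure \<mu> ?E \<le> ennreal (K * 2 powr (p - 1) * 4) * L1_norm"
    using t_pos by (subst (asm) ennreal_mult_le_mult_iff) auto
  have ng: "{x. \<not> good n x} \<in> sets \<mu>"
    using sets.compl_sets[OF sets_levels(1)[of n]] by (simp add: Compl_eq_Diff_UNIV[symmetric] Collect_neg_eq)
  have "emeasure \<mu> {x. ennreal (2 * t) < truncated b n f x} \<le> emeasure \<mu> ({x. \<not> good n x} \<union> ?E)"
  \<comment> \<open>The inclusion holds almost everywhere only, because the averages of
    \<open>tamed n\<close> are known on cubes of positive measure.\<close>
  proof (rule emeasure_mono_AE)
    show "AE x in \<mu>. x \<in> {x. ennreal (2 * t) < truncated b n f x} \<longrightarrow> x \<in> {x. \<not> good n x} \<union> ?E"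
      using AE_cube_pos
    proof eventually_elim
      case (elim x)
      show ?case
      proof (intro impI, rule ccontr)
        assume big: "x \<in> {x. ennreal (2 * t) < truncated b n f x}" and no: "x \<notin> {x. \<not> good n x} \<union> ?E"
        then have "truncated b n f x \<le> maximal ?g x + ennreal t" using elim by (intro truncated_le_tamed) auto
        also have "\<dots> \<le> ennreal t + ennreal t" using no by (intro add_right_mono) (simp add: not_less)
        also have "\<dots> = ennreal (2 * t)" using t_pos by (simp flip: ennreal_plus)
        finally show False using big by simp
      qed
    qed
  qed (intro sets.Un ng E)
  also have "\<dots> \<le> emeasure \<mu> {x. \<not> good n x} + emeasure \<mu> ?E" by (rule emeasure_subadditive[OF ng E])
  finally have "ennreal t * emeasure \<mu> {x. ennreal (2 * t) < truncated b n f x}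
      \<le> ennreal t * emeasure \<mu> {x. \<not> good n x} + ennreal t * emeasure \<mu> ?E"
    by (simp add: mult_left_mono flip: distrib_left)
  also have "\<dots> \<le> 2 * L1_norm + ennreal (K * 2 powr (p - 1) * 4) * L1_norm"
    by (intro add_mono emeasure_not_good_le Ele)
  also have "\<dots> = ennreal (2 + K * 2 powr (p - 1) * 4) * L1_norm"
    using K by (simp add: distrib_right)
  also have "\<dots> = ennreal t * (ennreal ((2 + K * 2 powr (p - 1) * 4) / t) * L1_norm)"
    using t_pos K by (simp flip: ennreal_mult mult.assoc)
  finally show ?thesis using t_pos by (subst (asm) ennreal_mult_le_mult_iff) auto
qed

text \<open>The sets where the truncated functions exceed \<open>t\<close> increase with the window
  to the set of the full operator, so the uniform window estimates pass to the limit.\<close>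

lemma (in rademacher_dyadic) strong_imp_weak:
  assumes "maximal_strong_type smul \<mu> D p" and p: "p > 1"
  shows "maximal_weak_type smul \<mu> D"
proof -
  obtain C' where C': "\<And>g. g \<in> Lp_vec \<mu> p \<Longrightarrow> Lp_norm \<mu> p (maximal g) \<le> ennreal C' * Lp_norm_vec \<mu> p g"
    using assms(1) unfolding maximal_strong_type_def by blast
  define C where "C = max C' 1"
  have C: "C > 0" by (simp add: C_def)
  define K where "K = C powr p"
  have K: "K > 0" using C by (simp add: K_def)
  have strong: "(\<integral>\<^sup>+x. ennreal_powr (maximal g x) p \<partial>\<mu>) \<le> ennreal K * (\<integral>\<^sup>+x. ennreal (norm (g x) powr p) \<partial>\<mu>)"
    if "g \<in> Lp_vec \<mu> p" for g
  proof -
    have "ennreal C' * Lp_norm_vec \<mu> p g \<le> ennreal C * Lp_norm_vec \<mu> p g"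
      by (intro mult_right_mono ennreal_leI) (auto simp: C_def)
    then have "Lp_norm \<mu> p (maximal g) \<le> ennreal C * Lp_norm_vec \<mu> p g" using C'[OF that] by (rule order_trans[rotated])
    then show ?thesis using p C by (simp add: Lp_norm_le_iff K_def)
  qed
  define c where "c = 2 + K * 2 powr (p - 1) * 4"
  have "emeasure \<mu> {x. maximal f x > ennreal t} \<le> ennreal (2 * c / t) * Lp_norm_vec \<mu> 1 f"
    if f: "f \<in> Lp_vec \<mu> 1" and t: "t > 0" for f t
  proof -
    have "strongly_measurable \<mu> f" using f by (simp add: Lp_vec_iff)
    then obtain g where g: "strongly_measurable \<mu> g" and gm: "(\<lambda>x. norm (g x)) \<in> borel_measurable \<mu>"
      and fg: "AE x in \<mu>. f x = g x" by (rule strongly_measurable_nice)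
    define G where "G = (\<integral>\<^sup>+x. ennreal (norm (g x)) \<partial>\<mu>)"
    have fG: "(\<integral>\<^sup>+x. ennreal (norm (f x)) \<partial>\<mu>) = G"
      unfolding G_def by (intro nn_integral_cong_AE) (use fg in \<open>eventually_elim, simp\<close>)
    then have fin: "G < \<infinity>" using f by (simp add: Lp_vec_iff)
    have "(\<integral>\<^sup>+y. ennreal (norm (g y)) * indicator (cube k x) y \<partial>\<mu>) < \<infinity>" for k x
    proof -
      have "(\<integral>\<^sup>+y. ennreal (norm (g y)) * indicator (cube k x) y \<partial>\<mu>) \<le> G"
        unfolding G_def by (intro nn_integral_mono) (simp add: indicator_def)
      then show ?thesis using fin by (rule le_less_trans)
    qed
    then have loc: "loc_integrable g" by (intro loc_integrableI g)
    have trunc: "emeasure \<mu> {x. ennreal t < truncated b n g x} \<le> ennreal (2 * c / t) * G" for b n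
    proof -
      \<comment> \<open>The stopping height is \<open>t / 2\<close> since the estimate concerns
        twice that height; hence the factor 2 in \<open>2 * c / t\<close>.\<close>
      interpret dyadic_stopping smul \<mu> D g b "t / 2"
        by unfold_locales (use loc gm t in auto)
      have "emeasure \<mu> {x. ennreal (2 * (t / 2)) < truncated b n g x} \<le> ennreal (c / (t / 2)) * G"
        unfolding c_def G_def by (rule emeasure_truncated_le[OF strong K p]) (use fin in \<open>simp_all add: G_def\<close>)
      then show ?thesis by (simp add: mult.commute)
    qed
    have "{x. maximal f x > ennreal t} = (\<Union>i. {x. ennreal t < truncated (- int i) (2 * i) g x})"
      unfolding maximal_cong_AE[OF fg] maximal_SUP by (auto simp: less_SUP_iff)
    also have "emeasure \<mu> \<dots> = (SUP i. emeasure \<mu> {x. ennreal t < truncated (- int i) (2 * i) g x})"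
    proof (rule SUP_emeasure_incseq[symmetric])
      have "{x\<in>space \<mu>. ennreal t < truncated (- int i) (2 * i) g x} \<in> sets \<mu>" for i by measurable
      then show "range (\<lambda>i. {x. ennreal t < truncated (- int i) (2 * i) g x}) \<subseteq> sets \<mu>" by auto
      show "incseq (\<lambda>i. {x. ennreal t < truncated (- int i) (2 * i) g x})"
        using incseqD[OF incseq_truncated[of g]] unfolding incseq_def by (blast intro: less_le_trans)
    qed
    also have "\<dots> \<le> ennreal (2 * c / t) * G" by (intro SUP_least trunc)
    finally show ?thesis by (simp add: Lp_norm_vec_1 fG)
  qed
  then show ?thesis unfolding maximal_weak_type_def by blast
qed

theorem theorem5:
  fixes smul :: "'k::{real_normed_field, euclidean_space} \<Rightarrow> 'a::banach \<Rightarrow> 'a"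
    and \<mu> :: "(real ^ 'n) measure"
    and D :: "int \<Rightarrow> (real ^ 'n) set set"
  assumes "banach_scaling smul"
    and "locally_finite_borel \<mu>"
    and "dyadic_system D"
  shows "((\<forall>p>1. maximal_strong_type smul \<mu> D p) \<longleftrightarrow> (\<exists>p>1. maximal_strong_type smul \<mu> D p)) \<and>
         ((\<exists>p>1. maximal_strong_type smul \<mu> D p) \<longleftrightarrow> maximal_weak_type smul \<mu> D)"
proof -
  interpret rademacher_dyadic smul \<mu> D
    by unfold_locales (rule assms)+
  \<comment> \<open>The exponent 2 witnesses that the range of exponents is nonempty; the way back
    from one exponent to all passes through the weak type.\<close>
  have "\<exists>p>1. maximal_strong_type smul \<mu> D p" if "\<forall>p>1. maximal_strong_type smul \<mu> D p"
    using that[rule_format, of 2] by (intro exI[of _ 2]) simp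
  then show ?thesis using weak_imp_strong strong_imp_weak by blast
qed

end
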